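(* Let $n\geq 2$, let $V\subset\mathbb{R}^n$ be a nonempty open set, and let $f\in\mathcal{E}'(\mathbb{R}^n)\cap\mathcal{A}_V$ or $f\in C_\infty(\mathbb{R}^n)\cap\mathcal{A}_V$. If $X_0f=0$ on all lines intersecting $V$, then $f=0$.
   Context: All functions and distributions are complex valued. $\mathcal{E}'(\mathbb{R}^n)$ is the space of compactly supported distributions, and $C_\infty(\mathbb{R}^n)$ is the set of all continuous functions on $\mathbb{R}^n$ which decay faster than any polynomial at infinity (i.e. $\sup_x(1+|x|)^k|f(x)|<\infty$ for every $k\in\mathbb{N}$). For $r\in\mathbb{R}$, $H^r(\mathbb{R}^n)=\{f\in\mathscr{S}'(\mathbb{R}^n):(1+|\cdot|^2)^{r/2}\hat f\in L^2(\mathbb{R}^n)\}$, and $H^{-\infty}(\mathbb{R}^n)=\bigcup_{r\in\mathbb{R}}H^r(\mathbb{R}^n)$. $\mathcal{P}$ is the set of all nonzero polynomials on $\mathbb{R}^n$ with complex coefficients; $P(\xi)=\sum_{|\alpha|\leq m}a_\alpha\xi^\alpha\in\mathcal{P}$ induces the constant coefficient operator $P(D)=\sum_{|\alpha|\leq m}a_\alpha D^\alpha$, $D^\alpha=D_1^{\alpha_1}\cdots D_n^{\alpha_n}$, $D_j=-i\partial_j$, acting on distributions. For a nonempty open set $V\subset\mathbb{R}^n$ the set of admissible functions is $$\mathcal{A}_V=\{f\in H^{-\infty}(\mathbb{R}^n): P(D)f|_V=0\text{ for some }P\in\mathcal{P}\},$$ where $|_V$ denotes restriction of distributions to $V$.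 Oriented lines are parametrized by $\Gamma=\{(z,\theta):\theta\in S^{n-1},\ z\in\theta^\perp\}$, where $(z,\theta)$ corresponds to the line $\{z+s\theta:s\in\mathbb{R}\}$. The X-ray transform of scalar fields is $X_0f(z,\theta)=\int_{\mathbb{R}}f(z+s\theta)\,ds$ for $f\in C_\infty(\mathbb{R}^n)$. With $X_0^*\psi(x)=\int_{S^{n-1}}\psi(x-(x\cdot\theta)\theta,\theta)\,d\theta$ for $\psi\in C^\infty(\Gamma)$, it is defined on $f\in\mathcal{E}'(\mathbb{R}^n)$ as $X_0f\in\mathcal{E}'(\Gamma)$ by $\langle X_0f,\varphi\rangle=\langle f,X_0^*\varphi\rangle$ for all $\varphi\in C^\infty(\Gamma)$. For $f\in C_\infty(\mathbb{R}^n)$, "$X_0f=0$ on all lines intersecting $V$" means $X_0f(z,\theta)=0$ for every $(z,\theta)\in\Gamma$ whose line meets $V$; for $f\in\mathcal{E}'(\mathbb{R}^n)$ it means that the distribution $X_0f$ vanishes on the open subset of $\Gamma$ consisting of the lines meeting $V$, i.e. $\langle X_0f,\varphi\rangle=0$ for all $\varphi\in C_c^\infty(\Gamma)$ supported in that open set. *)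

theory Defs
  imports "HOL-Analysis.Analysis" "HOL-Library.Poly_Mapping"
begin

section \<open>Smooth functions and iterated derivatives\<close>

definition dir_deriv :: "'a::euclidean_space \<Rightarrow> ('a \<Rightarrow> complex) \<Rightarrow> 'a \<Rightarrow> complex" where
  "dir_deriv b f = (\<lambda>x. frechet_derivative f (at x) b)"

definition iter_deriv :: "'a::euclidean_space list \<Rightarrow> ('a \<Rightarrow> complex) \<Rightarrow> 'a \<Rightarrow> complex" where
  "iter_deriv bs f = foldr dir_deriv bs f"

text \<open>
  Intended for open \<open>S\<close>: all iterated partial derivatives exist and are (Frechet) differentiable,
  hence continuous, on \<open>S\<close>.
\<close>
definition smooth_on :: "'a::euclidean_space set \<Rightarrow> ('a \<Rightarrow> complex) \<Rightarrow> bool" where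
  "smooth_on S f \<longleftrightarrow> (\<forall>bs \<in> lists Basis. \<forall>x\<in>S. iter_deriv bs f differentiable (at x))"

definition smooth_functions :: "('a::euclidean_space \<Rightarrow> complex) set" where
  "smooth_functions = {\<phi>. smooth_on UNIV \<phi>}"

definition test_functions :: "'a::euclidean_space set \<Rightarrow> ('a \<Rightarrow> complex) set" where
  "test_functions V = {\<phi>. smooth_on UNIV \<phi> \<and> compact (closure {x. \<phi> x \<noteq> 0})
                          \<and> closure {x. \<phi> x \<noteq> 0} \<subseteq> V}"

definition schwartz_functions :: "('a::euclidean_space \<Rightarrow> complex) set" where
  "schwartz_functions = {\<phi>. smooth_on UNIV \<phi> \<and>
     (\<forall>k. \<forall>bs \<in> lists Basis. bounded (range (\<lambda>x. (1 + norm x) ^ k * norm (iter_deriv bs \<phi> x))))}"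

section \<open>Distributions\<close>

text \<open>
  A distribution is a functional on complex-valued functions of which only the values on the relevant
  space of test functions matter: on the Schwartz functions for a tempered distribution, and on all
  smooth functions for a compactly supported one. Since test functions are Schwartz functions
  and Schwartz functions are smooth, the inclusion of the compactly supported distributions in the
  tempered ones, and the restriction of a distribution to an open set, do not change the functional.
\<close>
type_synonym 'a distribution = "('a \<Rightarrow> complex) \<Rightarrow> complex"

definition linear_functional_on :: "('a \<Rightarrow> complex) set \<Rightarrow> 'a distribution \<Rightarrow> bool" where
  "linear_functional_on F T \<longleftrightarrow>
     (\<forall>\<phi>\<in>F. \<forall>\<psi>\<in>F. T (\<lambda>x. \<phi> x + \<psi> x) = T \<phi> + T \<psi>) \<and>
     (\<forall>\<phi>\<in>F. \<forall>c. T (\<lambda>x. c * \<phi> x) = c * T \<phi>)"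

definition schwartz_seminorm :: "nat \<Rightarrow> ('a::euclidean_space \<Rightarrow> complex) \<Rightarrow> real" where
  "schwartz_seminorm N \<phi> =
     (\<Sum>bs | bs \<in> lists Basis \<and> length bs \<le> N. SUP x. (1 + norm x) ^ N * norm (iter_deriv bs \<phi> x))"

definition tempered_distributions :: "'a::euclidean_space distribution set" where
  "tempered_distributions = {T. linear_functional_on schwartz_functions T \<and>
     (\<exists>C N. \<forall>\<phi>\<in>schwartz_functions. norm (T \<phi>) \<le> C * schwartz_seminorm N \<phi>)}"

definition compact_seminorm :: "'a::euclidean_space set \<Rightarrow> nat \<Rightarrow> ('a \<Rightarrow> complex) \<Rightarrow> real" where
  "compact_seminorm K N \<phi> =
     (\<Sum>bs | bs \<in> lists Basis \<and> length bs \<le> N. SUP x\<in>K. norm (iter_deriv bs \<phi> x))"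

text \<open>
  The compactly supported distributions as the continuous dual of the space of all smooth functions;
  the support of \<open>u\<close> is contained in the set \<open>K\<close> of the estimate.
\<close>
definition compactly_supported_distributions :: "'a::euclidean_space distribution set" where
  "compactly_supported_distributions = {u. linear_functional_on smooth_functions u \<and>
     (\<exists>K C N. compact K \<and> K \<noteq> {} \<and> (\<forall>\<phi>\<in>smooth_functions. norm (u \<phi>) \<le> C * compact_seminorm K N \<phi>))}"

definition distribution_of :: "('a::euclidean_space \<Rightarrow> complex) \<Rightarrow> 'a distribution" where
  "distribution_of f = (\<lambda>\<phi>. \<integral>x. f x * \<phi> x \<partial>lborel)"

section \<open>Sobolev spaces\<close>

definition fourier :: "('a::euclidean_space \<Rightarrow> complex) \<Rightarrow> 'a \<Rightarrow> complex" where
  "fourier \<phi> = (\<lambda>\<xi>. \<integral>x. exp (- \<i> * complex_of_real (x \<bullet> \<xi>)) * \<phi> x \<partial>lborel)"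

definition fourier_dist :: "'a::euclidean_space distribution \<Rightarrow> 'a distribution" where
  "fourier_dist T = (\<lambda>\<phi>. T (fourier \<phi>))"

definition mult_dist :: "('a \<Rightarrow> complex) \<Rightarrow> 'a distribution \<Rightarrow> 'a distribution" where
  "mult_dist m T = (\<lambda>\<phi>. T (\<lambda>x. m x * \<phi> x))"

definition L2_functions :: "('a::euclidean_space \<Rightarrow> complex) set" where
  "L2_functions = {g. g \<in> borel_measurable lborel \<and> integrable lborel (\<lambda>x. (norm (g x))\<^sup>2)}"

definition sobolev :: "real \<Rightarrow> 'a::euclidean_space distribution set" where
  "sobolev r = {T \<in> tempered_distributions.
     \<exists>g\<in>L2_functions. \<forall>\<phi>\<in>schwartz_functions.
       mult_dist (\<lambda>\<xi>. complex_of_real ((1 + (norm \<xi>)\<^sup>2) powr (r / 2))) (fourier_dist T) \<phi>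
         = distribution_of g \<phi>}"

definition sobolev_minus_infinity :: "'a::euclidean_space distribution set" where
  "sobolev_minus_infinity = (\<Union>r. sobolev r)"

section \<open>Constant coefficient operators and admissible functions\<close>

text \<open>
  A polynomial on \<open>real ^ 'n\<close> is a finitely supported family of coefficients indexed by
  multi-indices \<open>'n \<Rightarrow>\<^sub>0 nat\<close>.
\<close>
type_synonym 'n cpoly = "('n \<Rightarrow>\<^sub>0 nat) \<Rightarrow>\<^sub>0 complex"

definition D_coord :: "'n::finite \<Rightarrow> (real ^ 'n \<Rightarrow> complex) \<Rightarrow> real ^ 'n \<Rightarrow> complex" where
  "D_coord j \<phi> = (\<lambda>x. - \<i> * dir_deriv (axis j 1) \<phi> x)"

text \<open>
  The index type carries no order, so an enumeration of it fixes the order in which the operators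
  \<open>D_coord j\<close> are composed; on smooth functions they commute and the choice is immaterial.
\<close>
definition coordinates :: "'n::finite list" where
  "coordinates = (SOME js. distinct js \<and> set js = UNIV)"

definition D_multi :: "('n::finite \<Rightarrow>\<^sub>0 nat) \<Rightarrow> (real ^ 'n \<Rightarrow> complex) \<Rightarrow> real ^ 'n \<Rightarrow> complex" where
  "D_multi \<alpha> \<phi> = foldr (\<lambda>j. D_coord j ^^ Poly_Mapping.lookup \<alpha> j) coordinates \<phi>"

definition D_multi_dist :: "('n::finite \<Rightarrow>\<^sub>0 nat) \<Rightarrow> (real ^ 'n) distribution \<Rightarrow> (real ^ 'n) distribution" where
  "D_multi_dist \<alpha> T = (\<lambda>\<phi>. (- 1) ^ (\<Sum>j\<in>UNIV. Poly_Mapping.lookup \<alpha> j) * T (D_multi \<alpha> \<phi>))"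

definition const_coeff_op :: "'n::finite cpoly \<Rightarrow> (real ^ 'n) distribution \<Rightarrow> (real ^ 'n) distribution" where
  "const_coeff_op P T = (\<lambda>\<phi>. \<Sum>\<alpha>\<in>Poly_Mapping.keys P. Poly_Mapping.lookup P \<alpha> * D_multi_dist \<alpha> T \<phi>)"

definition vanishes_on :: "'a::euclidean_space set \<Rightarrow> 'a distribution \<Rightarrow> bool" where
  "vanishes_on V T \<longleftrightarrow> (\<forall>\<phi>\<in>test_functions V. T \<phi> = 0)"

definition admissible :: "(real ^ 'n) set \<Rightarrow> (real ^ 'n) distribution set" where
  "admissible V = {T \<in> sobolev_minus_infinity. \<exists>P. P \<noteq> 0 \<and> vanishes_on V (const_coeff_op P T)}"

section \<open>The X-ray transform\<close>

definition rapidly_decaying_functions :: "('a::euclidean_space \<Rightarrow> complex) set" where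
  "rapidly_decaying_functions = {f. continuous_on UNIV f \<and>
     (\<forall>k::nat. bounded (range (\<lambda>x. (1 + norm x) ^ k * norm (f x))))}"

definition line_space :: "('a::euclidean_space \<times> 'a) set" where
  "line_space = {(z, \<theta>). norm \<theta> = 1 \<and> z \<bullet> \<theta> = 0}"

definition lines_meeting :: "'a::euclidean_space set \<Rightarrow> ('a \<times> 'a) set" where
  "lines_meeting V = {(z, \<theta>) \<in> line_space. \<exists>s. z + s *\<^sub>R \<theta> \<in> V}"

definition xray :: "('a::euclidean_space \<Rightarrow> complex) \<Rightarrow> 'a \<times> 'a \<Rightarrow> complex" where
  "xray f = (\<lambda>(z, \<theta>). \<integral>s. f (z + s *\<^sub>R \<theta>) \<partial>lborel)"

text \<open>
  Smoothness on \<open>line_space\<close> as an embedded submanifold of the ambient product space: local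
  extendability to smooth functions. Values outside \<open>line_space\<close> are irrelevant.
\<close>
definition smooth_line_functions :: "('a::euclidean_space \<times> 'a \<Rightarrow> complex) set" where
  "smooth_line_functions = {\<psi>. \<forall>p\<in>line_space. \<exists>U g. open U \<and> p \<in> U \<and> smooth_on U g \<and>
     (\<forall>q \<in> U \<inter> line_space. g q = \<psi> q)}"

text \<open>
  \<open>line_space\<close> is closed in the ambient space, so the closure below is the closure in \<open>line_space\<close>.
\<close>
definition line_test_functions :: "('a::euclidean_space \<times> 'a) set \<Rightarrow> ('a \<times> 'a \<Rightarrow> complex) set" where
  "line_test_functions W = {\<psi> \<in> smooth_line_functions.
     compact (closure {p \<in> line_space. \<psi> p \<noteq> 0}) \<and> closure {p \<in> line_space. \<psi> p \<noteq> 0} \<subseteq> W}"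

text \<open>
  Surface measure of the unit sphere by the cone formula: a set \<open>A\<close> has measure \<open>DIM('a)\<close> times
  the volume of the part of the unit ball whose radial projection \<open>sgn\<close> lies in \<open>A\<close>.
\<close>
definition sphere_measure :: "'a::euclidean_space measure" where
  "sphere_measure = scale_measure (of_nat DIM('a))
     (distr (restrict_space lborel (ball 0 1 - {0})) (restrict_space borel (sphere 0 1)) sgn)"

definition xray_adjoint :: "('a::euclidean_space \<times> 'a \<Rightarrow> complex) \<Rightarrow> 'a \<Rightarrow> complex" where
  "xray_adjoint \<psi> = (\<lambda>x. \<integral>\<theta>. \<psi> (x - (x \<bullet> \<theta>) *\<^sub>R \<theta>, \<theta>) \<partial>sphere_measure)"

definition xray_dist :: "'a::euclidean_space distribution \<Rightarrow> ('a \<times> 'a) distribution" where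
  "xray_dist u = (\<lambda>\<psi>. u (xray_adjoint \<psi>))"

end

theory Submission
  imports Defs "HOL-Real_Asymp.Real_Asymp" "HOL-Computational_Algebra.Polynomial"
begin

text \<open>
  The normal operator of the X-ray transform is convolution with the Riesz kernel \<open>norm w powr (1 - n)\<close>
  (lemma \<open>xray_adjoint_xray\<close>), that is, a multiple of \<open>(- \<Delta>) powr (- 1 / 2)\<close>. If the X-ray transform of \<open>f\<close>
  vanishes on all lines meeting \<open>V\<close>, then so does the Riesz potential of \<open>f\<close> on \<open>V\<close>. Convolution commutes with
  \<open>P(D)\<close>. Hence \<open>P(D) f\<close> and the Riesz potential of \<open>P(D) f\<close> both vanish on \<open>V\<close>, and regularizing with a test
  function \<open>\<eta>\<close> of small support gives an integrable continuous function \<open>h\<close> for which the same is true on a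
  slightly smaller open set.

  The core is a unique continuation principle for such \<open>h\<close>, theorem \<open>Riesz_potential_unique_continuation\<close>:
  if \<open>h\<close> and its Riesz potential vanish near \<open>c0\<close>, then \<open>h = 0\<close>. Because \<open>h\<close> vanishes near \<open>c0\<close>, the potential may
  be differentiated there under the integral. Repeated Laplacians of the kernel are nonzero multiples of
  \<open>norm w powr (1 - n - 2 * j)\<close>, so the integrals of \<open>h\<close> against all of these kernels, centred at any \<open>c\<close> near
  \<open>c0\<close>, are zero. The substitution \<open>\<rho> = (d / norm (y - c))\<^sup>2\<close> makes them the moments of a function of \<open>\<rho>\<close> in the unit
  interval, and by the Weierstrass theorem \<open>h\<close> integrates to zero against every Gaussian centred near \<open>c0\<close>. Gaussian
  means are analytic in the centre, so they vanish for all centres, and Gaussians concentrated at a point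
  recover the value of \<open>h\<close> there.

  Thus \<open>h = 0\<close> for every \<open>\<eta>\<close> of small support. The Fourier transform of \<open>h\<close> is the product of \<open>P(\<xi>)\<close> with the
  Fourier transforms of \<open>f\<close> and of the reflection of \<open>\<eta>\<close>. A nonzero polynomial does not vanish on any ball (lemma
  \<open>cpoly_nonzero_dense\<close>), so by continuity the Fourier transform of every regularization of \<open>f\<close> is zero, and so is
  the regularization, by injectivity of the Fourier transform (lemma \<open>zero_if_Fourier_transform_zero\<close>).
  Theorem \<open>vanishing_if_normal_operator_vanishes\<close> states this argument for an abstract functional.

  For a compactly supported distribution \<open>u\<close> the argument needs the exchange of \<open>u\<close> with an integral over
  translates of a test function (lemma \<open>integral_translates\<close>), and the fact that the X-ray transform of a
  test function on \<open>V\<close> is a test function on the lines meeting \<open>V\<close> (lemma \<open>xray_test_function\<close>).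
\<close>

section \<open>Parameter integrals, moments and localization\<close>

lemma norm_integral_le:
  fixes f :: "'x \<Rightarrow> 'b::{banach,second_countable_topology}"
  assumes "integrable M f" "integrable M g" "\<And>x. x \<in> space M \<Longrightarrow> norm (f x) \<le> g x"
  shows "norm (\<integral>x. f x \<partial>M) \<le> (\<integral>x. g x \<partial>M)"
  by (rule order_trans[OF integral_norm_bound]) (intro integral_mono integrable_norm assms)

text \<open>
  The Lipschitz bound \<open>w\<close> dominates all difference quotients of the integrand, so dominated convergence
  applies to them. The derivative of the integrand is a pointwise limit of such quotients, whence its
  measurability and integrability.
\<close>
lemma has_derivative_integral:
  fixes G :: "'a::euclidean_space \<Rightarrow> 'x \<Rightarrow> 'b::{banach,second_countable_topology}"
  assumes int: "\<And>y. y \<in> ball y0 r \<Longrightarrow> integrable M (G y)"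
    and der: "\<And>x. x \<in> space M \<Longrightarrow> ((\<lambda>y. G y x) has_derivative G' x) (at y0)"
    and lip: "\<And>x y. x \<in> space M \<Longrightarrow> y \<in> ball y0 r \<Longrightarrow> norm (G y x - G y0 x) \<le> w x * norm (y - y0)"
    and w: "integrable M w" and r: "0 < r"
  shows "((\<lambda>y. \<integral>x. G y x \<partial>M) has_derivative (\<lambda>v. \<integral>x. G' x v \<partial>M)) (at y0)"
    and "integrable M (\<lambda>x. G' x v)"
proof -
  have lin: "linear (G' x)" if "x \<in> space M" for x
    using der[OF that] by (rule has_derivative_linear)
  have *: "(\<lambda>x. G' x v) \<in> borel_measurable M \<and> (\<forall>x\<in>space M. norm (G' x v) \<le> w x * norm v)" for v
  proof -
    \<comment> \<open>Step sizes tending to \<open>0\<close> for which \<open>y0 + t n *\<^sub>R v\<close> stays in the ball of radius \<open>r\<close>.\<close>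
    define t where "t n = r / ((norm v + 1) * real (n + 1))" for n
    have t0: "t n > 0" for n
      unfolding t_def using r by (intro divide_pos_pos mult_pos_pos add_nonneg_pos) auto
    have tv: "norm (t n *\<^sub>R v) < r" for n
    proof -
      have "(norm v + 1) * 1 \<le> (norm v + 1) * real (n + 1)"
        by (intro mult_left_mono) auto
      then have "norm v < (norm v + 1) * real (n + 1)" by simp
      then have "r * norm v / ((norm v + 1) * real (n + 1)) < r"
        using r by (smt (verit) mult_less_cancel_left_pos norm_ge_zero pos_divide_less_eq)
      then show ?thesis using t0[of n] r by (simp add: t_def)
    qed
    have tl: "t \<longlonglongrightarrow> 0"
    proof -
      have "(\<lambda>n. (r / (norm v + 1)) * inverse (real (Suc n))) \<longlonglongrightarrow> (r / (norm v + 1)) * 0"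
        by (intro tendsto_intros LIMSEQ_inverse_real_of_nat)
      then show ?thesis by (simp add: t_def[abs_def] field_simps)
    qed
    define q where "q n x = (1 / t n) *\<^sub>R (G (y0 + t n *\<^sub>R v) x - G y0 x)" for n x
    have q_lim: "(\<lambda>n. q n x) \<longlonglongrightarrow> G' x v" if x: "x \<in> space M" for x
    proof -
      show ?thesis
      proof (cases "v = 0")
        case True
        then show ?thesis using linear_0[OF lin[OF x]] by (simp add: q_def)
      next
        case False
        have "(\<lambda>n. (1 / norm (t n *\<^sub>R v)) *\<^sub>R (G (y0 + t n *\<^sub>R v) x - (G y0 x + G' x (t n *\<^sub>R v)))) \<longlonglongrightarrow> 0"
        proof -
          have "\<forall>n. y0 + t n *\<^sub>R v \<in> UNIV - {y0}" using t0 False by (auto simp: less_imp_neq[symmetric])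
          moreover have "(\<lambda>n. y0 + t n *\<^sub>R v) \<longlonglongrightarrow> y0"
            using tendsto_add[OF tendsto_const[of y0] tendsto_scaleR[OF tl tendsto_const[of v]]] by simp
          moreover have "((\<lambda>y. (1 / norm (y - y0)) *\<^sub>R (G y x - (G y0 x + G' x (y - y0)))) \<longlongrightarrow> 0) (at y0)"
            using der[OF x] by (simp add: has_derivative_within)
          note * = this[unfolded tendsto_at_iff_sequentially, rule_format]
          ultimately have "((\<lambda>y. (1 / norm (y - y0)) *\<^sub>R (G y x - (G y0 x + G' x (y - y0)))) \<circ> (\<lambda>n. y0 + t n *\<^sub>R v)) \<longlonglongrightarrow> 0"
            by (intro *) auto
          then show ?thesis by (simp add: comp_def)
        qed
        then have "(\<lambda>n. norm v *\<^sub>R ((1 / norm (t n *\<^sub>R v)) *\<^sub>R (G (y0 + t n *\<^sub>R v) x - (G y0 x + G' x (t n *\<^sub>R v))))) \<longlonglongrightarrow> norm v *\<^sub>R 0"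
          by (intro tendsto_intros)
        also have "(\<lambda>n. norm v *\<^sub>R ((1 / norm (t n *\<^sub>R v)) *\<^sub>R (G (y0 + t n *\<^sub>R v) x - (G y0 x + G' x (t n *\<^sub>R v))))) = (\<lambda>n. q n x - G' x v)"
        proof
          fix n
          have "norm v *\<^sub>R ((1 / norm (t n *\<^sub>R v)) *\<^sub>R Z) = (1 / t n) *\<^sub>R Z" for Z :: 'b
            using t0[of n] False by simp
          from this[of "G (y0 + t n *\<^sub>R v) x - (G y0 x + G' x (t n *\<^sub>R v))"]
          show "norm v *\<^sub>R ((1 / norm (t n *\<^sub>R v)) *\<^sub>R (G (y0 + t n *\<^sub>R v) x - (G y0 x + G' x (t n *\<^sub>R v)))) = q n x - G' x v"
            using t0[of n] by (simp add: q_def linear_scale[OF lin[OF x]] algebra_simps del: norm_scaleR)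
        qed
        finally have "(\<lambda>n. q n x - G' x v) \<longlonglongrightarrow> 0" by simp
        then show ?thesis by (simp add: LIM_zero_iff)
      qed
    qed
    have "norm (q n x) \<le> w x * norm v" if x: "x \<in> space M" for n x
    proof -
      have "norm (G (y0 + t n *\<^sub>R v) x - G y0 x) \<le> w x * (t n * norm v)"
        using lip[OF x, of "y0 + t n *\<^sub>R v"] tv[of n] t0[of n] by (simp add: dist_norm)
      then have "norm (G (y0 + t n *\<^sub>R v) x - G y0 x) / t n \<le> w x * norm v"
        using t0[of n] by (simp add: pos_divide_le_eq mult_ac)
      then show ?thesis using t0[of n] by (simp add: q_def)
    qed
    then have "norm (G' x v) \<le> w x * norm v" if x: "x \<in> space M" for x
      using that by (intro Lim_bounded[OF tendsto_norm[OF q_lim[OF x]]]) auto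
    moreover have "(\<lambda>x. G' x v) \<in> borel_measurable M"
    proof (rule borel_measurable_LIMSEQ_metric[OF _ q_lim])
      show "q n \<in> borel_measurable M" for n
        unfolding q_def using tv[of n] r
        by (intro borel_measurable_scaleR borel_measurable_const borel_measurable_diff borel_measurable_integrable int)
           (auto simp: dist_norm)
    qed
    ultimately show ?thesis by blast
  qed
  have intG': "integrable M (\<lambda>x. G' x v)" for v
    by (rule Bochner_Integration.integrable_bound[of _ "\<lambda>x. w x * norm v"])
       (use * w in \<open>force intro!: AE_I2 intro: order_trans[OF _ abs_ge_self]\<close>)+
  then show "integrable M (\<lambda>x. G' x v)" .
  have bl: "bounded_linear (\<lambda>v. \<integral>x. G' x v \<partial>M)"
  proof (rule bounded_linear_intro[where K = "\<integral>x. w x \<partial>M"])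
    show "(\<integral>x. G' x (u + v) \<partial>M) = (\<integral>x. G' x u \<partial>M) + (\<integral>x. G' x v \<partial>M)" for u v
      by (subst Bochner_Integration.integral_add[symmetric])
         (auto intro!: intG' Bochner_Integration.integral_cong simp: linear_add[OF lin])
    show "(\<integral>x. G' x (s *\<^sub>R v) \<partial>M) = s *\<^sub>R (\<integral>x. G' x v \<partial>M)" for s v
    proof -
      have "(\<integral>x. G' x (s *\<^sub>R v) \<partial>M) = (\<integral>x. s *\<^sub>R G' x v \<partial>M)"
        by (intro Bochner_Integration.integral_cong) (auto simp: linear_scale[OF lin])
      then show ?thesis by simp
    qed
    show "norm (\<integral>x. G' x v \<partial>M) \<le> norm v * (\<integral>x. w x \<partial>M)" for v
    proof -
      have "norm (\<integral>x. G' x v \<partial>M) \<le> (\<integral>x. w x * norm v \<partial>M)"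
        by (rule norm_integral_le) (use * w intG' in auto)
      then show ?thesis by (simp add: mult.commute)
    qed
  qed
  have lim: "((\<lambda>y. (1 / norm (y - y0)) *\<^sub>R ((\<integral>x. G y x \<partial>M) - ((\<integral>x. G y0 x \<partial>M) + (\<integral>x. G' x (y - y0) \<partial>M)))) \<longlongrightarrow> 0) (at y0)"
    unfolding tendsto_at_iff_sequentially comp_def
  proof (intro allI impI)
    fix X :: "nat \<Rightarrow> 'a"
    assume X: "\<forall>i. X i \<in> UNIV - {y0}" "X \<longlonglongrightarrow> y0"
    define E where "E i x = (1 / norm (X i - y0)) *\<^sub>R (G (X i) x - (G y0 x + G' x (X i - y0)))" for i x
    obtain k where k: "\<And>i. i \<ge> k \<Longrightarrow> X i \<in> ball y0 r"
      using X(2) r by (metis LIMSEQ_def dist_commute mem_ball)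
    have "(\<lambda>i. \<integral>x. E (i + k) x \<partial>M) \<longlonglongrightarrow> (\<integral>x. 0 \<partial>M)"
    proof (rule integral_dominated_convergence)
      show "integrable M (\<lambda>x. 2 * w x)" using w by auto
      show "E (i + k) \<in> borel_measurable M" for i
        unfolding E_def using k[of "i + k"] r
        by (intro borel_measurable_scaleR borel_measurable_const borel_measurable_diff borel_measurable_add borel_measurable_integrable int intG')
           (auto)
      show "AE x in M. norm (E (i + k) x) \<le> 2 * w x" for i
      proof (rule AE_I2)
        fix x assume x: "x \<in> space M"
        have n0: "norm (X (i+k) - y0) > 0" using X(1) by auto
        have "norm (G (X (i+k)) x - (G y0 x + G' x (X (i+k) - y0)))
           \<le> norm (G (X (i+k)) x - G y0 x) + norm (G' x (X (i+k) - y0))"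
          by (metis diff_diff_eq norm_triangle_ineq4)
        also have "\<dots> \<le> w x * norm (X (i+k) - y0) + w x * norm (X (i+k) - y0)"
          using lip[OF x k[of "i+k"]] * x by (intro add_mono) auto
        finally have "norm (G (X (i+k)) x - (G y0 x + G' x (X (i+k) - y0))) / norm (X (i+k) - y0) \<le> 2 * w x"
          using n0 by (simp add: pos_divide_le_eq mult_ac)
        then show "norm (E (i + k) x) \<le> 2 * w x" by (simp add: E_def)
      qed
      show "AE x in M. (\<lambda>i. E (i + k) x) \<longlonglongrightarrow> 0"
      proof (rule AE_I2)
        fix x assume x: "x \<in> space M"
        have "(\<lambda>i. E i x) \<longlonglongrightarrow> 0"
          using der[OF x] X unfolding has_derivative_within tendsto_at_iff_sequentially comp_def E_def by blast
        then show "(\<lambda>i. E (i + k) x) \<longlonglongrightarrow> 0" by (rule LIMSEQ_ignore_initial_segment)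
      qed
    qed simp
    then have "(\<lambda>i. \<integral>x. E i x \<partial>M) \<longlonglongrightarrow> 0" by (auto dest: LIMSEQ_offset)
    moreover have "\<forall>\<^sub>F i in sequentially. (\<integral>x. E i x \<partial>M) = (1 / norm (X i - y0)) *\<^sub>R
        ((\<integral>x. G (X i) x \<partial>M) - ((\<integral>x. G y0 x \<partial>M) + (\<integral>x. G' x (X i - y0) \<partial>M)))"
      unfolding eventually_sequentially
    proof (intro exI[of _ k] allI impI)
      fix i assume i: "k \<le> i"
      have 1: "integrable M (G (X i))" "integrable M (G y0)" using int k[OF i] r by auto
      show "(\<integral>x. E i x \<partial>M) = (1 / norm (X i - y0)) *\<^sub>R
        ((\<integral>x. G (X i) x \<partial>M) - ((\<integral>x. G y0 x \<partial>M) + (\<integral>x. G' x (X i - y0) \<partial>M)))"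
        unfolding E_def using 1 intG' by (simp add: Bochner_Integration.integral_diff Bochner_Integration.integral_add)
    qed
    ultimately show "(\<lambda>i. (1 / norm (X i - y0)) *\<^sub>R
        ((\<integral>x. G (X i) x \<partial>M) - ((\<integral>x. G y0 x \<partial>M) + (\<integral>x. G' x (X i - y0) \<partial>M)))) \<longlonglongrightarrow> 0"
      by (rule Lim_transform_eventually)
  qed
  show "((\<lambda>y. \<integral>x. G y x \<partial>M) has_derivative (\<lambda>v. \<integral>x. G' x v \<partial>M)) (at y0)"
    using bl lim by (simp add: has_derivative_within)
qed

text \<open>
  By the Weierstrass theorem \<open>g\<close> is a uniform limit of polynomials on the range of \<open>\<rho>\<close>, and \<open>h\<close> is
  orthogonal to every polynomial in \<open>\<rho>\<close>.
\<close>
lemma moments_determine: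
  fixes h :: "'x \<Rightarrow> complex" and \<rho> :: "'x \<Rightarrow> real"
  assumes h: "integrable M h" and [measurable]: "\<rho> \<in> borel_measurable M"
    and rng: "\<And>x. x \<in> space M \<Longrightarrow> \<rho> x \<in> {0..1}"
    and mom: "\<And>k. (\<integral>x. h x * of_real (\<rho> x ^ k) \<partial>M) = 0"
    and g: "continuous_on {0..1} g"
  shows "(\<integral>x. h x * of_real (g (\<rho> x)) \<partial>M) = 0"
proof -
  have [measurable]: "h \<in> borel_measurable M" using h by auto
  have ihk: "integrable M (\<lambda>x. h x * of_real (\<rho> x ^ k))" for k
    by (rule Bochner_Integration.integrable_bound[OF h])
       (use rng in \<open>auto intro!: AE_I2 mult_left_le simp: norm_mult norm_power power_le_one\<close>)
  have zero_poly: "integrable M (\<lambda>x. h x * of_real (\<Sum>i\<le>n. a i * \<rho> x ^ i)) \<and>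
     (\<integral>x. h x * of_real (\<Sum>i\<le>n. a i * \<rho> x ^ i) \<partial>M) = 0" for a :: "nat \<Rightarrow> real" and n
  proof -
    have "(\<lambda>x. h x * of_real (\<Sum>i\<le>n. a i * \<rho> x ^ i)) = (\<lambda>x. \<Sum>i\<le>n. of_real (a i) * (h x * of_real (\<rho> x ^ i)))"
      by (simp add: sum_distrib_left mult_ac)
    then show ?thesis using ihk mom by (simp)
  qed
  \<comment> \<open>Clamping \<open>\<rho>\<close> to the unit interval exhibits \<open>g (\<rho> x)\<close> as a measurable function composed with a continuous one.\<close>
  define \<rho>' where "\<rho>' x = max 0 (min 1 (\<rho> x))" for x
  have gm: "(\<lambda>x. g (\<rho>' x)) \<in> borel_measurable M"
  proof -
    have "continuous_on UNIV (\<lambda>t. g (max 0 (min 1 t)))"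
      by (rule continuous_on_compose2[OF g]) (auto intro!: continuous_intros)
    then have "(\<lambda>t. g (max 0 (min 1 t))) \<in> borel_measurable borel" by (rule borel_measurable_continuous_onI)
    then show ?thesis unfolding \<rho>'_def by measurable
  qed
  have gm[measurable]: "(\<lambda>x. g (\<rho> x)) \<in> borel_measurable M"
    using gm by (rule measurable_cong[THEN iffD1, rotated]) (use rng in \<open>force simp: \<rho>'_def\<close>)
  obtain B where B: "\<And>t. t \<in> {0..1} \<Longrightarrow> \<bar>g t\<bar> \<le> B"
    using compact_imp_bounded[OF compact_continuous_image[OF g compact_Icc]]
    unfolding bounded_iff by (metis imageI real_norm_def)
  have ig: "integrable M (\<lambda>x. h x * of_real (g (\<rho> x)))"
  proof (rule Bochner_Integration.integrable_bound[of _ "\<lambda>x. norm (h x) * B"])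
    have "norm (h x * complex_of_real (g (\<rho> x))) \<le> norm (norm (h x) * B)" if "x \<in> space M" for x
    proof -
      have "norm (h x * complex_of_real (g (\<rho> x))) = norm (h x) * \<bar>g (\<rho> x)\<bar>" by (simp add: norm_mult)
      also have "\<dots> \<le> norm (h x) * B" using B[OF rng[OF that]] by (rule mult_left_mono) simp
      finally show ?thesis by simp
    qed
    then show "AE x in M. norm (h x * complex_of_real (g (\<rho> x))) \<le> norm (norm (h x) * B)" by (rule AE_I2)
  qed (use h in auto)
  have "norm (\<integral>x. h x * of_real (g (\<rho> x)) \<partial>M) \<le> e * (\<integral>x. norm (h x) \<partial>M)" if e: "e > 0" for e
  proof -
    obtain p where p: "real_polynomial_function p" "\<And>t. t \<in> {0..1} \<Longrightarrow> \<bar>g t - p t\<bar> < e"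
      using Stone_Weierstrass_real_polynomial_function[OF compact_Icc g e] by blast
    obtain a n where pn: "p = (\<lambda>t. \<Sum>i\<le>n. a i * t ^ i)"
      using real_polynomial_function_imp_sum[OF p(1)] by blast
    have "(\<integral>x. h x * of_real (g (\<rho> x)) \<partial>M) = (\<integral>x. h x * of_real (g (\<rho> x)) - h x * of_real (p (\<rho> x)) \<partial>M)"
      using zero_poly[where a=a and n=n] ig by (simp add: pn del: of_real_sum)
    also have "norm \<dots> \<le> (\<integral>x. e * norm (h x) \<partial>M)"
    proof (rule norm_integral_le)
      show "integrable M (\<lambda>x. h x * of_real (g (\<rho> x)) - h x * of_real (p (\<rho> x)))"
        using zero_poly[where a=a and n=n] ig by (simp add: pn del: of_real_sum)
      show "norm (h x * of_real (g (\<rho> x)) - h x * of_real (p (\<rho> x))) \<le> e * norm (h x)" if "x \<in> space M" for x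
      proof -
        have "norm (h x * of_real (g (\<rho> x)) - h x * of_real (p (\<rho> x))) = norm (h x) * \<bar>g (\<rho> x) - p (\<rho> x)\<bar>"
          by (metis norm_mult norm_of_real of_real_diff right_diff_distrib)
        also have "\<dots> \<le> norm (h x) * e"
          by (intro mult_left_mono) (use p(2)[OF rng[OF that]] in auto)
        finally show ?thesis by (simp add: mult.commute)
      qed
    qed (use h in auto)
    finally show ?thesis by simp
  qed
  moreover have "((\<lambda>e. e * (\<integral>x. norm (h x) \<partial>M)) \<longlongrightarrow> 0 * (\<integral>x. norm (h x) \<partial>M)) (at_right (0::real))"
    by (intro tendsto_intros)
  ultimately have "norm (\<integral>x. h x * of_real (g (\<rho> x)) \<partial>M) \<le> 0"
    by (intro tendsto_lowerbound[of "\<lambda>e. e * (\<integral>x. norm (h x) \<partial>M)" _ "at_right 0"])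
       (auto simp: eventually_at_filter)
  then show ?thesis by simp
qed

lemma continuous_integral_pos:
  fixes e :: "'a::euclidean_space \<Rightarrow> real"
  assumes cont: "continuous_on UNIV e" and int: "integrable lborel e" and nn: "\<And>y. e y \<ge> 0" and c: "e c > 0"
  shows "(\<integral>y. e y \<partial>lborel) > 0"
proof -
  have "(\<integral>y. e y \<partial>lborel) \<noteq> 0"
  proof
    assume "(\<integral>y. e y \<partial>lborel) = 0"
    then have "AE y in lborel. y \<notin> {y. e y \<noteq> 0}"
      using integral_nonneg_eq_0_iff_AE[OF int] nn by auto
    moreover have op: "open {y. e y \<noteq> 0}"
      using open_Collect_neq[OF cont continuous_on_const] .
    ultimately have "{y. e y \<noteq> 0} \<in> null_sets lborel"
      by (subst (asm) AE_iff_measurable[OF _ refl]) (auto intro!: null_setsI)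
    then have "negligible {y. e y \<noteq> 0}"
      unfolding negligible_iff_null_sets by (rule null_sets_completionI)
    then have "{y. e y \<noteq> 0} = {}" using op open_not_negligible by blast
    then show False using c by auto
  qed
  moreover have "(\<integral>y. e y \<partial>lborel) \<ge> 0" by (simp add: nn)
  ultimately show ?thesis by simp
qed

text \<open>
  If \<open>h c \<noteq> 0\<close>, then \<open>Re (cnj (h c) * h)\<close> is positive near \<open>c\<close>, and the integral against a function \<open>g\<close>
  concentrated there could not vanish.
\<close>
lemma continuous_zero_by_localization:
  fixes h :: "'a::euclidean_space \<Rightarrow> complex"
  assumes cont: "continuous_on UNIV h"
    and loc: "\<And>r. r > 0 \<Longrightarrow> \<exists>g. continuous_on UNIV g \<and> (\<forall>y. g y \<ge> (0::real)) \<and> g c > 0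
       \<and> (\<forall>y. y \<notin> ball c r \<longrightarrow> g y = 0) \<and> (\<integral>y. h y * of_real (g y) \<partial>lborel) = 0"
  shows "h c = 0"
proof (rule ccontr)
  assume hc: "h c \<noteq> 0"
  define H where "H y = Re (cnj (h c) * h y)" for y
  have "cnj (h c) * h c = of_real ((norm (h c))\<^sup>2)"
    by (metis complex_norm_square mult.commute)
  then have Hc: "H c > 0" using hc by (simp add: H_def)
  have contH: "continuous_on UNIV H" unfolding H_def by (intro continuous_intros cont)
  then have "isCont H c" by (simp add: continuous_on_eq_continuous_at)
  then obtain r where r: "r > 0" "\<And>y. y \<in> ball c r \<Longrightarrow> H y > 0"
  proof -
    have "\<forall>\<^sub>F y in nhds c. H y > 0"
      using \<open>isCont H c\<close> Hc by (metis isCont_def order_tendstoD(1) tendsto_at_iff_tendsto_nhds)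
    then show ?thesis using that by (auto simp: eventually_nhds_metric dist_commute)
  qed
  obtain g where g: "continuous_on UNIV g" "\<And>y. g y \<ge> 0" "g c > 0" "\<And>y. y \<notin> ball c r \<Longrightarrow> g y = 0"
     "(\<integral>y. h y * of_real (g y) \<partial>lborel) = 0"
    using loc[OF r(1)] by blast
  have nn: "H y * g y \<ge> 0" for y
    using r(2)[of y] g(2)[of y] g(4)[of y] by (cases "y \<in> ball c r") auto
  have cHg: "continuous_on UNIV (\<lambda>y. H y * g y)" by (intro continuous_intros contH g)
  have int: "integrable lborel (\<lambda>y. h y * of_real (g y))"
  proof -
    have "integrable lborel (\<lambda>y. indicator (cball c r) y *\<^sub>R (h y * of_real (g y)))"
      by (rule borel_integrable_compact) (auto intro!: continuous_intros continuous_on_subset[OF cont] continuous_on_subset[OF g(1)])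
    also have "(\<lambda>y. indicator (cball c r) y *\<^sub>R (h y * of_real (g y))) = (\<lambda>y. h y * of_real (g y))"
      using g(4) by (auto simp: fun_eq_iff indicator_def)
    finally show ?thesis .
  qed
  have Hg: "H y * g y = Re (cnj (h c) * (h y * of_real (g y)))" for y
    by (simp add: H_def algebra_simps)
  have iH: "integrable lborel (\<lambda>y. H y * g y)"
    unfolding Hg by (intro integrable_Re integrable_mult_right int)
  have "(\<integral>y. H y * g y \<partial>lborel) = Re (\<integral>y. cnj (h c) * (h y * of_real (g y)) \<partial>lborel)"
    unfolding Hg by (rule integral_Re) (intro integrable_mult_right int)
  also have "\<dots> = 0" using int g(5) by simp
  finally show False
    using continuous_integral_pos[OF cHg iH nn, of c] Hc g(3) by simp
qed

section \<open>Gaussian means and the Fourier transform\<close>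

text \<open>
  The Gaussians in question are the powers of \<open>\<rho> y = exp (- (norm (y - c))\<^sup>2)\<close>, a function with values in the
  unit interval, so \<open>moments_determine\<close> replaces them by arbitrary continuous functions of \<open>\<rho>\<close>; one that
  vanishes for \<open>\<rho> \<le> exp (- r\<^sup>2)\<close> is concentrated on the ball of radius \<open>r\<close> about \<open>c\<close>.
\<close>
lemma zero_if_Gaussian_means_zero:
  fixes h :: "'a::euclidean_space \<Rightarrow> complex"
  assumes cont: "continuous_on UNIV h" and int: "integrable lborel h"
    and z: "\<And>k::nat. (\<integral>y. h y * of_real (exp (- (real (Suc k) * (norm (y - c))\<^sup>2))) \<partial>lborel) = 0"
  shows "h c = 0"
proof (rule continuous_zero_by_localization[OF cont])
  fix r :: real assume r: "r > 0"
  define \<rho> where "\<rho> y = exp (- (norm (y - c))\<^sup>2)" for y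
  define \<tau> where "\<tau> = exp (- r\<^sup>2)"
  define g where "g y = \<rho> y * max 0 (\<rho> y - \<tau>)" for y
  have \<rho>k: "exp (- (real k * (norm (y - c))\<^sup>2)) = \<rho> y ^ k" for y k
    by (simp add: \<rho>_def exp_of_nat_mult[symmetric])
  have contr: "continuous_on UNIV \<rho>" unfolding \<rho>_def by (intro continuous_intros)
  then have [measurable]: "\<rho> \<in> borel_measurable borel" by (rule borel_measurable_continuous_onI)
  have r01: "\<rho> y \<in> {0..1}" for y by (simp add: \<rho>_def)
  have ih: "integrable lborel (\<lambda>y. h y * of_real (\<rho> y))"
    by (rule Bochner_Integration.integrable_bound[OF int])
       (use int r01 in \<open>auto intro!: AE_I2 mult_left_le simp: norm_mult\<close>)
  have "(\<integral>y. (h y * of_real (\<rho> y)) * of_real (max 0 (\<rho> y - \<tau>)) \<partial>lborel) = 0"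
  proof (rule moments_determine[OF ih, where g = "\<lambda>t. max 0 (t - \<tau>)"])
    show "(\<integral>y. h y * of_real (\<rho> y) * of_real (\<rho> y ^ k) \<partial>lborel) = 0" for k
      using z[of k] unfolding \<rho>k by (simp add: mult_ac)
  qed (use r01 in \<open>auto intro!: continuous_intros\<close>)
  then have "(\<integral>y. h y * of_real (g y) \<partial>lborel) = 0" by (simp add: g_def mult_ac)
  moreover have "continuous_on UNIV g" unfolding g_def by (intro continuous_intros contr)
  moreover have "g y \<ge> 0" for y using r01[of y] by (simp add: g_def)
  moreover have "g c > 0" using r by (simp add: g_def \<rho>_def \<tau>_def)
  moreover have "g y = 0" if "y \<notin> ball c r" for y
  proof -
    have "r\<^sup>2 \<le> (norm (y - c))\<^sup>2" using that r by (intro power_mono) (auto simp: dist_norm norm_minus_commute)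
    then show ?thesis by (simp add: g_def \<rho>_def \<tau>_def)
  qed
  ultimately show "\<exists>g. continuous_on UNIV g \<and> (\<forall>y. 0 \<le> (g y::real)) \<and> 0 < g c \<and> (\<forall>y. y \<notin> ball c r \<longrightarrow> g y = 0) \<and>
       (\<integral>y. h y * of_real (g y) \<partial>lborel) = 0" by blast
qed

text \<open>
  Expanding the exponential turns the integral into a power series in \<open>s\<close> that converges everywhere; its
  coefficients are determined by the values at small \<open>s\<close>.
\<close>
lemma exponential_means_zero:
  fixes H :: "'x \<Rightarrow> complex" and a :: "'x \<Rightarrow> real"
  assumes [measurable]: "H \<in> borel_measurable M" "a \<in> borel_measurable M"
    and int: "\<And>s. integrable M (\<lambda>x. norm (H x) * exp (s * \<bar>a x\<bar>))"
    and \<delta>: "0 < \<delta>" and z: "\<And>s. \<bar>s\<bar> < \<delta> \<Longrightarrow> (\<integral>x. H x * of_real (exp (s * a x)) \<partial>M) = 0"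
  shows "(\<integral>x. H x * of_real (exp (s * a x)) \<partial>M) = 0"
proof -
  define m where "m k = (\<integral>x. H x * of_real (a x ^ k / fact k) \<partial>M)" for k
  have ser: "(\<lambda>k. m k * of_real s ^ k) sums (\<integral>x. H x * of_real (exp (s * a x)) \<partial>M)" for s
  proof -
    define f where "f k x = H x * of_real ((s * a x) ^ k / fact k)" for k x
    have nf: "norm (f k x) = norm (H x) * (\<bar>s * a x\<bar> ^ k / fact k)" for k x
      by (simp add: f_def norm_mult norm_divide norm_power abs_mult)
    have expsum: "(\<lambda>k. \<bar>s * a x\<bar> ^ k / fact k) sums exp \<bar>s * a x\<bar>" for x
      using exp_converges[of "\<bar>s * a x\<bar>"] by (simp add: divide_inverse mult.commute)
    have part: "(\<Sum>k<n. \<bar>s * a x\<bar> ^ k / fact k) \<le> exp \<bar>s * a x\<bar>" for n x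
      using sum_le_suminf[OF sums_summable[OF expsum], of "{..<n}" x] sums_unique[OF expsum, of x] by auto
    have one: "\<bar>s * a x\<bar> ^ k / fact k \<le> exp \<bar>s * a x\<bar>" for k x
    proof -
      have "\<bar>s * a x\<bar> ^ k / fact k \<le> (\<Sum>k<Suc k. \<bar>s * a x\<bar> ^ k / fact k)"
        by (rule member_le_sum) auto
      then show ?thesis using part[of x "Suc k"] by linarith
    qed
    have int': "integrable M (\<lambda>x. norm (H x) * exp \<bar>s * a x\<bar>)"
      using int[of "\<bar>s\<bar>"] by (simp add: abs_mult)
    have fi: "integrable M (f k)" for k
    proof (rule Bochner_Integration.integrable_bound[OF int'])
      show "f k \<in> borel_measurable M" unfolding f_def by measurable
      show "AE x in M. norm (f k x) \<le> norm (norm (H x) * exp \<bar>s * a x\<bar>)"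
        unfolding nf using one by (intro AE_I2) (simp add: mult_left_mono del: times_divide_eq_right)
    qed
    have "(\<lambda>k. \<integral>x. f k x \<partial>M) sums (\<integral>x. suminf (\<lambda>k. f k x) \<partial>M)"
    proof (rule sums_integral[OF fi])
      show "AE x in M. summable (\<lambda>k. norm (f k x))"
        unfolding nf using sums_summable[OF expsum] by (intro AE_I2 summable_mult)
      show "summable (\<lambda>k. \<integral>x. norm (f k x) \<partial>M)"
      proof (rule summableI_nonneg_bounded)
        fix n
        have "(\<Sum>k<n. \<integral>x. norm (f k x) \<partial>M) = (\<integral>x. (\<Sum>k<n. norm (f k x)) \<partial>M)"
          by (rule Bochner_Integration.integral_sum[symmetric]) (intro integrable_norm fi)
        also have "\<dots> \<le> (\<integral>x. norm (H x) * exp \<bar>s * a x\<bar> \<partial>M)"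
        proof (rule integral_mono[OF _ int'])
          show "integrable M (\<lambda>x. \<Sum>k<n. norm (f k x))"
            by (intro Bochner_Integration.integrable_sum integrable_norm fi)
          show "(\<Sum>k<n. norm (f k x)) \<le> norm (H x) * exp \<bar>s * a x\<bar>" for x
            unfolding nf sum_distrib_left[symmetric] using part by (rule mult_left_mono) simp
        qed
        finally show "(\<Sum>k<n. \<integral>x. norm (f k x) \<partial>M) \<le> (\<integral>x. norm (H x) * exp \<bar>s * a x\<bar> \<partial>M)" .
      qed simp
    qed
    moreover have "suminf (\<lambda>k. f k x) = H x * of_real (exp (s * a x))" for x
    proof -
      have "(\<lambda>k. (s * a x) ^ k / fact k) sums exp (s * a x)"
        using exp_converges[of "s * a x"] by (simp add: divide_inverse mult.commute)
      then have "(\<lambda>k. H x * of_real ((s * a x) ^ k / fact k)) sums (H x * of_real (exp (s * a x)))"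
        by (intro sums_mult sums_of_real)
      then show ?thesis unfolding f_def by (rule sums_unique[symmetric])
    qed
    moreover have "(\<integral>x. f k x \<partial>M) = m k * of_real s ^ k" for k
    proof -
      have "f k = (\<lambda>x. (H x * of_real (a x ^ k / fact k)) * of_real s ^ k)"
        by (auto simp: f_def fun_eq_iff power_mult_distrib)
      then show ?thesis by (simp add: m_def)
    qed
    ultimately show ?thesis by simp
  qed
  \<comment> \<open>Once the lower coefficients vanish, dividing by \<open>s ^ k\<close> and letting \<open>s\<close> tend to \<open>0\<close> isolates \<open>m k\<close>.\<close>
  have m0: "m k = 0" for k
  proof (induction k rule: less_induct)
    case (less k)
    define q where "q j = m (j + k)" for j
    have qs: "(\<lambda>j. q j * of_real s ^ j) sums 0" if s: "0 < \<bar>s\<bar>" "\<bar>s\<bar> < \<delta>" for s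
    proof -
      have "(\<lambda>j. m j * of_real s ^ j) sums 0" using ser[of s] z[OF s(2)] by simp
      then have "(\<lambda>j. m (j + k) * of_real s ^ (j + k)) sums (0 - (\<Sum>j<k. m j * of_real s ^ j))"
        by (subst sums_iff_shift) simp
      then have "(\<lambda>j. m (j + k) * of_real s ^ (j + k) / of_real s ^ k) sums (0 / of_real s ^ k)"
        using less by (intro sums_divide) simp
      moreover have "m (j + k) * of_real s ^ (j + k) / of_real s ^ k = q j * of_real s ^ j" for j
        using s by (simp add: q_def power_add)
      ultimately show ?thesis by simp
    qed
    have summ: "summable (\<lambda>j. q j * of_real s ^ j)" if s: "s = \<delta> / 2" for s
      using qs[of s] \<delta> s by (auto simp: sums_iff)
    have "isCont (\<lambda>x. suminf (\<lambda>j. q j * x ^ j)) 0"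
      by (rule isCont_powser[OF summ[OF refl]]) (use \<delta> in auto)
    then have lim: "((\<lambda>x. suminf (\<lambda>j. q j * x ^ j)) \<longlongrightarrow> q 0) (at 0)" by (simp add: isCont_def)
    have "((\<lambda>s. suminf (\<lambda>j. q j * of_real s ^ j)) \<longlongrightarrow> q 0) (at_right (0::real))"
    proof (rule filterlim_compose[OF lim])
      show "filterlim complex_of_real (at 0) (at_right 0)"
        unfolding filterlim_at
        by (auto simp: eventually_at_filter intro!: tendsto_eq_intros)
    qed
    moreover have "((\<lambda>s. suminf (\<lambda>j. q j * of_real s ^ j)) \<longlongrightarrow> 0) (at_right (0::real))"
    proof (rule tendsto_eventually)
      have "\<forall>\<^sub>F s in at_right (0::real). s \<in> {0<..<\<delta>}"
        using \<delta> by (intro eventually_at_right_real)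
      then show "\<forall>\<^sub>F s in at_right (0::real). (suminf (\<lambda>j. q j * of_real s ^ j)) = 0"
        by eventually_elim (use qs in \<open>auto simp: sums_iff\<close>)
    qed
    ultimately have "q 0 = 0" using tendsto_unique trivial_limit_at_right_real by blast
    then show ?case by (simp add: q_def)
  qed
  show ?thesis using ser[of s] m0 by (simp add: sums_iff)
qed

text \<open>
  These trigonometric polynomials are bounded by \<open>1\<close>, which makes dominated convergence available.
\<close>
lemma cos_power_tendsto_Gaussian: "(\<lambda>m. cos (x / sqrt (real m)) ^ m) \<longlonglongrightarrow> exp (- x\<^sup>2 / 2)"
proof -
  have pos: "(\<lambda>m. cos (x / sqrt (real m)) ^ m) \<longlonglongrightarrow> exp (- x\<^sup>2 / 2)" if "x > 0" for x :: real
    using that by (real_asymp simp: power2_eq_square)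
  show ?thesis
  proof (cases "x = 0")
    case False
    have "cos (\<bar>x\<bar> / sqrt (real m)) = cos (x / sqrt (real m))" for m
      by (cases "x \<ge> 0") auto
    then show ?thesis using pos[of "\<bar>x\<bar>"] False by simp
  qed simp
qed

text \<open>
  Injectivity of the Fourier transform without an inversion formula: a function whose transform vanishes
  is orthogonal to all trigonometric polynomials, in particular to the products of cosine powers that
  converge boundedly to a Gaussian.
\<close>
lemma zero_if_Fourier_transform_zero:
  fixes h :: "'a::euclidean_space \<Rightarrow> complex"
  assumes cont: "continuous_on UNIV h" and int: "integrable lborel h"
    and z: "\<And>\<xi>. (\<integral>y. h y * cis (- (y \<bullet> \<xi>)) \<partial>lborel) = 0"
  shows "h c = 0"
proof -
  \<comment> \<open>The class of bounded functions orthogonal to every modulation of \<open>h\<close> is closed under multiplication by cosines.\<close>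
  define good where "good P \<longleftrightarrow> P \<in> borel_measurable borel \<and> (\<forall>y. \<bar>P y\<bar> \<le> 1) \<and>
     (\<forall>\<xi>. (\<integral>y. h y * cis (- (y \<bullet> \<xi>)) * of_real (P y) \<partial>lborel) = 0)" for P :: "'a \<Rightarrow> real"
  have [measurable]: "h \<in> borel_measurable borel" using int by auto
  have [measurable]: "(\<lambda>y. cis (- (y \<bullet> \<xi>))) \<in> borel_measurable borel" for \<xi> :: 'a
    by (intro borel_measurable_continuous_onI continuous_intros)
  have gi: "integrable lborel (\<lambda>y. h y * cis (- (y \<bullet> \<xi>)) * of_real (P y))"
    if [measurable]: "P \<in> borel_measurable borel" and "\<And>y. \<bar>P y\<bar> \<le> 1" for P \<xi>
    by (rule Bochner_Integration.integrable_bound[OF int])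
       (use that in \<open>auto simp: norm_mult intro!: AE_I2 mult_left_le\<close>)
  have step: "good (\<lambda>y. P y * cos (y \<bullet> a + \<phi>))" if "good P" for P a \<phi>
  proof -
    have [measurable]: "P \<in> borel_measurable borel" and b: "\<And>y. \<bar>P y\<bar> \<le> 1"
      and z: "\<And>\<xi>. (\<integral>y. h y * cis (- (y \<bullet> \<xi>)) * of_real (P y) \<partial>lborel) = 0"
      using that by (auto simp: good_def)
    have "(\<integral>y. h y * cis (- (y \<bullet> \<xi>)) * of_real (P y * cos (y \<bullet> a + \<phi>)) \<partial>lborel) = 0" for \<xi>
    proof -
      have *: "h y * cis (- (y \<bullet> \<xi>)) * of_real (P y * cos (y \<bullet> a + \<phi>)) =
          (cis \<phi> / 2) * (h y * cis (- (y \<bullet> (\<xi> - a))) * of_real (P y)) +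
          (cis (-\<phi>) / 2) * (h y * cis (- (y \<bullet> (\<xi> + a))) * of_real (P y))" for y
      proof -
        have e1: "cis (- (y \<bullet> (\<xi> - a))) = cis (- (y \<bullet> \<xi>)) * cis (y \<bullet> a)"
          and e2: "cis (- (y \<bullet> (\<xi> + a))) = cis (- (y \<bullet> \<xi>)) * cis (- (y \<bullet> a))"
          by (simp_all add: cis_mult inner_diff_right inner_add_right)
        have "of_real (cos t) = (cis t + cis (- t)) / 2" for t
          by (simp add: complex_eq_iff)
        from this[of "y \<bullet> a + \<phi>"]
        have "of_real (cos (y \<bullet> a + \<phi>)) = (cis (y \<bullet> a + \<phi>) + cis (- (y \<bullet> a) + (- \<phi>))) / 2"
          by (simp only: minus_add_distrib)
        then have e3: "of_real (cos (y \<bullet> a + \<phi>)) = (cis (y \<bullet> a) * cis \<phi> + cis (- (y \<bullet> a)) * cis (- \<phi>)) / 2"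
          by (simp only: cis_mult)
        have "X * U * (p * ((A * F + B * G) / 2)) = (F / 2) * (X * (U * A) * p) + (G / 2) * (X * (U * B) * p)"
          for X U A B F G p :: complex by (simp add: field_simps)
        then show ?thesis unfolding e1 e2 e3 of_real_mult by blast
      qed
      show ?thesis unfolding *
        using gi[of P] b z by (subst Bochner_Integration.integral_add) (auto intro!: integrable_mult_right)
    qed
    moreover have "\<bar>P y * cos (y \<bullet> a + \<phi>)\<bar> \<le> 1" for y
      using mult_mono[OF b[of y] abs_cos_le_one[of "y \<bullet> a + \<phi>"]] by (simp add: abs_mult)
    ultimately show ?thesis by (auto simp: good_def)
  qed
  have good1: "good (\<lambda>_. 1)" using z by (simp add: good_def)
  have pow: "good (\<lambda>y. P y * cos (y \<bullet> a + \<phi>) ^ m)" if "good P" for P a \<phi> m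
    using that
  proof (induction m)
    case (Suc m)
    then show ?case using step[OF Suc.IH[OF Suc.prems], of a \<phi>] by (simp add: mult_ac)
  qed simp
  have prd: "good (\<lambda>y. \<Prod>b\<in>B. cos (y \<bullet> a b + \<phi> b) ^ m)" if "finite B" for B :: "'a set" and a \<phi> m
    using that
  proof induction
    case (insert b B)
    then show ?case using pow[OF insert.IH, where a="a b" and \<phi>="\<phi> b"] by (simp add: mult_ac)
  qed (simp add: good1)
  show ?thesis
  proof (rule zero_if_Gaussian_means_zero[OF cont int])
    fix k
    \<comment> \<open>With this scale \<open>exp (- (t * x)\<^sup>2 / 2)\<close> is the Gaussian with exponent \<open>Suc k\<close>.\<close>
    define t where "t = sqrt (2 * real (Suc k))"
    define P where "P m y = (\<Prod>b\<in>Basis. cos (t * ((y - c) \<bullet> b) / sqrt (real m)) ^ m)" for m and y :: 'a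
    have gP: "good (P m)" for m
    proof -
      have "P m = (\<lambda>y. \<Prod>b\<in>Basis. cos (y \<bullet> ((t / sqrt (real m)) *\<^sub>R b) + (- (t * (c \<bullet> b) / sqrt (real m)))) ^ m)"
        by (intro ext) (simp add: P_def inner_diff_left algebra_simps diff_divide_distrib)
      then show ?thesis by (simp only: prd[OF finite_Basis])
    qed
    have Plim: "(\<lambda>m. P m y) \<longlonglongrightarrow> exp (- (real (Suc k) * (norm (y - c))\<^sup>2))" for y
    proof -
      have "(\<lambda>m. P m y) \<longlonglongrightarrow> (\<Prod>b\<in>Basis. exp (- (t * ((y - c) \<bullet> b))\<^sup>2 / 2))"
        unfolding P_def by (intro tendsto_prod cos_power_tendsto_Gaussian)
      also have "(\<Prod>b\<in>Basis. exp (- (t * ((y - c) \<bullet> b))\<^sup>2 / 2)) = exp (\<Sum>b\<in>Basis. - (t * ((y - c) \<bullet> b))\<^sup>2 / 2)"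
        by (rule exp_sum[symmetric]) simp
      also have "(\<Sum>b\<in>Basis. - (t * ((y - c) \<bullet> b))\<^sup>2 / 2) = - (real (Suc k) * (\<Sum>b\<in>Basis. ((y - c) \<bullet> b)\<^sup>2))"
        by (simp add: t_def power_mult_distrib sum_distrib_left sum_negf[symmetric]) (intro sum.cong refl, simp add: field_simps)
      also have "(\<Sum>b\<in>Basis. ((y - c) \<bullet> b)\<^sup>2) = (norm (y - c))\<^sup>2"
        unfolding power2_norm_eq_inner euclidean_inner[of "y - c" "y - c"] by (simp add: power2_eq_square)
      finally show ?thesis .
    qed
    have "(\<lambda>m. \<integral>y. h y * of_real (P m y) \<partial>lborel) \<longlonglongrightarrow> (\<integral>y. h y * of_real (exp (- (real (Suc k) * (norm (y - c))\<^sup>2))) \<partial>lborel)"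
    proof (rule integral_dominated_convergence)
      show "integrable lborel (\<lambda>y. norm (h y))" using int by simp
      show "AE y in lborel. (\<lambda>m. h y * of_real (P m y)) \<longlonglongrightarrow> h y * of_real (exp (- (real (Suc k) * (norm (y - c))\<^sup>2)))"
        by (intro AE_I2 tendsto_intros Plim)
      show "AE y in lborel. norm (h y * of_real (P m y)) \<le> norm (h y)" for m
        using gP[of m] by (auto simp: good_def norm_mult intro!: AE_I2 mult_left_le)
      show "(\<lambda>y. h y * of_real (P m y)) \<in> borel_measurable lborel" for m
        using gP[of m] by (auto simp: good_def)
    qed simp
    moreover have "(\<integral>y. h y * of_real (P m y) \<partial>lborel) = 0" for m
      using gP[of m] unfolding good_def by (elim conjE allE[of _ 0]) simp
    ultimately show "(\<integral>y. h y * of_real (exp (- (real (Suc k) * (norm (y - c))\<^sup>2))) \<partial>lborel) = 0"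
      using LIMSEQ_unique[OF _ tendsto_const] by simp
  qed
qed

section \<open>Unique continuation for the Riesz potential\<close>

abbreviation kernel_mean :: "('a::euclidean_space \<Rightarrow> complex) \<Rightarrow> ('a \<Rightarrow> real) \<Rightarrow> 'a \<Rightarrow> complex" where
  "kernel_mean h \<kappa> c \<equiv> \<integral>y. h y * of_real (\<kappa> (y - c)) \<partial>lborel"

abbreviation inorm :: "'a::euclidean_space \<Rightarrow> real" where
  "inorm w \<equiv> inverse (norm w)"

text \<open>
  Up to a constant factor, the convolution kernel of \<open>(- \<Delta>) powr (- 1 / 2)\<close>. Its value at the origin is
  \<open>0\<close> in dimension at least two, since \<open>inverse 0 = 0\<close>.
\<close>
definition riesz_kernel :: "'a::euclidean_space \<Rightarrow> real" where
  "riesz_kernel w = inorm w ^ (DIM('a) - 1)"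

lemma riesz_kernel_measurable [measurable]: "riesz_kernel \<in> borel_measurable borel"
  unfolding riesz_kernel_def by measurable

lemma riesz_kernel_nonneg: "riesz_kernel w \<ge> 0"
  by (simp add: riesz_kernel_def)

text \<open>
  As \<open>h\<close> vanishes within \<open>2 * d\<close> of \<open>c0\<close>, for centres \<open>c\<close> within \<open>d\<close> of \<open>c0\<close> the kernel is evaluated only
  at points of norm greater than \<open>d\<close>, away from its singularity. There it can be differentiated with
  respect to \<open>c\<close> under the integral.
\<close>
lemma integral_derivative_kernel_zero:
  fixes h :: "'a::euclidean_space \<Rightarrow> complex" and \<kappa> :: "'a \<Rightarrow> real"
  assumes int: "integrable lborel h" and d: "0 < d"
    and supp: "\<And>y. y \<in> ball c0 (2 * d) \<Longrightarrow> h y = 0"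
    and [measurable]: "\<kappa> \<in> borel_measurable borel"
    and der: "\<And>w. d < norm w \<Longrightarrow> (\<kappa> has_derivative \<kappa>' w) (at w)"
    and bd0: "\<And>w. d < norm w \<Longrightarrow> \<bar>\<kappa> w\<bar> \<le> B0"
    and bd1: "\<And>w v. d < norm w \<Longrightarrow> \<bar>\<kappa>' w v\<bar> \<le> B * norm v"
    and z: "\<And>c. c \<in> ball c0 d \<Longrightarrow> kernel_mean h \<kappa> c = 0"
    and c: "c \<in> ball c0 d"
  shows "(\<integral>y. h y * of_real (\<kappa>' (y - c) v) \<partial>lborel) = 0"
    and "integrable lborel (\<lambda>y. h y * of_real (\<kappa>' (y - c) v))"
proof -
  have far: "d < norm (y - c)" if "h y \<noteq> 0" "c \<in> ball c0 d" for y c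
  proof -
    have "2 * d \<le> dist c0 y" using supp[of y] that(1) by force
    also have "\<dots> \<le> dist c0 c + dist c y" by (rule dist_triangle)
    finally show ?thesis using that(2) by (simp add: dist_norm norm_minus_commute)
  qed
  obtain r where r: "r > 0" "ball c r \<subseteq> ball c0 d"
    using c open_ball openE by blast
  have int_\<kappa>: "integrable lborel (\<lambda>y. h y * of_real (\<kappa> (y - c)))" if "c \<in> ball c0 d" for c
  proof (rule Bochner_Integration.integrable_bound[of _ "\<lambda>y. B0 * norm (h y)"])
    show "AE y in lborel. norm (h y * of_real (\<kappa> (y - c))) \<le> norm (B0 * norm (h y))"
    proof (rule AE_I2)
      fix y show "norm (h y * of_real (\<kappa> (y - c))) \<le> norm (B0 * norm (h y))"
      proof (cases "h y = 0")
        case False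
        then show ?thesis using bd0[OF far[OF False that]]
          by (simp add: norm_mult abs_mult mult.commute mult_right_mono)
      qed simp
    qed
  qed (use int in auto)
  have hd: "((\<lambda>c. h y * of_real (\<kappa> (y - c))) has_derivative (\<lambda>v. h y * of_real (- \<kappa>' (y - c) v))) (at c)"
    if "c \<in> ball c0 d" for y c
  proof (cases "h y = 0")
    case False
    have lin: "linear (\<kappa>' (y - c))" using der[OF far[OF False that]] by (rule has_derivative_linear)
    have "((\<lambda>c. \<kappa> (y - c)) has_derivative (\<lambda>v. \<kappa>' (y - c) (- v))) (at c)"
      by (rule has_derivative_compose[where g=\<kappa> and f="\<lambda>c. y - c", OF _ der[OF far[OF False that]]])
         (auto intro!: derivative_eq_intros)
    then have "((\<lambda>c. \<kappa> (y - c)) has_derivative (\<lambda>v. - \<kappa>' (y - c) v)) (at c)"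
      using linear_neg[OF lin] by simp
    then show ?thesis by (intro has_derivative_mult_right has_derivative_of_real)
  qed simp
  have lip: "norm (h y * of_real (\<kappa> (y - c')) - h y * of_real (\<kappa> (y - c))) \<le> (\<bar>B\<bar> * norm (h y)) * norm (c' - c)"
    if "c' \<in> ball c r" for c' y
  proof (rule differentiable_bound[where S="ball c r" and f="\<lambda>c. h y * of_real (\<kappa> (y - c))" and f'="\<lambda>c v. h y * of_real (- \<kappa>' (y - c) v)"])
    show "((\<lambda>c. h y * of_real (\<kappa> (y - c))) has_derivative (\<lambda>v. h y * of_real (- \<kappa>' (y - x) v))) (at x within ball c r)"
      if "x \<in> ball c r" for x
      using hd[of x] that r by (blast intro: has_derivative_at_withinI)
    show "onorm (\<lambda>v. h y * of_real (- \<kappa>' (y - x) v)) \<le> \<bar>B\<bar> * norm (h y)" if x: "x \<in> ball c r" for x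
    proof (rule onorm_le)
      fix v
      show "norm (h y * of_real (- \<kappa>' (y - x) v)) \<le> \<bar>B\<bar> * norm (h y) * norm v"
      proof (cases "h y = 0")
        case False
        have "\<bar>\<kappa>' (y - x) v\<bar> \<le> \<bar>B\<bar> * norm v"
          using bd1[OF far[OF False], of x v] r(2) x
          by (meson abs_ge_self mult_right_mono norm_ge_zero order_trans subsetD)
        then have "norm (h y) * \<bar>\<kappa>' (y - x) v\<bar> \<le> norm (h y) * (\<bar>B\<bar> * norm v)"
          by (rule mult_left_mono) simp
        then show ?thesis by (simp add: norm_mult mult_ac)
      qed simp
    qed
  qed (use that r in auto)
  have D: "((\<lambda>c. \<integral>y. h y * of_real (\<kappa> (y - c)) \<partial>lborel) has_derivative (\<lambda>v. \<integral>y. h y * of_real (- \<kappa>' (y - c) v) \<partial>lborel)) (at c)"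
    and I: "integrable lborel (\<lambda>y. h y * of_real (- \<kappa>' (y - c) v))"
    by (rule has_derivative_integral[where r=r and w="\<lambda>y. \<bar>B\<bar> * norm (h y)" and G="\<lambda>c y. h y * of_real (\<kappa> (y - c))"];
        use int_\<kappa> hd lip r c int in force)+
  have "((\<lambda>c. 0) has_derivative (\<lambda>v. \<integral>y. h y * of_real (- \<kappa>' (y - c) v) \<partial>lborel)) (at c)"
    by (rule has_derivative_transform_within_open[OF D open_ball c]) (use z in auto)
  then have "(\<lambda>v. \<integral>y. h y * of_real (- \<kappa>' (y - c) v) \<partial>lborel) = (\<lambda>v. 0)"
    by (rule has_derivative_unique[OF _ has_derivative_const])
  then have "(\<integral>y. h y * of_real (- \<kappa>' (y - c) v) \<partial>lborel) = 0" by meson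
  then show "(\<integral>y. h y * of_real (\<kappa>' (y - c) v) \<partial>lborel) = 0" by simp
  show "integrable lborel (\<lambda>y. h y * of_real (\<kappa>' (y - c) v))" using I by simp
qed

lemma has_derivative_inverse_norm_power:
  fixes w :: "'a::euclidean_space"
  assumes "w \<noteq> 0"
  shows "((\<lambda>w. inorm w ^ m) has_derivative (\<lambda>v. - (real m * (w \<bullet> v) * inorm w ^ (m + 2)))) (at w)"
proof (cases m)
  case (Suc p)
  have "(norm has_derivative (\<lambda>v. w \<bullet> v / norm w)) (at w)"
    using has_derivative_norm[OF assms] by (simp add: sgn_div_norm divide_inverse mult.commute inner_commute)
  then show ?thesis
    by (auto intro!: derivative_eq_intros simp: assms Suc fun_eq_iff divide_simps power2_eq_square)
       (cases p; simp add: algebra_simps)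
qed simp

text \<open>
  In dimension \<open>n\<close> the Laplacian of \<open>norm w powr (- m)\<close> is \<open>m * (m + 2 - n)\<close> times \<open>norm w powr (- m - 2)\<close>,
  and the kernel means remain zero under differentiation with respect to the centre.
\<close>
lemma kernel_mean_Laplacian_step:
  fixes h :: "'a::euclidean_space \<Rightarrow> complex"
  assumes int: "integrable lborel h" and d: "0 < d"
    and supp: "\<And>y. y \<in> ball c0 (2 * d) \<Longrightarrow> h y = 0"
    and m: "0 < m" "m + 2 \<noteq> DIM('a)"
    and z: "\<And>c. c \<in> ball c0 d \<Longrightarrow> kernel_mean h (\<lambda>w. inorm w ^ m) c = 0"
    and c: "c \<in> ball c0 d"
  shows "kernel_mean h (\<lambda>w. inorm w ^ (m + 2)) c = 0"
proof -
  have inv: "inorm w ^ k \<le> inverse d ^ k" if "d < norm w" for w :: 'a and k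
    using that d by (intro power_mono le_imp_inverse_le) auto
  have bd: "\<bar>w \<bullet> v\<bar> * inorm w ^ Suc k \<le> norm v * inverse d ^ k" if w: "d < norm w" for w v :: 'a and k
  proof -
    have "\<bar>w \<bullet> v\<bar> * inorm w ^ Suc k \<le> (norm w * norm v) * inorm w ^ Suc k"
      by (intro mult_right_mono Cauchy_Schwarz_ineq2) auto
    also have "\<dots> = norm v * inorm w ^ k"
    proof -
      have "w \<noteq> 0" using w d by auto
      then show ?thesis by simp
    qed
    also have "\<dots> \<le> norm v * inverse d ^ k" by (intro mult_left_mono inv w) simp
    finally show ?thesis .
  qed
  have der: "((\<lambda>w. inorm w ^ k) has_derivative (\<lambda>v. - (real k * (w \<bullet> v) * inorm w ^ (k + 2)))) (at w)"
    if "d < norm w" for w :: 'a and k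
    by (rule has_derivative_inverse_norm_power) (use that d in auto)
  \<comment> \<open>\<open>- m * \<kappa> v\<close> is the derivative of \<open>inorm w ^ m\<close> in direction \<open>v\<close>, and \<open>\<kappa>'\<close> is the derivative of \<open>\<kappa>\<close>.
    The sum of \<open>\<kappa>' v w v\<close> over an orthonormal basis is therefore a multiple of the Laplacian.\<close>
  define \<kappa> where "\<kappa> v w = (w \<bullet> v) * inorm w ^ (m + 2)" for v w :: 'a
  define \<kappa>' where "\<kappa>' v w u = (u \<bullet> v) * inorm w ^ (m + 2) - real (m + 2) * (w \<bullet> u) * (w \<bullet> v) * inorm w ^ (m + 4)" for v w u :: 'a
  have [measurable]: "\<kappa> v \<in> borel_measurable borel" for v unfolding \<kappa>_def by measurable
  have first: "kernel_mean h (\<kappa> v) c = 0" if c: "c \<in> ball c0 d" for c v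
  proof -
    define F where "F w u = - real m * \<kappa> u w" for w u :: 'a
    have "(\<integral>y. h y * of_real (F (y - c) v) \<partial>lborel) = 0"
    proof (rule integral_derivative_kernel_zero(1)[OF int d supp _ _ _ _ z c])
      show "((\<lambda>w. inorm w ^ m) has_derivative F w) (at w)" if "d < norm w" for w
        using der[OF that, of m] by (simp add: F_def[abs_def] \<kappa>_def mult.assoc)
      show "\<bar>F w u\<bar> \<le> (real m * inverse d ^ (m + 1)) * norm u" if "d < norm w" for w u
        using mult_left_mono[OF bd[OF that, of u "m + 1"], of "real m"]
        by (simp add: F_def \<kappa>_def abs_mult mult_ac)
      show "\<bar>inorm w ^ m\<bar> \<le> inverse d ^ m" if "d < norm w" for w :: 'a using inv[OF that] by simp
    qed simp_all
    then have "of_real (- real m) * kernel_mean h (\<kappa> v) c = 0"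
      by (subst integral_mult_right_zero[symmetric]) (simp add: F_def mult_ac)
    then show ?thesis using m by simp
  qed
  have second: "(\<integral>y. h y * of_real (\<kappa>' v (y - c) v) \<partial>lborel) = 0 \<and> integrable lborel (\<lambda>y. h y * of_real (\<kappa>' v (y - c) v))" for v
  proof -
    have D: "(\<kappa> v has_derivative \<kappa>' v w) (at w)" if w: "d < norm w" for w
    proof -
      have "((\<lambda>w. w \<bullet> v) has_derivative (\<lambda>u. u \<bullet> v)) (at w)" by (auto intro!: derivative_eq_intros)
      from has_derivative_mult[OF this der[OF w, of "m + 2"]] show ?thesis
        unfolding \<kappa>_def by (rule has_derivative_eq_rhs) (simp add: \<kappa>'_def fun_eq_iff algebra_simps eval_nat_numeral)
    qed
    have b0: "\<bar>\<kappa> v w\<bar> \<le> norm v * inverse d ^ (m + 1)" if "d < norm w" for w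
      using bd[OF that, of v "m + 1"] by (simp add: \<kappa>_def abs_mult)
    have b1: "\<bar>\<kappa>' v w u\<bar> \<le> (norm v * real (m + 3) * inverse d ^ (m + 2)) * norm u" if w: "d < norm w" for w u
    proof -
      have 1: "\<bar>u \<bullet> v\<bar> * inorm w ^ (m + 2) \<le> (norm u * norm v) * inverse d ^ (m + 2)"
        by (intro mult_mono Cauchy_Schwarz_ineq2 inv w) auto
      have "(\<bar>w \<bullet> u\<bar> * inorm w ^ Suc (m + 2)) * (\<bar>w \<bullet> v\<bar> * inorm w ^ Suc 0) \<le> (norm u * inverse d ^ (m + 2)) * (norm v * inverse d ^ 0)"
        using d by (intro mult_mono bd w) auto
      then have "\<bar>w \<bullet> u\<bar> * \<bar>w \<bullet> v\<bar> * inorm w ^ (m + 4) \<le> norm u * norm v * inverse d ^ (m + 2)"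
        by (simp add: eval_nat_numeral mult_ac)
      from mult_left_mono[OF this, of "real (m + 2)"] 1
      have "\<bar>u \<bullet> v\<bar> * inorm w ^ (m + 2) + real (m + 2) * (\<bar>w \<bullet> u\<bar> * \<bar>w \<bullet> v\<bar> * inorm w ^ (m + 4))
          \<le> (norm v * real (m + 3) * inverse d ^ (m + 2)) * norm u"
        by (simp add: algebra_simps)
      moreover have "\<bar>\<kappa>' v w u\<bar> \<le> \<bar>u \<bullet> v\<bar> * inorm w ^ (m + 2) + real (m + 2) * (\<bar>w \<bullet> u\<bar> * \<bar>w \<bullet> v\<bar> * inorm w ^ (m + 4))"
        unfolding \<kappa>'_def by (rule order_trans[OF abs_triangle_ineq4]) (simp add: abs_mult mult_ac)
      ultimately show ?thesis by linarith
    qed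
    have \<kappa>m: "\<kappa> v \<in> borel_measurable borel" by measurable
    show ?thesis
      using integral_derivative_kernel_zero[OF int d supp \<kappa>m D b0 b1 first c] by blast
  qed
  have trace: "(\<Sum>v\<in>Basis. \<kappa>' v w v) = (real DIM('a) - real (m + 2)) * inorm w ^ (m + 2)" for w
  proof -
    have A: "(\<Sum>v\<in>Basis. (w \<bullet> v) * (w \<bullet> v)) = (norm w)\<^sup>2"
      unfolding power2_norm_eq_inner by (rule euclidean_inner[symmetric])
    have B: "(norm w)\<^sup>2 * inorm w ^ (m + 4) = inorm w ^ (m + 2)"
      by (cases "w = 0") (simp_all add: power_add field_simps power2_eq_square eval_nat_numeral)
    have C: "(\<Sum>v\<in>Basis. \<kappa>' v w v) = (\<Sum>v\<in>(Basis :: 'a set). v \<bullet> v) * inorm w ^ (m + 2)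
        - real (m + 2) * ((\<Sum>v\<in>Basis. (w \<bullet> v) * (w \<bullet> v)) * inorm w ^ (m + 4))"
      unfolding \<kappa>'_def by (simp only: sum_subtractf sum_distrib_left sum_distrib_right mult.assoc)
    have D: "(\<Sum>v\<in>(Basis :: 'a set). v \<bullet> v) = real DIM('a)" by (simp add: inner_Basis)
    show ?thesis unfolding C A B D by (rule left_diff_distrib[symmetric])
  qed
  have "of_real (real DIM('a) - real (m + 2)) * kernel_mean h (\<lambda>w. inorm w ^ (m + 2)) c
      = (\<integral>y. (\<Sum>v\<in>Basis. h y * of_real (\<kappa>' v (y - c) v)) \<partial>lborel)"
    unfolding sum_distrib_left[symmetric] of_real_sum[symmetric] trace
    by (subst integral_mult_right_zero[symmetric]) (simp only: of_real_mult mult_ac)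
  also have "\<dots> = (\<Sum>v\<in>Basis. \<integral>y. h y * of_real (\<kappa>' v (y - c) v) \<partial>lborel)"
    by (rule Bochner_Integration.integral_sum) (use second in blast)
  also have "\<dots> = 0" by (simp only: second sum.neutral_const)
  finally have "complex_of_real (real DIM('a) - real (m + 2)) = 0 \<or> kernel_mean h (\<lambda>w. inorm w ^ (m + 2)) c = 0"
    by (simp only: mult_eq_0_iff)
  moreover have "real DIM('a) - real (m + 2) \<noteq> 0"
    using m(2) by (simp only: right_minus_eq of_nat_eq_iff not_sym simp_thms)
  ultimately show ?thesis unfolding of_real_eq_0_iff by blast
qed

text \<open>
  The exponents \<open>m\<close> that occur are at least \<open>DIM('a) - 1\<close>, so the factor \<open>m + 2 - DIM('a)\<close> of the Laplacian
  step is never zero.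
\<close>
lemma Riesz_moments_zero:
  fixes h :: "'a::euclidean_space \<Rightarrow> complex"
  assumes dim: "2 \<le> DIM('a)" and int: "integrable lborel h" and d: "0 < d"
    and supp: "\<And>y. y \<in> ball c0 (2 * d) \<Longrightarrow> h y = 0"
    and z: "\<And>c. c \<in> ball c0 d \<Longrightarrow> kernel_mean h riesz_kernel c = 0"
    and c: "c \<in> ball c0 d"
  shows "kernel_mean h (\<lambda>w. inorm w ^ (DIM('a) - 1 + 2 * j)) c = 0"
  using c
proof (induction j arbitrary: c)
  case 0
  then show ?case using z by (simp add: riesz_kernel_def)
next
  case (Suc j)
  have "kernel_mean h (\<lambda>w. inorm w ^ ((DIM('a) - 1 + 2 * j) + 2)) c = 0"
    by (rule kernel_mean_Laplacian_step[OF int d supp _ _ Suc.IH Suc.prems]) (use dim in auto)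
  then show ?case by simp
qed

lemma power_times_Gaussian_tendsto_0:
  fixes t :: real assumes "t > 0"
  shows "((\<lambda>x. x ^ p * exp (- t * x\<^sup>2)) \<longlongrightarrow> 0) at_top"
  using assms by real_asymp

text \<open>
  With \<open>\<rho> y = (d / norm (y - c))\<^sup>2\<close> on the support of \<open>h\<close>, the Riesz moments are the moments in \<open>\<rho>\<close> of the
  function \<open>h y * norm (y - c) powr (1 - DIM('a))\<close>. The Gaussian is obtained from a continuous function
  \<open>g\<close> of \<open>\<rho>\<close>; continuity at \<open>\<rho> = 0\<close>, the image of infinity, is the rapid decay of the Gaussian.
\<close>
lemma Gaussian_means_zero_near:
  fixes h :: "'a::euclidean_space \<Rightarrow> complex"
  assumes dim: "2 \<le> DIM('a)" and int: "integrable lborel h" and d: "0 < d"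
    and supp: "\<And>y. y \<in> ball c0 (2 * d) \<Longrightarrow> h y = 0"
    and z: "\<And>c. c \<in> ball c0 d \<Longrightarrow> kernel_mean h riesz_kernel c = 0"
    and c: "c \<in> ball c0 d" and t: "t > 0"
  shows "(\<integral>y. h y * of_real (exp (- t * (norm (y - c))\<^sup>2)) \<partial>lborel) = 0"
proof -
  define p where "p = DIM('a) - 1"
  define q where "q y = inorm (y - c)" for y
  define \<rho> where "\<rho> y = (if d < norm (y - c) then (d * q y)\<^sup>2 else 0)" for y
  \<comment> \<open>\<open>d * inverse (sqrt \<tau>)\<close> is \<open>norm (y - c)\<close> for \<open>\<tau> = \<rho> y\<close>.\<close>
  define g where "g \<tau> = (if \<tau> = 0 then 0 else (d * inverse (sqrt \<tau>)) ^ p * exp (- t * (d * inverse (sqrt \<tau>))\<^sup>2))" for \<tau>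
  have far: "d < norm (y - c)" if "h y \<noteq> 0" for y
  proof -
    have "2 * d \<le> dist c0 y" using supp[of y] that(1) by force
    also have "\<dots> \<le> dist c0 c + dist c y" by (rule dist_triangle)
    finally show ?thesis using c by (simp add: dist_norm norm_minus_commute)
  qed
  have [measurable]: "q \<in> borel_measurable borel" unfolding q_def by measurable
  have [measurable]: "\<rho> \<in> borel_measurable borel" unfolding \<rho>_def by measurable
  have ih: "integrable lborel (\<lambda>y. h y * of_real (q y ^ p))"
  proof (rule Bochner_Integration.integrable_bound[of _ "\<lambda>y. inverse d ^ p * norm (h y)"])
    show "AE y in lborel. norm (h y * of_real (q y ^ p)) \<le> norm (inverse d ^ p * norm (h y))"
    proof (rule AE_I2)
      fix y show "norm (h y * of_real (q y ^ p)) \<le> norm (inverse d ^ p * norm (h y))"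
      proof (cases "h y = 0")
        case False
        then have "q y ^ p \<le> inverse d ^ p"
          unfolding q_def using far d by (intro power_mono le_imp_inverse_le) (auto intro: less_imp_le)
        moreover have "q y \<ge> 0" by (simp add: q_def)
        ultimately show ?thesis using d
          using mult_left_mono[of "q y ^ p" "inverse d ^ p" "norm (h y)"]
          by (simp add: norm_mult norm_power abs_mult mult.commute del: power_inverse)
      qed simp
    qed
  qed (use int in auto)
  have contg: "continuous_on {0..1} g"
    unfolding continuous_on_def
  proof
    fix \<tau> :: real assume \<tau>: "\<tau> \<in> {0..1}"
    show "(g \<longlongrightarrow> g \<tau>) (at \<tau> within {0..1})"
    proof (cases "\<tau> = 0")
      case True
      have "filterlim (\<lambda>\<tau>. d * inverse (sqrt \<tau>)) at_top (at_right 0)"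
        using d by real_asymp
      then have "((\<lambda>\<tau>. (d * inverse (sqrt \<tau>)) ^ p * exp (- t * (d * inverse (sqrt \<tau>))\<^sup>2)) \<longlongrightarrow> 0) (at_right 0)"
        by (rule filterlim_compose[OF power_times_Gaussian_tendsto_0[OF t]])
      then have "(g \<longlongrightarrow> 0) (at_right 0)"
        by (rule Lim_transform_eventually) (auto simp: g_def eventually_at_filter)
      moreover have "at 0 within {0..1::real} \<le> at_right 0"
        by (auto simp: le_filter_def eventually_at_filter elim!: eventually_mono)
      ultimately show ?thesis using True by (simp add: g_def tendsto_mono)
    next
      case False
      then have "((\<lambda>\<tau>. (d * inverse (sqrt \<tau>)) ^ p * exp (- t * (d * inverse (sqrt \<tau>))\<^sup>2)) \<longlongrightarrow> g \<tau>) (at \<tau> within {0..1})"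
        using \<tau> by (auto simp: g_def intro!: tendsto_intros)
      moreover have "\<forall>\<^sub>F x in at \<tau> within {0..1}. x \<noteq> 0"
        by (rule tendsto_imp_eventually_ne[OF tendsto_ident_at False])
      then have "\<forall>\<^sub>F x in at \<tau> within {0..1}. (d * inverse (sqrt x)) ^ p * exp (- t * (d * inverse (sqrt x))\<^sup>2) = g x"
        by eventually_elim (simp add: g_def)
      ultimately show ?thesis by (rule Lim_transform_eventually)
    qed
  qed
  have "(\<integral>y. (h y * of_real (q y ^ p)) * of_real (g (\<rho> y)) \<partial>lborel) = 0"
  proof (rule moments_determine[OF ih _ _ _ contg])
    show "\<rho> y \<in> {0..1}" for y
    proof (cases "d < norm (y - c)")
      case True
      then have "norm (y - c) > 0" using d by linarith
      then have "0 \<le> d * q y" "d * q y \<le> 1"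
        using True d unfolding q_def divide_inverse[symmetric] by (auto simp: divide_le_eq_1_pos simp del: zero_less_norm_iff)
      then show ?thesis by (auto simp: \<rho>_def power_le_one)
    qed (simp add: \<rho>_def)
    show "(\<integral>y. h y * of_real (q y ^ p) * of_real (\<rho> y ^ k) \<partial>lborel) = 0" for k
    proof -
      have *: "h y * of_real (q y ^ p) * of_real (\<rho> y ^ k) = of_real (d ^ (2 * k)) * (h y * of_real (q y ^ (p + 2 * k)))" for y
        using far[of y] by (cases "h y = 0") (simp_all add: \<rho>_def power_mult_distrib power_add mult_ac flip: power_mult)
      show ?thesis
        unfolding * using Riesz_moments_zero[OF dim int d supp z c, of k]
        by (simp add: p_def q_def del: of_real_power power_inverse)
    qed
  qed simp
  moreover have "(h y * of_real (q y ^ p)) * of_real (g (\<rho> y)) = h y * of_real (exp (- t * (norm (y - c))\<^sup>2))" for y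
  proof (cases "h y = 0")
    case False
    note f = far[OF False]
    then have n0: "norm (y - c) > 0" using d by linarith
    have "sqrt (\<rho> y) = d * q y" using f d by (simp add: \<rho>_def q_def)
    then have "d * inverse (sqrt (\<rho> y)) = norm (y - c)" using d n0 by (simp add: q_def)
    moreover have "\<rho> y \<noteq> 0" using f d n0 by (simp add: \<rho>_def q_def)
    ultimately have "q y ^ p * g (\<rho> y) = exp (- t * (norm (y - c))\<^sup>2)"
      using n0 unfolding g_def by (simp add: q_def power_mult_distrib[symmetric] del: power_inverse)
    then show ?thesis by (metis mult.assoc of_real_mult)
  qed simp
  ultimately show ?thesis by (simp only:)
qed

text \<open>
  On a line \<open>c0 + s *\<^sub>R v\<close> of centres the Gaussian mean of \<open>h\<close> equals a positive factor times an integral of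
  \<open>exp (s * a y)\<close>. It vanishes for small \<open>s\<close>, hence for all \<open>s\<close>; so the Gaussian means vanish at every
  centre, and this localizes.
\<close>
theorem Riesz_potential_unique_continuation:
  fixes h :: "'a::euclidean_space \<Rightarrow> complex"
  assumes dim: "2 \<le> DIM('a)" and cont: "continuous_on UNIV h" and int: "integrable lborel h" and d: "0 < d"
    and supp: "\<And>y. y \<in> ball c0 (2 * d) \<Longrightarrow> h y = 0"
    and z: "\<And>c. c \<in> ball c0 d \<Longrightarrow> kernel_mean h riesz_kernel c = 0"
  shows "h x = 0"
proof (rule zero_if_Gaussian_means_zero[OF cont int])
  fix k
  define t where "t = real (Suc k)"
  have t: "t > 0" by (simp add: t_def)
  define v where "v = x - c0"
  define H where "H y = h y * of_real (exp (- t * (norm (y - c0))\<^sup>2))" for y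
  define a where "a y = 2 * t * ((y - c0) \<bullet> v)" for y
  have [measurable]: "h \<in> borel_measurable borel" using int by auto
  have [measurable]: "H \<in> borel_measurable borel" "a \<in> borel_measurable borel"
    unfolding H_def a_def by measurable
  have ex: "- t * (norm (y - (c0 + s *\<^sub>R v)))\<^sup>2 = - t * (norm (y - c0))\<^sup>2 + s * a y + - t * (s\<^sup>2 * (norm v)\<^sup>2)" for y s
  proof -
    have E: "(norm (y - (c0 + s *\<^sub>R v)))\<^sup>2 = (norm (y - c0))\<^sup>2 - 2 * s * ((y - c0) \<bullet> v) + s\<^sup>2 * (norm v)\<^sup>2"
      unfolding power2_norm_eq_inner
      by (simp add: inner_diff_left inner_diff_right inner_add_left inner_add_right inner_commute power2_eq_square algebra_simps)
    show ?thesis unfolding a_def E by (simp add: algebra_simps)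
  qed
  have Hs: "h y * of_real (exp (- t * (norm (y - (c0 + s *\<^sub>R v)))\<^sup>2)) = of_real (exp (- t * (s\<^sup>2 * (norm v)\<^sup>2))) * (H y * of_real (exp (s * a y)))" for y s
    unfolding ex by (simp only: exp_add H_def of_real_mult mult_ac)
  have z0: "(\<integral>y. H y * of_real (exp (s * a y)) \<partial>lborel) = 0" if "\<bar>s\<bar> < d / (norm v + 1)" for s
  proof -
    have "\<bar>s\<bar> * norm v \<le> \<bar>s\<bar> * (norm v + 1)" by (intro mult_left_mono) auto
    also have "\<dots> < d" using that by (simp add: pos_less_divide_eq add_nonneg_pos)
    finally have "c0 + s *\<^sub>R v \<in> ball c0 d" by (simp add: dist_norm)
    from Gaussian_means_zero_near[OF dim int d supp z this t] show ?thesis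
      unfolding Hs by simp
  qed
  have "(\<integral>y. H y * of_real (exp (1 * a y)) \<partial>lborel) = 0"
  proof (rule exponential_means_zero[OF _ _ _ _ z0])
    show "integrable lborel (\<lambda>y. norm (H y) * exp (s * \<bar>a y\<bar>))" for s
    proof (rule Bochner_Integration.integrable_bound[of _ "\<lambda>y. exp (t * (s\<^sup>2 * (norm v)\<^sup>2)) * norm (h y)"])
      show "AE y in lborel. norm (norm (H y) * exp (s * \<bar>a y\<bar>)) \<le> norm (exp (t * (s\<^sup>2 * (norm v)\<^sup>2)) * norm (h y))"
      proof (rule AE_I2)
        fix y
        define r where "r = norm (y - c0)"
        have "s * \<bar>a y\<bar> \<le> \<bar>s\<bar> * \<bar>a y\<bar>" by (intro mult_right_mono) auto
        also have "\<dots> \<le> \<bar>s\<bar> * (2 * t * (r * norm v))"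
          unfolding a_def r_def using t by (intro mult_left_mono) (auto simp: abs_mult intro!: mult_left_mono Cauchy_Schwarz_ineq2)
        also have "\<dots> \<le> t * r\<^sup>2 + t * (\<bar>s\<bar>\<^sup>2 * (norm v)\<^sup>2)"
        proof -
          have "0 \<le> t * (r - \<bar>s\<bar> * norm v)\<^sup>2" using t by simp
          then show ?thesis by (simp only: power2_eq_square algebra_simps)
        qed
        finally have "exp (- t * r\<^sup>2) * exp (s * \<bar>a y\<bar>) \<le> exp (t * (s\<^sup>2 * (norm v)\<^sup>2))"
          by (simp add: exp_add[symmetric])
        then have "norm (h y) * (exp (- t * r\<^sup>2) * exp (s * \<bar>a y\<bar>)) \<le> norm (h y) * exp (t * (s\<^sup>2 * (norm v)\<^sup>2))"
          by (rule mult_left_mono) simp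
        then show "norm (norm (H y) * exp (s * \<bar>a y\<bar>)) \<le> norm (exp (t * (s\<^sup>2 * (norm v)\<^sup>2)) * norm (h y))"
          by (simp add: H_def norm_mult abs_mult r_def mult_ac)
      qed
    qed (use int in auto)
    show "0 < d / (norm v + 1)" using d by (simp add: add_nonneg_pos)
  qed auto
  then have "(\<integral>y. h y * of_real (exp (- t * (norm (y - (c0 + 1 *\<^sub>R v)))\<^sup>2)) \<partial>lborel) = 0"
    unfolding Hs by simp
  then show "(\<integral>y. h y * of_real (exp (- (real (Suc k) * (norm (y - x))\<^sup>2))) \<partial>lborel) = 0"
    by (simp only: v_def t_def mult_minus_left scaleR_one add_diff_cancel_left' diff_add_cancel add_diff_eq)
qed

section \<open>Zeros of polynomials in several variables\<close>

definition cpoly_eval :: "'n::finite cpoly \<Rightarrow> real ^ 'n \<Rightarrow> complex" where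
  "cpoly_eval P \<xi> = (\<Sum>\<alpha>\<in>Poly_Mapping.keys P. Poly_Mapping.lookup P \<alpha> * of_real (\<Prod>j\<in>UNIV. (\<xi> $ j) ^ Poly_Mapping.lookup \<alpha> j))"

text \<open>
  Artin's argument for the independence of characters: monomials are multiplicative under the componentwise
  product.
\<close>
lemma monomials_linearly_independent:
  fixes A :: "('n::finite \<Rightarrow>\<^sub>0 nat) set"
  assumes "finite A" and "\<And>\<xi>::real^'n. (\<Sum>\<alpha>\<in>A. c \<alpha> * complex_of_real (\<Prod>j\<in>UNIV. (\<xi> $ j) ^ Poly_Mapping.lookup \<alpha> j)) = 0"
    and "\<alpha> \<in> A"
  shows "c \<alpha> = 0"
  using assms
proof (induction A arbitrary: c \<alpha> rule: finite_induct)
  case (insert \<beta> A)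
  define mon where "mon \<alpha> \<xi> = complex_of_real (\<Prod>j\<in>UNIV. (\<xi> $ j) ^ Poly_Mapping.lookup \<alpha> j)"
    for \<alpha> :: "'n \<Rightarrow>\<^sub>0 nat" and \<xi> :: "real ^ 'n"
  have mult: "mon \<alpha> (vec_lambda (\<lambda>j. \<xi> $ j * \<eta> $ j)) = mon \<alpha> \<xi> * mon \<alpha> \<eta>" for \<alpha> \<xi> \<eta>
    by (simp add: mon_def power_mult_distrib prod.distrib)
  have zero: "(\<Sum>\<alpha>\<in>A. c \<alpha> * mon \<alpha> \<xi>) = - (c \<beta> * mon \<beta> \<xi>)" for \<xi>
    using insert.prems(1)[of \<xi>] insert.hyps by (simp add: mon_def eq_neg_iff_add_eq_0 add.commute)
  have c0: "c \<alpha> = 0" if \<alpha>: "\<alpha> \<in> A" for \<alpha>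
  proof -
    have "\<alpha> \<noteq> \<beta>" using \<alpha> insert.hyps by auto
    then obtain i where i: "Poly_Mapping.lookup \<alpha> i \<noteq> Poly_Mapping.lookup \<beta> i"
      by (meson poly_mapping_eqI)
    define \<xi>0 :: "real ^ 'n" where "\<xi>0 = vec_lambda (\<lambda>j. if j = i then 2 else 1)"
    have x0: "mon \<gamma> \<xi>0 = 2 ^ Poly_Mapping.lookup \<gamma> i" for \<gamma>
    proof -
      have "(\<Prod>j\<in>UNIV. (\<xi>0 $ j) ^ Poly_Mapping.lookup \<gamma> j) = (\<Prod>j\<in>UNIV. if j = i then 2 ^ Poly_Mapping.lookup \<gamma> i else 1)"
        by (intro prod.cong) (auto simp: \<xi>0_def)
      then show ?thesis by (simp add: mon_def)
    qed
    \<comment> \<open>The relation at the product of \<open>\<xi>0\<close> and \<open>\<xi>\<close> minus \<open>mon \<beta> \<xi>0\<close> times the relation at \<open>\<xi>\<close> is one without \<open>\<beta>\<close>.\<close>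
    define c' where "c' \<gamma> = c \<gamma> * (mon \<gamma> \<xi>0 - mon \<beta> \<xi>0)" for \<gamma>
    have "(\<Sum>\<gamma>\<in>A. c' \<gamma> * mon \<gamma> \<xi>) = 0" for \<xi>
    proof -
      have "(\<Sum>\<gamma>\<in>A. c' \<gamma> * mon \<gamma> \<xi>) = (\<Sum>\<gamma>\<in>A. c \<gamma> * mon \<gamma> (vec_lambda (\<lambda>j. \<xi>0 $ j * \<xi> $ j))) - mon \<beta> \<xi>0 * (\<Sum>\<gamma>\<in>A. c \<gamma> * mon \<gamma> \<xi>)"
        unfolding mult c'_def by (simp add: sum_subtractf sum_distrib_left algebra_simps)
      also have "\<dots> = 0" unfolding zero by (simp add: mult)
      finally show ?thesis .
    qed
    then have "c' \<alpha> = 0" unfolding mon_def by (rule insert.IH[OF _ \<alpha>])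
    moreover have "mon \<alpha> \<xi>0 \<noteq> mon \<beta> \<xi>0"
    proof -
      have "(2::real) ^ Poly_Mapping.lookup \<alpha> i \<noteq> 2 ^ Poly_Mapping.lookup \<beta> i" using i by simp
      then have "complex_of_real (2 ^ Poly_Mapping.lookup \<alpha> i) \<noteq> complex_of_real (2 ^ Poly_Mapping.lookup \<beta> i)"
        by (simp only: of_real_eq_iff not_False_eq_True)
      then show ?thesis unfolding x0 of_real_power of_real_numeral .
    qed
    ultimately show ?thesis by (simp add: c'_def)
  qed
  have "c \<beta> * mon \<beta> (vec_lambda (\<lambda>_. 1)) = 0"
    using zero[of "vec_lambda (\<lambda>_. 1)"] c0 by simp
  then have "c \<beta> = 0" by (simp add: mon_def)
  then show ?case using c0 insert.prems(2) by auto
qed simp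

text \<open>
  Along each line through \<open>\<xi>0\<close> the polynomial is univariate; if it vanished near \<open>\<xi>0\<close>, it would have
  infinitely many zeros on each of these lines and so vanish everywhere, against the independence of monomials.
\<close>
lemma cpoly_nonzero_dense:
  fixes P :: "'n::finite cpoly"
  assumes "P \<noteq> 0" and r: "0 < r"
  shows "\<exists>\<xi>\<in>ball \<xi>0 r. cpoly_eval P \<xi> \<noteq> 0"
proof (rule ccontr)
  assume "\<not> ?thesis"
  then have z: "cpoly_eval P \<xi> = 0" if "\<xi> \<in> ball \<xi>0 r" for \<xi> using that by blast
  have "cpoly_eval P \<xi> = 0" for \<xi>
  proof -
    define d where "d = \<xi> - \<xi>0"
    define q where "q = (\<Sum>\<alpha>\<in>Poly_Mapping.keys P. smult (Poly_Mapping.lookup P \<alpha>)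
        (\<Prod>j\<in>UNIV. [:complex_of_real (\<xi>0 $ j), complex_of_real (d $ j):] ^ Poly_Mapping.lookup \<alpha> j))"
    have q: "poly q (of_real s) = cpoly_eval P (\<xi>0 + s *\<^sub>R d)" for s
      by (simp add: q_def cpoly_eval_def poly_sum poly_prod)
    have "poly q (of_real s) = 0" if s: "0 < s" "s < r / (norm d + 1)" for s
    proof -
      have "s * norm d \<le> s * (norm d + 1)" using s by (intro mult_left_mono) auto
      also have "\<dots> < r" using s by (simp add: pos_less_divide_eq add_nonneg_pos)
      finally show ?thesis unfolding q using s by (intro z) (simp add: dist_norm)
    qed
    then have "complex_of_real ` {0<..<r / (norm d + 1)} \<subseteq> {x. poly q x = 0}" by auto
    moreover have "infinite (complex_of_real ` {0<..<r / (norm d + 1)})"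
    proof -
      have "infinite {0<..<r / (norm d + 1)}" using r by (intro infinite_Ioo divide_pos_pos add_nonneg_pos) auto
      then show ?thesis by (simp add: finite_image_iff inj_on_def)
    qed
    ultimately have "q = 0" using poly_roots_finite finite_subset by blast
    then have "cpoly_eval P (\<xi>0 + 1 *\<^sub>R d) = 0" using q[of 1] by simp
    then show ?thesis by (simp add: d_def)
  qed
  then have "(\<Sum>\<alpha>\<in>Poly_Mapping.keys P. Poly_Mapping.lookup P \<alpha> * complex_of_real (\<Prod>j\<in>UNIV. (\<xi> $ j) ^ Poly_Mapping.lookup \<alpha> j)) = 0" for \<xi> :: "real ^ 'n"
    by (simp only: cpoly_eval_def)
  then have "Poly_Mapping.lookup P \<alpha> = 0" if "\<alpha> \<in> Poly_Mapping.keys P" for \<alpha>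
    using that by (rule monomials_linearly_independent[OF finite_keys])
  then have "Poly_Mapping.lookup P \<alpha> = 0" for \<alpha>
    by (cases "\<alpha> \<in> Poly_Mapping.keys P") (auto simp: in_keys_iff)
  then have "P = 0" by (intro poly_mapping_eqI) simp
  then show False using \<open>P \<noteq> 0\<close> by simp
qed

section \<open>Calculus of smooth functions and test functions\<close>

lemma iter_deriv_Nil [simp]: "iter_deriv [] f = f"
  by (simp add: iter_deriv_def)

lemma iter_deriv_Cons [simp]: "iter_deriv (b # bs) f = dir_deriv b (iter_deriv bs f)"
  by (simp add: iter_deriv_def)

lemma iter_deriv_append: "iter_deriv (as @ bs) f = iter_deriv as (iter_deriv bs f)"
  by (simp add: iter_deriv_def)

lemma dir_deriv_eq: "(f has_derivative f') (at x) \<Longrightarrow> dir_deriv b f x = f' b"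
  unfolding dir_deriv_def by (metis frechet_derivative_at)

text \<open>
  The form in which smoothness is proved throughout: it suffices to exhibit a set of differentiable functions
  that is closed under the derivatives in the basis directions.
\<close>
lemma smooth_functions_coinduct:
  assumes "f \<in> S"
    and "\<And>f. f \<in> S \<Longrightarrow> \<exists>f'. (\<forall>x. (f has_derivative f' x) (at x)) \<and> (\<forall>b\<in>Basis. (\<lambda>x. f' x b) \<in> S)"
  shows "f \<in> smooth_functions"
proof -
  have "iter_deriv bs f \<in> S" if "bs \<in> lists Basis" for bs
    using that
  proof (induction bs)
    case (Cons b bs)
    then obtain f' where f': "\<And>x. (iter_deriv bs f has_derivative f' x) (at x)" "(\<lambda>x. f' x b) \<in> S"
      using assms(2)[of "iter_deriv bs f"] by auto
    have "dir_deriv b (iter_deriv bs f) = (\<lambda>x. f' x b)"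
      using dir_deriv_eq[OF f'(1)] by blast
    then show ?case using f'(2) by simp
  qed (simp add: assms)
  then show ?thesis
    using assms(2) unfolding smooth_functions_def smooth_on_def differentiable_def by blast
qed

lemma smooth_iter_deriv:
  assumes "f \<in> smooth_functions" "bs \<in> lists Basis"
  shows "iter_deriv bs f \<in> smooth_functions"
  using assms unfolding smooth_functions_def smooth_on_def
  by (auto simp flip: iter_deriv_append)

lemma smooth_dir_deriv:
  "f \<in> smooth_functions \<Longrightarrow> b \<in> Basis \<Longrightarrow> dir_deriv b f \<in> smooth_functions"
  using smooth_iter_deriv[of f "[b]"] by simp

lemma smooth_has_derivative:
  assumes "f \<in> smooth_functions"
  shows "(f has_derivative (\<lambda>v. dir_deriv v f x)) (at x)"
proof -
  have "f differentiable (at x)"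
    using assms by (auto simp: smooth_functions_def smooth_on_def dest!: bspec[of _ _ "[]"])
  then obtain f' where f': "(f has_derivative f') (at x)" by (auto simp: differentiable_def)
  moreover have "f' = (\<lambda>v. dir_deriv v f x)" by (rule ext) (rule dir_deriv_eq[OF f', symmetric])
  ultimately show ?thesis by simp
qed

lemma dir_deriv_Basis_expansion:
  fixes f :: "'a::euclidean_space \<Rightarrow> complex"
  assumes "f \<in> smooth_functions"
  shows "dir_deriv v f x = (\<Sum>b\<in>Basis. (v \<bullet> b) *\<^sub>R dir_deriv b f x)"
proof -
  have lin: "linear (\<lambda>v. dir_deriv v f x)"
    using smooth_has_derivative[OF assms] by (rule has_derivative_linear)
  have "dir_deriv v f x = dir_deriv (\<Sum>b\<in>Basis. (v \<bullet> b) *\<^sub>R b) f x" by (simp add: euclidean_representation)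
  then show ?thesis by (simp only: linear_sum[OF lin] linear_scale[OF lin])
qed

lemma smooth_continuous: "f \<in> smooth_functions \<Longrightarrow> continuous_on S f"
  by (meson smooth_has_derivative has_derivative_continuous continuous_at_imp_continuous_on)

lemma dir_deriv_linear_combination:
  assumes "f \<in> smooth_functions" "g \<in> smooth_functions"
  shows "dir_deriv b (\<lambda>x. c * f x + d * g x) = (\<lambda>x. c * dir_deriv b f x + d * dir_deriv b g x)"
proof
  fix x
  have "(f has_derivative (\<lambda>v. dir_deriv v f x)) (at x)" "(g has_derivative (\<lambda>v. dir_deriv v g x)) (at x)"
    by (intro smooth_has_derivative assms)+
  then have "((\<lambda>x. c * f x + d * g x) has_derivative (\<lambda>v. c * dir_deriv v f x + d * dir_deriv v g x)) (at x)"
    by (intro has_derivative_add has_derivative_mult_right)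
  then show "dir_deriv b (\<lambda>x. c * f x + d * g x) x = c * dir_deriv b f x + d * dir_deriv b g x"
    by (rule dir_deriv_eq)
qed

lemma iter_deriv_linear_combination:
  assumes "f \<in> smooth_functions" "g \<in> smooth_functions" "bs \<in> lists Basis"
  shows "iter_deriv bs (\<lambda>x. c * f x + d * g x) = (\<lambda>x. c * iter_deriv bs f x + d * iter_deriv bs g x)"
  using assms(3)
  by (induction bs) (auto simp: dir_deriv_linear_combination smooth_iter_deriv assms)

lemma smooth_linear_combination:
  assumes "f \<in> smooth_functions" "g \<in> smooth_functions"
  shows "(\<lambda>x. c * f x + d * g x) \<in> smooth_functions"
proof (rule smooth_functions_coinduct[where S="{\<lambda>x. c * f x + d * g x |f g. f \<in> smooth_functions \<and> g \<in> smooth_functions}"])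
  fix h assume "h \<in> {\<lambda>x. c * f x + d * g x |f g. f \<in> smooth_functions \<and> g \<in> smooth_functions}"
  then obtain f g where h: "h = (\<lambda>x. c * f x + d * g x)" and fg: "f \<in> smooth_functions" "g \<in> smooth_functions" by auto
  show "\<exists>f'. (\<forall>x. (h has_derivative f' x) (at x)) \<and> (\<forall>b\<in>Basis. (\<lambda>x. f' x b) \<in> {\<lambda>x. c * f x + d * g x |f g. f \<in> smooth_functions \<and> g \<in> smooth_functions})"
  proof (intro exI conjI allI ballI)
    show "(h has_derivative (\<lambda>v. c * dir_deriv v f x + d * dir_deriv v g x)) (at x)" for x
      unfolding h by (intro has_derivative_add has_derivative_mult_right smooth_has_derivative fg)
  qed (use smooth_dir_deriv fg in blast)
qed (use assms in blast)

lemma smooth_cmult: "f \<in> smooth_functions \<Longrightarrow> (\<lambda>x. c * f x) \<in> smooth_functions"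
  using smooth_linear_combination[of f f c 0] by simp

lemma smooth_add: "f \<in> smooth_functions \<Longrightarrow> g \<in> smooth_functions \<Longrightarrow> (\<lambda>x. f x + g x) \<in> smooth_functions"
  using smooth_linear_combination[of f g 1 1] by simp

lemma smooth_diff: "f \<in> smooth_functions \<Longrightarrow> g \<in> smooth_functions \<Longrightarrow> (\<lambda>x. f x - g x) \<in> smooth_functions"
  using smooth_linear_combination[of f g 1 "-1"] by simp

lemma smooth_zero: "(\<lambda>x. 0) \<in> smooth_functions"
  by (rule smooth_functions_coinduct[where S="{\<lambda>x. 0}"]) (auto intro!: exI[of _ "\<lambda>x v. 0"])

lemma smooth_sum:
  "finite A \<Longrightarrow> (\<And>i. i \<in> A \<Longrightarrow> f i \<in> smooth_functions) \<Longrightarrow> (\<lambda>x. \<Sum>i\<in>A. f i x) \<in> smooth_functions"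
  by (induction A rule: finite_induct) (auto simp: smooth_zero intro: smooth_add)

abbreviation translate :: "'a::euclidean_space \<Rightarrow> ('a \<Rightarrow> complex) \<Rightarrow> 'a \<Rightarrow> complex" where
  "translate a f \<equiv> \<lambda>y. f (y - a)"

lemma dir_deriv_translate:
  assumes "f \<in> smooth_functions"
  shows "dir_deriv b (translate a f) = (translate a (dir_deriv b f))"
proof
  fix x
  have "((translate a f) has_derivative (\<lambda>v. dir_deriv v f (x - a))) (at x)"
    by (rule has_derivative_compose[where g=f and f="\<lambda>x. x - a" and f'="\<lambda>v. v", OF _ smooth_has_derivative[OF assms], simplified])
       (auto intro!: derivative_eq_intros)
  then show "dir_deriv b (translate a f) x = dir_deriv b f (x - a)" by (rule dir_deriv_eq)
qed

lemma iter_deriv_translate: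
  assumes "f \<in> smooth_functions" "bs \<in> lists Basis"
  shows "iter_deriv bs (translate a f) = (translate a (iter_deriv bs f))"
  using assms(2) by (induction bs) (auto simp: dir_deriv_translate smooth_iter_deriv assms)

lemma smooth_translate:
  assumes "f \<in> smooth_functions"
  shows "(translate a f) \<in> smooth_functions"
proof (rule smooth_functions_coinduct[where S="{\<lambda>x. f (x - a) |f. f \<in> smooth_functions}"])
  fix h assume "h \<in> {\<lambda>x. f (x - a) |f. f \<in> smooth_functions}"
  then obtain f where h: "h = (translate a f)" and f: "f \<in> smooth_functions" by auto
  have "(h has_derivative (\<lambda>v. dir_deriv v f (x - a))) (at x)" for x
    unfolding h
    by (rule has_derivative_compose[where g=f and f="\<lambda>x. x - a" and f'="\<lambda>v. v", OF _ smooth_has_derivative[OF f], simplified])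
       (auto intro!: derivative_eq_intros)
  then show "\<exists>f'. (\<forall>x. (h has_derivative f' x) (at x)) \<and> (\<forall>b\<in>Basis. (\<lambda>x. f' x b) \<in> {\<lambda>x. f (x - a) |f. f \<in> smooth_functions})"
    using smooth_dir_deriv[OF f] by (intro exI[of _ "\<lambda>x v. dir_deriv v f (x - a)"]) blast
qed (use assms in blast)

text \<open>
  By the product rule the sums of products of smooth functions are closed under derivatives, which single products
  are not.
\<close>
inductive_set product_sums :: "('a::euclidean_space \<Rightarrow> complex) set" where
  prod: "f \<in> smooth_functions \<Longrightarrow> g \<in> smooth_functions \<Longrightarrow> (\<lambda>x. f x * g x) \<in> product_sums"
| add: "f \<in> product_sums \<Longrightarrow> g \<in> product_sums \<Longrightarrow> (\<lambda>x. f x + g x) \<in> product_sums"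

lemma smooth_mult:
  assumes "f \<in> smooth_functions" "g \<in> smooth_functions"
  shows "(\<lambda>x. f x * g x) \<in> smooth_functions"
proof (rule smooth_functions_coinduct[where S=product_sums])
  fix h :: "'a \<Rightarrow> complex" assume "h \<in> product_sums"
  then show "\<exists>f'. (\<forall>x. (h has_derivative f' x) (at x)) \<and> (\<forall>b\<in>Basis. (\<lambda>x. f' x b) \<in> product_sums)"
  proof induction
    case (prod f g)
    show ?case
    proof (intro exI conjI allI ballI)
      show "((\<lambda>x. f x * g x) has_derivative (\<lambda>v. f x * dir_deriv v g x + dir_deriv v f x * g x)) (at x)" for x
        by (intro has_derivative_mult smooth_has_derivative prod)
      show "(\<lambda>x. f x * dir_deriv b g x + dir_deriv b f x * g x) \<in> product_sums" if "b \<in> Basis" for b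
        by (intro product_sums.intros prod smooth_dir_deriv that)
    qed
  next
    case (add f g)
    then obtain f' g' where "\<forall>x. (f has_derivative f' x) (at x)" "\<forall>b\<in>Basis. (\<lambda>x. f' x b) \<in> product_sums"
      "\<forall>x. (g has_derivative g' x) (at x)" "\<forall>b\<in>Basis. (\<lambda>x. g' x b) \<in> product_sums" by blast
    then show ?case
      by (intro exI[of _ "\<lambda>x v. f' x v + g' x v"]) (auto intro: has_derivative_add product_sums.add)
  qed
qed (intro product_sums.prod assms)

lemma smooth_cis: "(\<lambda>x. cis (x \<bullet> \<xi>)) \<in> smooth_functions"
proof (rule smooth_functions_coinduct[where S="range (\<lambda>c x. c * cis (x \<bullet> \<xi>))"])
  fix h assume "h \<in> range (\<lambda>c x. c * cis (x \<bullet> \<xi>))"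
  then obtain c where h: "h = (\<lambda>x. c * cis (x \<bullet> \<xi>))" by auto
  show "\<exists>f'. (\<forall>x. (h has_derivative f' x) (at x)) \<and> (\<forall>b\<in>Basis. (\<lambda>x. f' x b) \<in> range (\<lambda>c x. c * cis (x \<bullet> \<xi>)))"
  proof (intro exI conjI allI ballI)
    show "(h has_derivative (\<lambda>v. c * ((v \<bullet> \<xi>) *\<^sub>R (\<i> * cis (x \<bullet> \<xi>))))) (at x)" for x
      unfolding h by (auto intro!: derivative_eq_intros)
    show "(\<lambda>x. c * ((b \<bullet> \<xi>) *\<^sub>R (\<i> * cis (x \<bullet> \<xi>)))) \<in> range (\<lambda>c x. c * cis (x \<bullet> \<xi>))" for b
      by (intro image_eqI[of _ _ "c * (b \<bullet> \<xi>) *\<^sub>R \<i>"]) (auto simp: fun_eq_iff)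
  qed
qed (auto intro: image_eqI[of _ _ 1])

lemma has_derivative_local_cong:
  assumes "open U" "x \<in> U" "\<And>y. y \<in> U \<Longrightarrow> f y = g y"
  shows "(f has_derivative f') (at x) \<longleftrightarrow> (g has_derivative f') (at x)"
  using has_derivative_transform_within_open[OF _ assms(1,2), of f f' UNIV g]
    has_derivative_transform_within_open[OF _ assms(1,2), of g f' UNIV f] assms(3) by auto

lemma iter_deriv_local_cong:
  assumes "open U" "\<And>y. y \<in> U \<Longrightarrow> f y = g y"
  shows "x \<in> U \<Longrightarrow> iter_deriv bs f x = iter_deriv bs g x"
proof (induction bs arbitrary: x)
  case (Cons b bs)
  have "frechet_derivative (iter_deriv bs f) (at x) = frechet_derivative (iter_deriv bs g) (at x)"
    unfolding frechet_derivative_def using has_derivative_local_cong[OF assms(1) Cons.prems Cons.IH] by simp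
  then show ?case by (simp add: dir_deriv_def)
qed (use assms in simp)

lemma iter_deriv_zero: "iter_deriv bs (\<lambda>x. 0) = (\<lambda>x. 0)"
  by (induction bs) (auto simp: dir_deriv_def)

lemma test_functionsD:
  assumes "f \<in> test_functions V"
  shows "f \<in> smooth_functions" "compact (closure {x. f x \<noteq> 0})" "closure {x. f x \<noteq> 0} \<subseteq> V"
  using assms by (auto simp: test_functions_def smooth_functions_def)

lemma test_functionsI:
  assumes "f \<in> smooth_functions" "compact K" "K \<subseteq> V" "\<And>x. x \<notin> K \<Longrightarrow> f x = 0"
  shows "f \<in> test_functions V"
proof -
  have "closure {x. f x \<noteq> 0} \<subseteq> K"
    by (rule closure_minimal) (use assms compact_imp_closed in auto)
  then show ?thesis using assms unfolding test_functions_def smooth_functions_def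
    by (auto simp: compact_closure intro: bounded_subset[OF compact_imp_bounded] closure_subset[THEN subsetD])
qed

lemma test_functionsE:
  assumes "f \<in> test_functions V"
  obtains K where "f \<in> smooth_functions" "compact K" "K \<subseteq> V" "\<And>x bs. x \<notin> K \<Longrightarrow> iter_deriv bs f x = 0"
proof (rule that)
  show "iter_deriv bs f x = 0" if "x \<notin> closure {x. f x \<noteq> 0}" for x bs
  proof -
    have "iter_deriv bs f x = iter_deriv bs (\<lambda>x. 0) x"
      by (rule iter_deriv_local_cong[of "- closure {x. f x \<noteq> 0}"])
         (use that closure_subset[of "{x. f x \<noteq> 0}"] in auto)
    then show ?thesis by (simp add: iter_deriv_zero)
  qed
qed (use test_functionsD[OF assms] in auto)

lemma test_iter_deriv:
  assumes "f \<in> test_functions V" "bs \<in> lists Basis"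
  shows "iter_deriv bs f \<in> test_functions V"
  using assms(1)
proof (rule test_functionsE)
  fix K assume K: "f \<in> smooth_functions" "compact K" "K \<subseteq> V" "\<And>x bs. x \<notin> K \<Longrightarrow> iter_deriv bs f x = 0"
  show ?thesis by (rule test_functionsI[OF smooth_iter_deriv[OF K(1) assms(2)] K(2,3,4)])
qed

lemma test_dir_deriv: "f \<in> test_functions V \<Longrightarrow> b \<in> Basis \<Longrightarrow> dir_deriv b f \<in> test_functions V"
  using test_iter_deriv[of f V "[b]"] by simp

lemma test_linear_combination:
  assumes "f \<in> test_functions V" "g \<in> test_functions V"
  shows "(\<lambda>x. c * f x + d * g x) \<in> test_functions V"
proof -
  obtain K where K: "f \<in> smooth_functions" "compact K" "K \<subseteq> V" "\<And>x bs. x \<notin> K \<Longrightarrow> iter_deriv bs f x = 0"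
    by (rule test_functionsE[OF assms(1)]) blast
  obtain L where L: "g \<in> smooth_functions" "compact L" "L \<subseteq> V" "\<And>x bs. x \<notin> L \<Longrightarrow> iter_deriv bs g x = 0"
    by (rule test_functionsE[OF assms(2)]) blast
  show ?thesis
    by (rule test_functionsI[of _ "K \<union> L"])
       (use K L K(4)[of _ "[]"] L(4)[of _ "[]"] in \<open>auto intro: smooth_linear_combination\<close>)
qed

lemma test_cmult: "f \<in> test_functions V \<Longrightarrow> (\<lambda>x. c * f x) \<in> test_functions V"
  using test_linear_combination[of f V f c 0] by simp

lemma test_zero: "(\<lambda>x. 0) \<in> test_functions V"
  by (rule test_functionsI[of _ "{}"]) (auto simp: smooth_zero)

lemma test_sum:
  "finite A \<Longrightarrow> (\<And>i. i \<in> A \<Longrightarrow> f i \<in> test_functions V) \<Longrightarrow> (\<lambda>x. \<Sum>i\<in>A. f i x) \<in> test_functions V"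
proof (induction A rule: finite_induct)
  case (insert a A)
  then show ?case using test_linear_combination[of "f a" V "\<lambda>x. \<Sum>i\<in>A. f i x" 1 1] by auto
qed (simp add: test_zero)

lemma test_mono: "V \<subseteq> W \<Longrightarrow> test_functions V \<subseteq> test_functions W"
  by (auto simp: test_functions_def)

lemma test_translate:
  assumes "f \<in> test_functions V" "\<And>x. x \<in> V \<Longrightarrow> x + a \<in> W"
  shows "(translate a f) \<in> test_functions W"
  using assms(1)
proof (rule test_functionsE)
  fix K assume K: "f \<in> smooth_functions" "compact K" "K \<subseteq> V" "\<And>x bs. x \<notin> K \<Longrightarrow> iter_deriv bs f x = 0"
  show ?thesis
  proof (rule test_functionsI[of _ "(\<lambda>x. x + a) ` K"])
    show "compact ((\<lambda>x. x + a) ` K)" by (intro compact_continuous_image continuous_intros K)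
    show "f (x - a) = 0" if "x \<notin> (\<lambda>x. x + a) ` K" for x
      using K(4)[of "x - a" "[]"] that by (metis diff_add_cancel image_eqI iter_deriv_Nil)
  qed (use K assms in \<open>auto intro: smooth_translate\<close>)
qed

lemma test_bounds:
  fixes f :: "'a::euclidean_space \<Rightarrow> complex"
  assumes "f \<in> test_functions V"
  obtains B L R where "0 < R" "\<And>x. R \<le> norm x \<Longrightarrow> f x = 0" "0 \<le> B" "\<And>x. norm (f x) \<le> B"
    "0 \<le> L" "\<And>x y. norm (f x - f y) \<le> L * norm (x - y)"
proof -
  obtain K where K: "f \<in> smooth_functions" "compact K" "K \<subseteq> V" "\<And>x bs. x \<notin> K \<Longrightarrow> iter_deriv bs f x = 0"
    by (rule test_functionsE[OF assms]) blast
  have bd: "\<exists>B\<ge>0. \<forall>x. norm (iter_deriv bs f x) \<le> B" if "bs \<in> lists Basis" for bs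
  proof -
    have "compact (iter_deriv bs f ` K)"
      by (intro compact_continuous_image smooth_continuous smooth_iter_deriv K that)
    then obtain B where B: "\<And>x. x \<in> K \<Longrightarrow> norm (iter_deriv bs f x) \<le> B"
      using compact_imp_bounded bounded_iff by (metis imageI)
    have "norm (iter_deriv bs f x) \<le> max B 0" for x
      using B[of x] K(4)[of x bs] by (cases "x \<in> K") auto
    then show ?thesis by (intro exI[of _ "max B 0"]) auto
  qed
  obtain B where B: "B \<ge> 0" "\<And>x. norm (f x) \<le> B" using bd[of "[]"] by auto
  have "\<forall>b\<in>Basis. \<exists>B\<ge>0. \<forall>x. norm (dir_deriv b f x) \<le> B" using bd[of "[_]"] by auto
  then obtain C where C: "\<And>b. b \<in> Basis \<Longrightarrow> C b \<ge> 0" "\<And>b x. b \<in> Basis \<Longrightarrow> norm (dir_deriv b f x) \<le> C b" by metis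
  have lip: "norm (f x - f y) \<le> (\<Sum>b\<in>Basis. C b) * norm (x - y)" for x y
  proof (rule differentiable_bound[where S=UNIV and f'="\<lambda>x v. dir_deriv v f x"])
    show "(f has_derivative (\<lambda>v. dir_deriv v f x)) (at x within UNIV)" for x
      using smooth_has_derivative[OF K(1)] by simp
    show "onorm (\<lambda>v. dir_deriv v f x) \<le> (\<Sum>b\<in>Basis. C b)" for x
    proof (rule onorm_le)
      fix v
      have "norm (\<Sum>b\<in>Basis. (v \<bullet> b) *\<^sub>R dir_deriv b f x) \<le> (\<Sum>b\<in>Basis. C b * norm v)"
      proof (rule sum_norm_le)
        fix b :: 'a assume b: "b \<in> Basis"
        have "\<bar>v \<bullet> b\<bar> * norm (dir_deriv b f x) \<le> norm v * C b"
          by (intro mult_mono Basis_le_norm C b) auto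
        then show "norm ((v \<bullet> b) *\<^sub>R dir_deriv b f x) \<le> C b * norm v" by (simp add: mult.commute)
      qed
      then show "norm (dir_deriv v f x) \<le> (\<Sum>b\<in>Basis. C b) * norm v"
        unfolding dir_deriv_Basis_expansion[OF K(1), of v] by (simp add: sum_distrib_right)
    qed
  qed auto
  obtain R where R: "R > 0" "\<And>x. x \<in> K \<Longrightarrow> norm x < R"
    using compact_imp_bounded[OF K(2)] by (meson bounded_pos_less)
  show ?thesis
    by (rule that[OF R(1) _ B _ lip]) (use R(2) K(4)[of _ "[]"] C in \<open>auto intro!: sum_nonneg, force\<close>)
qed

section \<open>Convolution with test functions\<close>

lemma lborel_affine_substitution:
  fixes f :: "'a::euclidean_space \<Rightarrow> 'b::{banach,second_countable_topology}"
  assumes [measurable]: "f \<in> borel_measurable borel" and c: "c \<noteq> 0"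
  shows "integrable lborel (\<lambda>x. f (t + c *\<^sub>R x)) \<longleftrightarrow> integrable lborel f"
    and "(\<integral>x. f (t + c *\<^sub>R x) \<partial>lborel) = (1 / \<bar>c\<bar> ^ DIM('a)) *\<^sub>R (\<integral>x. f x \<partial>lborel)"
proof -
  have m[measurable]: "(\<lambda>x::'a. t + c *\<^sub>R x) \<in> borel_measurable lborel" by measurable
  have "integrable lborel f \<longleftrightarrow> integrable (density (distr lborel borel (\<lambda>x. t + c *\<^sub>R x)) (\<lambda>_. \<bar>c\<bar> ^ DIM('a))) f"
    using lborel_affine[OF c, of t] by simp
  also have "\<dots> \<longleftrightarrow> integrable (distr lborel borel (\<lambda>x. t + c *\<^sub>R x)) (\<lambda>x. (\<bar>c\<bar> ^ DIM('a)) *\<^sub>R f x)"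
    by (rule integrable_density) auto
  also have "\<dots> \<longleftrightarrow> integrable lborel (\<lambda>x. (\<bar>c\<bar> ^ DIM('a)) *\<^sub>R f (t + c *\<^sub>R x))"
    by (rule integrable_distr_eq) auto
  also have "\<dots> \<longleftrightarrow> integrable lborel (\<lambda>x. f (t + c *\<^sub>R x))"
  proof
    assume "integrable lborel (\<lambda>x. (\<bar>c\<bar> ^ DIM('a)) *\<^sub>R f (t + c *\<^sub>R x))"
    then have "integrable lborel (\<lambda>x. (1 / \<bar>c\<bar> ^ DIM('a)) *\<^sub>R (\<bar>c\<bar> ^ DIM('a)) *\<^sub>R f (t + c *\<^sub>R x))"
      by (rule integrable_scaleR_right)
    then show "integrable lborel (\<lambda>x. f (t + c *\<^sub>R x))" using c by simp
  qed (rule integrable_scaleR_right)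
  finally show "integrable lborel (\<lambda>x. f (t + c *\<^sub>R x)) \<longleftrightarrow> integrable lborel f" ..
  have "(\<integral>x. f x \<partial>lborel) = (\<integral>x. f x \<partial>density (distr lborel borel (\<lambda>x. t + c *\<^sub>R x)) (\<lambda>_. \<bar>c\<bar> ^ DIM('a)))"
    using lborel_affine[OF c, of t] by simp
  also have "\<dots> = (\<integral>x. (\<bar>c\<bar> ^ DIM('a)) *\<^sub>R f x \<partial>distr lborel borel (\<lambda>x. t + c *\<^sub>R x))"
    by (rule integral_density) auto
  also have "\<dots> = (\<integral>x. (\<bar>c\<bar> ^ DIM('a)) *\<^sub>R f (t + c *\<^sub>R x) \<partial>lborel)"
    by (rule integral_distr) auto
  finally show "(\<integral>x. f (t + c *\<^sub>R x) \<partial>lborel) = (1 / \<bar>c\<bar> ^ DIM('a)) *\<^sub>R (\<integral>x. f x \<partial>lborel)"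
    using c by simp
qed

lemma lborel_reflect_translate:
  fixes f :: "'a::euclidean_space \<Rightarrow> 'b::{banach,second_countable_topology}"
  assumes "f \<in> borel_measurable borel"
  shows "(\<integral>x. f (t - x) \<partial>lborel) = (\<integral>x. f x \<partial>lborel)"
    and "integrable lborel (\<lambda>x. f (t - x)) \<longleftrightarrow> integrable lborel f"
    and "(\<integral>x. f (t + x) \<partial>lborel) = (\<integral>x. f x \<partial>lborel)"
    and "integrable lborel (\<lambda>x. f (t + x)) \<longleftrightarrow> integrable lborel f"
  using lborel_affine_substitution[OF assms, of "-1" t] lborel_affine_substitution[OF assms, of 1 t] by simp_all

definition locally_integrable :: "('a::euclidean_space \<Rightarrow> complex) \<Rightarrow> bool" where
  "locally_integrable m \<longleftrightarrow> m \<in> borel_measurable borel \<and> (\<forall>R. set_integrable lborel (cball 0 R) m)"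

definition conv :: "('a::euclidean_space \<Rightarrow> complex) \<Rightarrow> ('a \<Rightarrow> complex) \<Rightarrow> 'a \<Rightarrow> complex" where
  "conv \<Phi> m y = (\<integral>x. \<Phi> (y - x) * m x \<partial>lborel)"

lemma continuous_imp_locally_integrable:
  assumes "continuous_on UNIV m" shows "locally_integrable m"
  unfolding locally_integrable_def set_integrable_def
  using assms by (auto intro!: borel_integrable_compact borel_measurable_continuous_onI intro: continuous_on_subset)

lemma locally_integrable_cmult_bound:
  assumes "locally_integrable m" "0 < R" and [measurable]: "g \<in> borel_measurable borel"
    and "\<And>x. R < norm x \<Longrightarrow> g x = 0" "\<And>x. norm (g x) \<le> B"
  shows "integrable lborel (\<lambda>x. g x * m x)"
proof (rule Bochner_Integration.integrable_bound[of _ "\<lambda>x. B *\<^sub>R (indicator (cball 0 R) x *\<^sub>R norm (m x))"])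
  have "integrable lborel (\<lambda>x. norm (indicator (cball 0 R) x *\<^sub>R m x))"
    using assms(1) unfolding locally_integrable_def set_integrable_def by (intro integrable_norm) auto
  then show "integrable lborel (\<lambda>x. B *\<^sub>R (indicator (cball 0 R) x *\<^sub>R norm (m x)))"
    by (intro integrable_scaleR_right) (simp add: abs_indicator)
  have [measurable]: "m \<in> borel_measurable borel" using assms by (simp add: locally_integrable_def)
  show "(\<lambda>x. g x * m x) \<in> borel_measurable lborel" by measurable
  have "norm (g x * m x) \<le> norm (B *\<^sub>R (indicator (cball 0 R) x *\<^sub>R norm (m x)))" for x
  proof (cases "norm x \<le> R")
    case True
    have "norm (g x) * norm (m x) \<le> \<bar>B\<bar> * norm (m x)"
      using assms(5)[of x] by (intro mult_right_mono) auto
    then show ?thesis using True by (simp add: norm_mult)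
  next
    case False
    then show ?thesis using assms(4) by simp
  qed
  then show "AE x in lborel. norm (g x * m x) \<le> norm (B *\<^sub>R (indicator (cball 0 R) x *\<^sub>R norm (m x)))"
    by (rule AE_I2)
qed

lemma test_borel_measurable: "\<Phi> \<in> test_functions V \<Longrightarrow> \<Phi> \<in> borel_measurable borel"
  by (intro borel_measurable_continuous_onI smooth_continuous test_functionsD)

lemma conv_integrable:
  assumes "\<Phi> \<in> test_functions V" "locally_integrable m"
  shows "integrable lborel (\<lambda>x. \<Phi> (y - x) * m x)"
proof -
  obtain B L R where b: "0 < R" "\<And>x. R \<le> norm x \<Longrightarrow> \<Phi> x = 0" "0 \<le> B" "\<And>x. norm (\<Phi> x) \<le> B"
    by (rule test_bounds[OF assms(1)]) blast
  have [measurable]: "\<Phi> \<in> borel_measurable borel" using test_borel_measurable assms by blast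
  show ?thesis
  proof (rule locally_integrable_cmult_bound[OF assms(2), where R="R + norm y" and B=B])
    show "\<Phi> (y - x) = 0" if "R + norm y < norm x" for x
      using norm_triangle_ineq2[of x y] that by (intro b) (simp add: norm_minus_commute)
  qed (use b in \<open>auto simp: add_pos_nonneg\<close>)
qed

lemma conv_has_derivative:
  assumes "\<Phi> \<in> test_functions V" "locally_integrable m"
  shows "(conv \<Phi> m has_derivative (\<lambda>v. conv (dir_deriv v \<Phi>) m y)) (at y)"
proof -
  obtain B L R where b: "0 < R" "\<And>x. R \<le> norm x \<Longrightarrow> \<Phi> x = 0"
    "0 \<le> L" "\<And>x y. norm (\<Phi> x - \<Phi> y) \<le> L * norm (x - y)"
    by (rule test_bounds[OF assms(1)]) blast
  define K where "K = R + norm y + 1"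
  have "((\<lambda>y. \<integral>x. \<Phi> (y - x) * m x \<partial>lborel) has_derivative (\<lambda>v. \<integral>x. dir_deriv v \<Phi> (y - x) * m x \<partial>lborel)) (at y)"
  proof (rule has_derivative_integral(1)[where r=1 and w="\<lambda>x. L * norm (indicator (cball 0 K) x *\<^sub>R m x)"])
    show "integrable lborel (\<lambda>x. \<Phi> (y - x) * m x)" for y by (rule conv_integrable[OF assms])
    show "((\<lambda>y. \<Phi> (y - x) * m x) has_derivative (\<lambda>v. dir_deriv v \<Phi> (y - x) * m x)) (at y)" for x
      by (intro has_derivative_mult_left
            has_derivative_compose[where g=\<Phi> and f="\<lambda>y. y - x" and f'="\<lambda>v. v", OF _ smooth_has_derivative[OF test_functionsD(1)[OF assms(1)]], simplified])
         (auto intro!: derivative_eq_intros)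
    show "integrable lborel (\<lambda>x. L * norm (indicator (cball 0 K) x *\<^sub>R m x))"
      using assms(2) unfolding locally_integrable_def set_integrable_def by (intro integrable_mult_right integrable_norm) auto
    show "norm (\<Phi> (y' - x) * m x - \<Phi> (y - x) * m x) \<le> L * norm (indicator (cball 0 K) x *\<^sub>R m x) * norm (y' - y)"
      if "y' \<in> ball y 1" for x y'
    proof (cases "norm x \<le> K")
      case True
      have "norm (\<Phi> (y' - x) * m x - \<Phi> (y - x) * m x) = norm (\<Phi> (y' - x) - \<Phi> (y - x)) * norm (m x)"
        by (metis left_diff_distrib norm_mult)
      also have "\<dots> \<le> (L * norm (y' - y)) * norm (m x)"
        using b(4)[of "y' - x" "y - x"] by (intro mult_right_mono) auto
      finally show ?thesis using True by (simp add: mult_ac)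
    next
      case False
      have "norm (y' - y) < 1" using that by (simp add: dist_norm norm_minus_commute)
      then have "norm y' < norm y + 1" using norm_triangle_ineq2[of y' y] by linarith
      then have "\<Phi> (y' - x) = 0" "\<Phi> (y - x) = 0"
        using False norm_triangle_ineq2[of x y] norm_triangle_ineq2[of x y']
        by (auto intro!: b simp: K_def norm_minus_commute)
      then show ?thesis using b by simp
    qed
  qed simp
  then show ?thesis by (simp add: conv_def[abs_def])
qed

lemma smooth_conv:
  assumes "\<Phi> \<in> test_functions V" "locally_integrable m"
  shows "conv \<Phi> m \<in> smooth_functions"
proof (rule smooth_functions_coinduct[where S="(\<lambda>\<Phi>. conv \<Phi> m) ` test_functions V"])
  fix h assume "h \<in> (\<lambda>\<Phi>. conv \<Phi> m) ` test_functions V"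
  then obtain \<Phi> where h: "h = conv \<Phi> m" and P: "\<Phi> \<in> test_functions V" by auto
  show "\<exists>f'. (\<forall>x. (h has_derivative f' x) (at x)) \<and> (\<forall>b\<in>Basis. (\<lambda>x. f' x b) \<in> (\<lambda>\<Phi>. conv \<Phi> m) ` test_functions V)"
    unfolding h
    by (rule exI[of _ "\<lambda>x v. conv (dir_deriv v \<Phi>) m x"])
       (auto intro!: conv_has_derivative[OF P assms(2)] imageI test_dir_deriv[OF P])
qed (use assms in blast)

lemma iter_deriv_conv:
  assumes "\<Phi> \<in> test_functions V" "locally_integrable m" "bs \<in> lists Basis"
  shows "iter_deriv bs (conv \<Phi> m) = conv (iter_deriv bs \<Phi>) m"
  using assms(3)
proof (induction bs)
  case (Cons b bs)
  then have "iter_deriv bs \<Phi> \<in> test_functions V" by (intro test_iter_deriv assms) auto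
  then show ?case using Cons dir_deriv_eq[OF conv_has_derivative[OF _ assms(2)]] by auto
qed simp

text \<open>
  The Fourier transform at \<open>- \<xi>\<close>; with this sign it is the factor by which convolution acts on the
  exponential \<open>cis (- (x \<bullet> \<xi>))\<close>.
\<close>
definition test_transform :: "('a::euclidean_space \<Rightarrow> complex) \<Rightarrow> 'a \<Rightarrow> complex" where
  "test_transform \<Phi> \<xi> = (\<integral>w. \<Phi> w * cis (w \<bullet> \<xi>) \<partial>lborel)"

lemma locally_integrable_cis: "locally_integrable (\<lambda>x. cis (- (x \<bullet> \<xi>)))"
  by (intro continuous_imp_locally_integrable continuous_intros)

lemma conv_cis:
  assumes "\<Phi> \<in> test_functions V"
  shows "conv \<Phi> (\<lambda>x. cis (- (x \<bullet> \<xi>))) y = cis (- (y \<bullet> \<xi>)) * test_transform \<Phi> \<xi>"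
proof -
  have [measurable]: "\<Phi> \<in> borel_measurable borel" using test_borel_measurable assms by blast
  have [measurable]: "(\<lambda>w. cis (- ((y - w) \<bullet> \<xi>))) \<in> borel_measurable borel"
    by (intro borel_measurable_continuous_onI continuous_intros)
  have "conv \<Phi> (\<lambda>x. cis (- (x \<bullet> \<xi>))) y = (\<integral>x. (\<lambda>w. \<Phi> w * cis (- ((y - w) \<bullet> \<xi>))) (y - x) \<partial>lborel)"
    by (simp add: conv_def)
  also have "\<dots> = (\<integral>w. \<Phi> w * cis (- ((y - w) \<bullet> \<xi>)) \<partial>lborel)"
    by (rule lborel_reflect_translate) measurable
  also have "\<dots> = (\<integral>w. cis (- (y \<bullet> \<xi>)) * (\<Phi> w * cis (w \<bullet> \<xi>)) \<partial>lborel)"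
    by (intro Bochner_Integration.integral_cong) (auto simp: inner_diff_left cis_mult mult_ac)
  finally show ?thesis by (simp add: test_transform_def)
qed

text \<open>
  Both sides are the derivative at the origin of the convolution of \<open>\<Phi>\<close> with an exponential, computed once on
  \<open>\<Phi>\<close> and once on the exponential; this takes the place of an integration by parts.
\<close>
lemma test_transform_dir_deriv:
  assumes "\<Phi> \<in> test_functions V" "b \<in> Basis"
  shows "test_transform (dir_deriv b \<Phi>) \<xi> = - \<i> * of_real (b \<bullet> \<xi>) * test_transform \<Phi> \<xi>"
proof -
  let ?e = "\<lambda>x::'a. cis (- (x \<bullet> \<xi>))"
  have "test_transform (dir_deriv b \<Phi>) \<xi> = conv (dir_deriv b \<Phi>) ?e 0"
    using conv_cis[OF test_dir_deriv[OF assms], of \<xi> 0] by simp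
  also have "\<dots> = dir_deriv b (conv \<Phi> ?e) 0"
    by (rule dir_deriv_eq[OF conv_has_derivative[OF assms(1) locally_integrable_cis], symmetric])
  also have "conv \<Phi> ?e = (\<lambda>y. ?e y * test_transform \<Phi> \<xi>)"
    using conv_cis[OF assms(1)] by blast
  also have "dir_deriv b (\<lambda>y. ?e y * test_transform \<Phi> \<xi>) 0 = - \<i> * of_real (b \<bullet> \<xi>) * test_transform \<Phi> \<xi>"
  proof (rule dir_deriv_eq)
    show "((\<lambda>y. ?e y * test_transform \<Phi> \<xi>) has_derivative (\<lambda>v. - \<i> * of_real (v \<bullet> \<xi>) * test_transform \<Phi> \<xi>)) (at 0)"
      by (auto intro!: derivative_eq_intros simp: fun_eq_iff scaleR_conv_of_real)
  qed
  finally show ?thesis .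
qed

section \<open>Bump and cutoff functions\<close>

text \<open>
  The functions \<open>exp (- 1 / t)\<close>, extended by zero, times negative powers of \<open>t\<close>: a family whose span is closed
  under differentiation.
\<close>
definition flat :: "nat \<Rightarrow> real \<Rightarrow> real" where
  "flat k t = (if t > 0 then inverse t ^ k * exp (- inverse t) else 0)"

lemma flat_tendsto_0: "((\<lambda>t. flat k t) \<longlongrightarrow> 0) (at 0)"
proof -
  have "((\<lambda>t::real. inverse t ^ k / exp (inverse t)) \<longlongrightarrow> 0) (at_right 0)"
    by (rule filterlim_compose[OF tendsto_power_div_exp_0 filterlim_inverse_at_top_right])
  then have "((\<lambda>t. flat k t) \<longlongrightarrow> 0) (at_right 0)"
    by (rule Lim_transform_eventually) (auto simp: flat_def eventually_at_filter exp_minus divide_inverse)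
  moreover have "((\<lambda>t. flat k t) \<longlongrightarrow> 0) (at_left 0)"
    by (rule tendsto_eventually) (auto simp: flat_def eventually_at_filter)
  ultimately show ?thesis by (simp add: filterlim_split_at)
qed

lemma flat_has_derivative:
  "(flat k has_real_derivative (- real k * flat (k + 1) t + flat (k + 2) t)) (at t)"
proof -
  consider "t > 0" | "t < 0" | "t = 0" by linarith
  then show ?thesis
  proof cases
    case 1
    have "((\<lambda>t. inverse t ^ k * exp (- inverse t)) has_real_derivative (- real k * flat (k + 1) t + flat (k + 2) t)) (at t)"
    proof (cases k)
      case 0
      then show ?thesis using 1
        by (auto intro!: derivative_eq_intros simp: flat_def power2_eq_square)
    next
      case (Suc p)
      then show ?thesis using 1
        by (auto intro!: derivative_eq_intros simp: flat_def power2_eq_square algebra_simps) (cases p; simp)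
    qed
    then show ?thesis
      by (rule has_field_derivative_transform_within_open[where S="{0<..}"]) (use 1 in \<open>auto simp: flat_def\<close>)
  next
    case 2
    have "((\<lambda>t. 0) has_real_derivative (- real k * flat (k + 1) t + flat (k + 2) t)) (at t)"
      using 2 by (auto simp: flat_def)
    then show ?thesis
      by (rule has_field_derivative_transform_within_open[where S="{..<0}"]) (use 2 in \<open>auto simp: flat_def\<close>)
  next
    case 3
    have "((\<lambda>h. (flat k (0 + h) - flat k 0) / h) \<longlongrightarrow> 0) (at 0)"
      by (rule Lim_transform_eventually[OF flat_tendsto_0[of "Suc k"]])
         (auto simp: flat_def eventually_at_filter divide_inverse)
    then show ?thesis using 3 by (simp add: DERIV_def flat_def)
  qed
qed

text \<open>
  Differentiating \<open>flat k (s - (y - c) \<bullet> (y - c))\<close> produces coordinates of \<open>y - c\<close> times functions of the same form.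
\<close>
inductive_set bump_algebra :: "'a::euclidean_space \<Rightarrow> real \<Rightarrow> ('a \<Rightarrow> complex) set" for c s where
  flat: "(\<lambda>y. of_real (flat k (s - (y - c) \<bullet> (y - c)))) \<in> bump_algebra c s"
| coord: "f \<in> bump_algebra c s \<Longrightarrow> (\<lambda>y. of_real ((y - c) \<bullet> b) * f y) \<in> bump_algebra c s"
| lin: "f \<in> bump_algebra c s \<Longrightarrow> g \<in> bump_algebra c s \<Longrightarrow> (\<lambda>y. u * f y + v * g y) \<in> bump_algebra c s"

lemma bump_algebra_smooth: "f \<in> bump_algebra c s \<Longrightarrow> f \<in> smooth_functions"
proof (rule smooth_functions_coinduct[where S="bump_algebra c s"])
  fix h assume "h \<in> bump_algebra c s"
  then show "\<exists>f'. (\<forall>x. (h has_derivative f' x) (at x)) \<and> (\<forall>b\<in>Basis. (\<lambda>x. f' x b) \<in> bump_algebra c s)"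
  proof induction
    case (flat k)
    let ?q = "\<lambda>y. s - (y - c) \<bullet> (y - c)"
    define F where "F y = of_real (- real k) * complex_of_real (flat (k + 1) (?q y)) + 1 * of_real (flat (k + 2) (?q y))" for y
    have F: "F \<in> bump_algebra c s" unfolding F_def by (intro bump_algebra.intros)
    show ?case
    proof (intro exI conjI allI ballI)
      fix y
      have "(?q has_derivative (\<lambda>v. - 2 * ((y - c) \<bullet> v))) (at y)"
        by (auto intro!: derivative_eq_intros simp: inner_commute)
      from has_derivative_compose[OF this flat_has_derivative[of k "?q y", unfolded has_field_derivative_def]]
      show "((\<lambda>y. complex_of_real (flat k (?q y))) has_derivative (\<lambda>v. -2 * (of_real ((y - c) \<bullet> v) * F y) + 0 * F y)) (at y)"
        by (rule has_derivative_eq_rhs[OF has_derivative_of_real]) (simp add: F_def fun_eq_iff algebra_simps)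
      show "(\<lambda>y. -2 * (of_real ((y - c) \<bullet> b) * F y) + 0 * F y) \<in> bump_algebra c s" for b
        by (intro bump_algebra.lin bump_algebra.coord F)
    qed
  next
    case (coord f b)
    then obtain f' where f': "\<And>x. (f has_derivative f' x) (at x)" "\<And>b. b \<in> Basis \<Longrightarrow> (\<lambda>x. f' x b) \<in> bump_algebra c s" by blast
    show ?case
    proof (intro exI conjI allI ballI)
      show "((\<lambda>y. of_real ((y - c) \<bullet> b) * f y) has_derivative (\<lambda>v. 1 * (of_real ((y - c) \<bullet> b) * f' y v) + of_real (v \<bullet> b) * f y)) (at y)" for y
      proof -
        have "((\<lambda>y. complex_of_real ((y - c) \<bullet> b)) has_derivative (\<lambda>v. of_real (v \<bullet> b))) (at y)"
          by (auto intro!: derivative_eq_intros)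
        from has_derivative_mult[OF this f'(1)] show ?thesis by (simp add: mult.commute add.commute)
      qed
      show "(\<lambda>y. 1 * (of_real ((y - c) \<bullet> b) * f' y a) + of_real (a \<bullet> b) * f y) \<in> bump_algebra c s" if "a \<in> Basis" for a
        by (intro bump_algebra.lin bump_algebra.coord f' that coord)
    qed
  next
    case (lin f g u v)
    then obtain f' g' where f': "\<And>x. (f has_derivative f' x) (at x)" "\<And>b. b \<in> Basis \<Longrightarrow> (\<lambda>x. f' x b) \<in> bump_algebra c s"
      and g': "\<And>x. (g has_derivative g' x) (at x)" "\<And>b. b \<in> Basis \<Longrightarrow> (\<lambda>x. g' x b) \<in> bump_algebra c s" by metis
    show ?case
      by (rule exI[of _ "\<lambda>x a. u * f' x a + v * g' x a"])
         (auto intro!: has_derivative_add has_derivative_mult_right bump_algebra.lin f' g')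
  qed
qed

lemma bump_exists:
  fixes c :: "'a::euclidean_space"
  assumes r: "0 < r"
  obtains e :: "'a \<Rightarrow> real" where "(\<lambda>y. complex_of_real (e y)) \<in> test_functions (ball c r)"
    "continuous_on UNIV e" "\<And>y. e y \<ge> 0" "e c > 0" "\<And>y. y \<notin> ball c r \<Longrightarrow> e y = 0"
    "integrable lborel e" "(\<integral>y. e y \<partial>lborel) > 0"
proof -
  define s where "s = (r / 2)\<^sup>2"
  define e where "e y = flat 0 (s - (y - c) \<bullet> (y - c))" for y
  have sm: "(\<lambda>y. complex_of_real (e y)) \<in> smooth_functions"
    unfolding e_def by (rule bump_algebra_smooth) (rule bump_algebra.flat)
  have z: "e y = 0" if "y \<notin> cball c (r / 2)" for y
  proof -
    have "(r / 2)\<^sup>2 \<le> (norm (y - c))\<^sup>2"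
      using that r by (intro power_mono) (auto simp: dist_norm norm_minus_commute)
    then show ?thesis by (simp add: e_def flat_def s_def power2_norm_eq_inner)
  qed
  have test: "(\<lambda>y. complex_of_real (e y)) \<in> test_functions (ball c r)"
    by (rule test_functionsI[OF sm, of "cball c (r / 2)"]) (use z r in auto)
  have "continuous_on UNIV (\<lambda>y. Re (complex_of_real (e y)))"
    by (intro continuous_intros smooth_continuous sm)
  then have cont: "continuous_on UNIV e" by simp
  have nn: "e y \<ge> 0" for y by (simp add: e_def flat_def)
  have pos: "e c > 0" using r by (simp add: e_def flat_def s_def)
  have "integrable lborel (\<lambda>y. indicator (cball c (r / 2)) y *\<^sub>R e y)"
    by (intro borel_integrable_compact continuous_on_subset[OF cont]) auto
  also have "(\<lambda>y. indicator (cball c (r / 2)) y *\<^sub>R e y) = e"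
    using z by (auto simp: fun_eq_iff indicator_def)
  finally have int: "integrable lborel e" .
  show ?thesis
    by (rule that[OF test cont nn pos _ int continuous_integral_pos[OF cont int nn pos]])
       (use z r in auto)
qed

text \<open>
  A bump times \<open>cis (- (y \<bullet> \<xi>))\<close>: its transform at \<open>\<xi>\<close> is the integral of the bump.
\<close>
lemma test_transform_nonzero_exists:
  fixes \<xi> :: "'a::euclidean_space"
  assumes "0 < r"
  shows "\<exists>\<eta>\<in>test_functions (ball 0 r). test_transform \<eta> \<xi> \<noteq> 0"
proof -
  obtain e :: "'a \<Rightarrow> real" where e: "(\<lambda>y. complex_of_real (e y)) \<in> test_functions (ball 0 r)"
    "(\<integral>y. e y \<partial>lborel) > 0" "integrable lborel e"
    using bump_exists[OF assms, of 0] by metis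
  obtain K where K: "(\<lambda>y. complex_of_real (e y)) \<in> smooth_functions" "compact K" "K \<subseteq> ball 0 r"
      "\<And>x bs. x \<notin> K \<Longrightarrow> iter_deriv bs (\<lambda>y. complex_of_real (e y)) x = 0"
    by (rule test_functionsE[OF e(1)]) blast
  define \<eta> where "\<eta> y = of_real (e y) * cis (y \<bullet> - \<xi>)" for y
  have "\<eta> \<in> test_functions (ball 0 r)"
    by (rule test_functionsI[OF _ K(2,3)])
       (use K(4)[of _ "[]"] smooth_mult[OF K(1) smooth_cis, of "- \<xi>"] in \<open>auto simp: \<eta>_def[abs_def]\<close>)
  moreover have "test_transform \<eta> \<xi> = of_real (\<integral>y. e y \<partial>lborel)"
  proof -
    have "\<eta> w * cis (w \<bullet> \<xi>) = of_real (e w)" for w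
      by (simp add: \<eta>_def mult.assoc cis_mult)
    then show ?thesis by (simp add: test_transform_def)
  qed
  ultimately show ?thesis using e(2) by (intro bexI[of _ \<eta>]) auto
qed

text \<open>
  The indicator of a ball of radius \<open>R + 1\<close>, convolved with a bump of radius \<open>1\<close> and integral \<open>1\<close>.
\<close>
lemma cutoff_exists:
  assumes R: "0 < R"
  obtains cut :: "'a::euclidean_space \<Rightarrow> complex" where "cut \<in> test_functions UNIV" "\<And>y. y \<in> ball 0 R \<Longrightarrow> cut y = 1"
proof -
  obtain e :: "'a \<Rightarrow> real" where e: "(\<lambda>y. complex_of_real (e y)) \<in> test_functions (ball 0 1)"
    "(\<integral>y. e y \<partial>lborel) > 0" "integrable lborel e" "\<And>y. y \<notin> ball 0 1 \<Longrightarrow> e y = 0" "continuous_on UNIV e"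
    using bump_exists[of 1 "0::'a"] by (metis zero_less_one)
  define I where "I = (\<integral>y. e y \<partial>lborel)"
  define \<eta> where "\<eta> y = of_real (inverse I) * complex_of_real (e y)" for y
  define m where "m x = (if norm x \<le> R + 1 then 1 else 0 :: complex)" for x :: 'a
  have \<eta>: "\<eta> \<in> test_functions (ball 0 1)" unfolding \<eta>_def by (intro test_cmult e)
  have \<eta>0: "\<eta> y = 0" if "norm y \<ge> 1" for y using e(4)[of y] that by (simp add: \<eta>_def)
  have [measurable]: "\<eta> \<in> borel_measurable borel" using test_borel_measurable[OF \<eta>] .
  have int1: "(\<integral>y. \<eta> y \<partial>lborel) = 1"
    using e(2) by (simp add: \<eta>_def I_def)
  have m: "locally_integrable m"
    unfolding locally_integrable_def set_integrable_def
  proof (intro conjI allI)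
    show "m \<in> borel_measurable borel" unfolding m_def by measurable
    then show "integrable lborel (\<lambda>x. indicator (cball 0 r) x *\<^sub>R m x)" for r
      by (intro Bochner_Integration.integrable_bound[OF borel_integrable_compact[of "cball 0 r" "\<lambda>_. 1::real"]])
         (auto simp: m_def indicator_def intro!: AE_I2)
  qed
  have "conv \<eta> m \<in> test_functions UNIV"
  proof (rule test_functionsI[OF smooth_conv[OF \<eta> m], of "cball 0 (R + 2)"])
    show "conv \<eta> m y = 0" if y: "y \<notin> cball 0 (R + 2)" for y
    proof -
      have "\<eta> (y - x) * m x = 0" for x
      proof (cases "norm x \<le> R + 1")
        case True
        then have "norm (y - x) \<ge> 1" using y norm_triangle_ineq2[of y x] by auto
        then show ?thesis by (simp add: \<eta>0)
      qed (simp add: m_def)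
      then show ?thesis unfolding conv_def by (simp only: integral_zero)
    qed
  qed auto
  moreover have "conv \<eta> m y = 1" if y: "y \<in> ball 0 R" for y
  proof -
    have "\<eta> (y - x) * m x = \<eta> (y - x)" for x
    proof (cases "norm x \<le> R + 1")
      case False
      then have "norm (y - x) \<ge> 1" using y norm_triangle_ineq2[of x y] by (simp add: norm_minus_commute)
      then show ?thesis by (simp add: \<eta>0)
    qed (simp add: m_def)
    then have "conv \<eta> m y = (\<integral>x. \<eta> (y - x) \<partial>lborel)" by (simp only: conv_def)
    also have "\<dots> = 1" using int1 by (subst lborel_reflect_translate(1)) auto
    finally show ?thesis .
  qed
  ultimately show ?thesis by (rule that)
qed

section \<open>The unique continuation argument for a functional\<close>

lemma axis_Basis: "axis j 1 \<in> (Basis :: (real ^ 'n::finite) set)"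
  by (auto simp: Basis_vec_def)

lemma test_D_coord: "\<phi> \<in> test_functions V \<Longrightarrow> D_coord j \<phi> \<in> test_functions V"
  unfolding D_coord_def by (intro test_cmult test_dir_deriv axis_Basis)

lemma test_D_coord_power: "\<phi> \<in> test_functions V \<Longrightarrow> (D_coord j ^^ k) \<phi> \<in> test_functions V"
  by (induction k) (auto intro: test_D_coord)

lemma test_D_multi: "\<phi> \<in> test_functions V \<Longrightarrow> D_multi \<alpha> \<phi> \<in> test_functions V"
proof -
  assume "\<phi> \<in> test_functions V"
  then have "foldr (\<lambda>j. D_coord j ^^ Poly_Mapping.lookup \<alpha> j) js \<phi> \<in> test_functions V" for js
    by (induction js) (auto intro: test_D_coord_power)
  then show ?thesis by (simp add: D_multi_def)
qed

lemma D_coord_translate: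
  "\<phi> \<in> test_functions V \<Longrightarrow> D_coord j (translate x \<phi>) = (translate x (D_coord j \<phi>))"
  unfolding D_coord_def by (simp add: dir_deriv_translate test_functionsD(1))

lemma D_multi_translate:
  assumes "\<phi> \<in> test_functions V"
  shows "D_multi \<alpha> (translate x \<phi>) = (translate x (D_multi \<alpha> \<phi>))"
proof -
  have pow: "(D_coord j ^^ k) (translate x \<psi>) = (\<lambda>y. (D_coord j ^^ k) \<psi> (y - x))"
    if "\<psi> \<in> test_functions V" for \<psi> j k
    by (induction k) (auto simp: D_coord_translate[OF test_D_coord_power[OF that]])
  have "foldr (\<lambda>j. D_coord j ^^ Poly_Mapping.lookup \<alpha> j) js (translate x \<phi>)
      = (\<lambda>y. foldr (\<lambda>j. D_coord j ^^ Poly_Mapping.lookup \<alpha> j) js \<phi> (y - x)) \<and>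
      foldr (\<lambda>j. D_coord j ^^ Poly_Mapping.lookup \<alpha> j) js \<phi> \<in> test_functions V" for js
    by (induction js) (auto simp: pow assms test_D_coord_power)
  then show ?thesis by (simp add: D_multi_def)
qed

lemma coordinates_enumerate: "distinct (coordinates :: 'n::finite list) \<and> set (coordinates :: 'n list) = UNIV"
  unfolding coordinates_def
  by (rule someI_ex) (metis finite_distinct_list finite)

lemma test_transform_D_multi:
  fixes \<xi> :: "real ^ 'n::finite"
  assumes "\<phi> \<in> test_functions V"
  shows "test_transform (D_multi \<alpha> \<phi>) \<xi> = of_real (\<Prod>j\<in>UNIV. (- (\<xi> $ j)) ^ Poly_Mapping.lookup \<alpha> j) * test_transform \<phi> \<xi>"
proof -
  have one: "test_transform (D_coord j \<psi>) \<xi> = of_real (- (\<xi> $ j)) * test_transform \<psi> \<xi>"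
    if "\<psi> \<in> test_functions V" for \<psi> j
  proof -
    have "test_transform (D_coord j \<psi>) \<xi> = - \<i> * test_transform (dir_deriv (axis j 1) \<psi>) \<xi>"
      by (simp add: D_coord_def test_transform_def mult.assoc)
    also have "\<dots> = of_real (- (\<xi> $ j)) * test_transform \<psi> \<xi>"
      unfolding test_transform_dir_deriv[OF that axis_Basis] by (simp add: inner_axis' flip: mult.assoc)
    finally show ?thesis .
  qed
  have pow: "test_transform ((D_coord j ^^ k) \<psi>) \<xi> = of_real ((- (\<xi> $ j)) ^ k) * test_transform \<psi> \<xi>"
    if "\<psi> \<in> test_functions V" for \<psi> j k
    by (induction k) (auto simp: one[OF test_D_coord_power[OF that]])
  have fold: "test_transform (foldr (\<lambda>j. D_coord j ^^ Poly_Mapping.lookup \<alpha> j) js \<phi>) \<xi>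
      = of_real (\<Prod>j\<leftarrow>js. (- (\<xi> $ j)) ^ Poly_Mapping.lookup \<alpha> j) * test_transform \<phi> \<xi> \<and>
      foldr (\<lambda>j. D_coord j ^^ Poly_Mapping.lookup \<alpha> j) js \<phi> \<in> test_functions V" for js
    by (induction js) (auto simp: pow assms test_D_coord_power)
  have "(\<Prod>j\<leftarrow>coordinates. (- (\<xi> $ j)) ^ Poly_Mapping.lookup \<alpha> j) = (\<Prod>j\<in>UNIV. (- (\<xi> $ j)) ^ Poly_Mapping.lookup \<alpha> j)"
    using coordinates_enumerate[where 'n='n] prod.distinct_set_conv_list[of "coordinates :: 'n list" "\<lambda>j. (- (\<xi> $ j)) ^ Poly_Mapping.lookup \<alpha> j"] by simp
  then show ?thesis using fold[of coordinates] by (simp add: D_multi_def)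
qed

text \<open>
  The transpose of \<open>P(D)\<close>: a linear functional \<open>u\<close> satisfies
  \<open>const_coeff_op P u \<phi> = u (transposed_op P \<phi>)\<close>.
\<close>
definition transposed_op :: "'n::finite cpoly \<Rightarrow> (real ^ 'n \<Rightarrow> complex) \<Rightarrow> real ^ 'n \<Rightarrow> complex" where
  "transposed_op P \<phi> y = (\<Sum>\<alpha>\<in>Poly_Mapping.keys P. (Poly_Mapping.lookup P \<alpha> * (- 1) ^ (\<Sum>j\<in>UNIV. Poly_Mapping.lookup \<alpha> j)) * D_multi \<alpha> \<phi> y)"

lemma test_transposed_op: "\<phi> \<in> test_functions V \<Longrightarrow> transposed_op P \<phi> \<in> test_functions V"
  unfolding transposed_op_def[abs_def] by (intro test_sum test_cmult test_D_multi finite_keys)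

lemma transposed_op_translate:
  "\<phi> \<in> test_functions V \<Longrightarrow> transposed_op P (translate x \<phi>) = (translate x (transposed_op P \<phi>))"
  by (simp add: transposed_op_def[abs_def] D_multi_translate)

lemma test_transform_integrable:
  assumes "\<phi> \<in> test_functions V"
  shows "integrable lborel (\<lambda>w. \<phi> w * cis (w \<bullet> \<xi>))"
proof -
  have [measurable]: "\<phi> \<in> borel_measurable borel" using test_borel_measurable[OF assms] .
  have [measurable]: "(\<lambda>w. \<phi> w * cis (w \<bullet> \<xi>)) \<in> borel_measurable borel"
    by (intro borel_measurable_continuous_onI continuous_intros smooth_continuous[OF test_functionsD(1)[OF assms]])
  have "integrable lborel (\<lambda>x. \<phi> (0 - x) * cis (- (x \<bullet> \<xi>)))"
    by (rule conv_integrable[OF assms locally_integrable_cis])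
  then show ?thesis
    using lborel_reflect_translate(2)[of "\<lambda>w. \<phi> w * cis (w \<bullet> \<xi>)" 0] by simp
qed

text \<open>
  The sign \<open>(- 1) ^ (sum of the exponents)\<close> of the transposition cancels the one that results from taking the
  transform at \<open>- \<xi>\<close>.
\<close>
lemma test_transform_transposed_op:
  assumes "\<phi> \<in> test_functions V"
  shows "test_transform (transposed_op P \<phi>) \<xi> = cpoly_eval P \<xi> * test_transform \<phi> \<xi>"
proof -
  have sgn: "(- 1) ^ (\<Sum>j\<in>UNIV. Poly_Mapping.lookup \<alpha> j) * (\<Prod>j\<in>UNIV. (- (\<xi> $ j)) ^ Poly_Mapping.lookup \<alpha> j)
     = (\<Prod>j\<in>UNIV. (\<xi> $ j) ^ Poly_Mapping.lookup \<alpha> j)" for \<alpha>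
    by (simp add: power_sum prod.distrib[symmetric] power_mult_distrib[symmetric])
  have "test_transform (transposed_op P \<phi>) \<xi> = (\<Sum>\<alpha>\<in>Poly_Mapping.keys P. \<integral>w. (Poly_Mapping.lookup P \<alpha> * (- 1) ^ (\<Sum>j\<in>UNIV. Poly_Mapping.lookup \<alpha> j)) * (D_multi \<alpha> \<phi> w * cis (w \<bullet> \<xi>)) \<partial>lborel)"
    unfolding test_transform_def transposed_op_def sum_distrib_right mult.assoc[of _ "D_multi _ _ _"]
    by (rule Bochner_Integration.integral_sum) (intro integrable_mult_right test_transform_integrable[OF test_D_multi[OF assms]])
  also have "\<dots> = (\<Sum>\<alpha>\<in>Poly_Mapping.keys P. (Poly_Mapping.lookup P \<alpha> * (- 1) ^ (\<Sum>j\<in>UNIV. Poly_Mapping.lookup \<alpha> j)) * test_transform (D_multi \<alpha> \<phi>) \<xi>)"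
    by (simp add: test_transform_def)
  also have "\<dots> = (\<Sum>\<alpha>\<in>Poly_Mapping.keys P. Poly_Mapping.lookup P \<alpha> * of_real (\<Prod>j\<in>UNIV. (\<xi> $ j) ^ Poly_Mapping.lookup \<alpha> j) * test_transform \<phi> \<xi>)"
    unfolding test_transform_D_multi[OF assms] sgn[symmetric] by (simp add: mult_ac)
  finally show ?thesis by (simp add: cpoly_eval_def sum_distrib_right)
qed

lemma linear_functional_sum:
  assumes lin: "\<And>f g c d. f \<in> test_functions V \<Longrightarrow> g \<in> test_functions V \<Longrightarrow> u (\<lambda>x. c * f x + d * g x) = c * u f + d * u g"
    and "finite A" "\<And>i. i \<in> A \<Longrightarrow> f i \<in> test_functions V"
  shows "u (\<lambda>x. \<Sum>i\<in>A. c i * f i x) = (\<Sum>i\<in>A. c i * (u (f i) :: complex))"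
  using assms(2,3)
proof (induction A rule: finite_induct)
  case empty
  show ?case using lin[OF test_zero test_zero, of 0 0] by simp
next
  case (insert a A)
  have "u (\<lambda>x. c a * f a x + 1 * (\<Sum>i\<in>A. c i * f i x)) = c a * u (f a) + 1 * u (\<lambda>x. \<Sum>i\<in>A. c i * f i x)"
    using insert by (intro lin test_sum test_cmult) auto
  then show ?case using insert by simp
qed

text \<open>
  For a test function \<open>\<eta>\<close> supported near the origin, \<open>h x = u (translate x (transposed_op P \<eta>))\<close> is a regularization
  of \<open>P(D) u\<close>. Near a point of \<open>V\<close> it vanishes by \<open>pde\<close>, and so does its Riesz potential by \<open>riesz\<close>; hence
  \<open>h = 0\<close> by unique continuation. Since the Fourier transform of \<open>h\<close> is \<open>U \<xi> * cpoly_eval P \<xi>\<close> times the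
  transform of \<open>\<eta>\<close>, it follows that \<open>U\<close> vanishes off the zeros of \<open>P\<close>, a dense set. The Fourier transforms of
  the regularizations of \<open>u\<close> itself are continuous and divisible by \<open>U\<close>, so they vanish identically.

  All conditions concern the values of \<open>u\<close> on test functions, so that \<open>u\<close> can be a distribution of compact support
  as well as the integral against a function.
\<close>
theorem vanishing_if_normal_operator_vanishes:
  fixes u :: "(real ^ 'n) distribution" and U :: "real ^ 'n \<Rightarrow> complex"
  assumes dim: "CARD('n) \<ge> 2" and V: "open V" "V \<noteq> {}" and P: "P \<noteq> 0"
    and lin: "\<And>f g c d. f \<in> test_functions UNIV \<Longrightarrow> g \<in> test_functions UNIV \<Longrightarrow> u (\<lambda>x. c * f x + d * g x) = c * u f + d * u g"
    and cont: "\<And>\<phi>. \<phi> \<in> test_functions UNIV \<Longrightarrow> continuous_on UNIV (\<lambda>x. u (translate x \<phi>))"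
    and int: "\<And>\<phi>. \<phi> \<in> test_functions UNIV \<Longrightarrow> integrable lborel (\<lambda>x. u (translate x \<phi>))"
    and riesz: "\<And>\<phi> c. \<phi> \<in> test_functions UNIV \<Longrightarrow> (translate c \<phi>) \<in> test_functions V \<Longrightarrow>
        (\<integral>x. u (translate x \<phi>) * of_real (riesz_kernel (x - c)) \<partial>lborel) = 0"
    and fourier: "\<And>\<phi> \<xi>. \<phi> \<in> test_functions UNIV \<Longrightarrow>
        (\<integral>x. u (translate x \<phi>) * cis (- (x \<bullet> \<xi>)) \<partial>lborel) = U \<xi> * test_transform \<phi> \<xi>"
    and pde: "vanishes_on V (const_coeff_op P u)"
    and \<phi>: "\<phi> \<in> test_functions UNIV"
  shows "u \<phi> = 0"
proof -
  obtain c0 r where r: "r > 0" "ball c0 r \<subseteq> V" using V by (meson ex_in_conv openE)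
  \<comment> \<open>Test functions supported within \<open>d\<close> of the origin may be moved to any point within \<open>2 * d\<close> of \<open>c0\<close>.\<close>
  define d where "d = r / 3"
  have d: "d > 0" using r by (simp add: d_def)
  have near: "(translate x \<eta>) \<in> test_functions V" if "\<eta> \<in> test_functions (ball 0 d)" "x \<in> ball c0 (2 * d)" for \<eta> and x :: "real ^ 'n"
  proof (rule test_translate[OF that(1)])
    fix y :: "real ^ 'n" assume y: "y \<in> ball 0 d"
    have "dist c0 (y + x) \<le> dist c0 x + dist x (y + x)" by (rule dist_triangle)
    also have "\<dots> < r" using y that(2) by (simp add: d_def dist_norm)
    finally show "y + x \<in> V" using r by auto
  qed
  have pde': "u (transposed_op P \<psi>) = 0" if \<psi>: "\<psi> \<in> test_functions V" for \<psi>
  proof -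
    have "u (transposed_op P \<psi>) = (\<Sum>\<alpha>\<in>Poly_Mapping.keys P. Poly_Mapping.lookup P \<alpha> * (- 1) ^ (\<Sum>j\<in>UNIV. Poly_Mapping.lookup \<alpha> j) * u (D_multi \<alpha> \<psi>))"
      unfolding transposed_op_def[abs_def]
      by (rule linear_functional_sum[where V=UNIV, OF lin])
         (use test_D_multi[OF subsetD[OF test_mono[OF subset_UNIV] \<psi>]] in auto)
    also have "\<dots> = const_coeff_op P u \<psi>"
      by (simp add: const_coeff_op_def D_multi_dist_def mult.assoc)
    finally show ?thesis using pde \<psi> by (simp add: vanishes_on_def)
  qed
  have UP: "U \<xi> * cpoly_eval P \<xi> = 0" for \<xi>
  proof -
    obtain \<eta> where \<eta>: "\<eta> \<in> test_functions (ball 0 d)" "test_transform \<eta> \<xi> \<noteq> 0"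
      using test_transform_nonzero_exists[OF d] by blast
    have \<eta>': "\<eta> \<in> test_functions UNIV" using \<eta>(1) test_mono[of "ball 0 d" UNIV] by auto
    have Q: "transposed_op P \<eta> \<in> test_functions UNIV" by (rule test_transposed_op[OF \<eta>'])
    define h where "h x = u (translate x (transposed_op P \<eta>))" for x
    have "h x = 0" for x
    proof (rule Riesz_potential_unique_continuation[where h=h and d=d and x=x])
      show "2 \<le> DIM(real ^ 'n)" using dim by simp
      show "continuous_on UNIV h" unfolding h_def by (rule cont[OF Q])
      show "integrable lborel h" unfolding h_def by (rule int[OF Q])
      show "h y = 0" if "y \<in> ball c0 (2 * d)" for y
        using pde'[OF near[OF \<eta>(1) that]] transposed_op_translate[OF \<eta>', of P y] by (simp add: h_def)
      show "kernel_mean h riesz_kernel c = 0" if "c \<in> ball c0 d" for c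
      proof -
        have "c \<in> ball c0 (2 * d)" using that d by auto
        then have "transposed_op P (translate c \<eta>) \<in> test_functions V"
          by (intro test_transposed_op near \<eta>)
        then show ?thesis
          using riesz[OF Q, of c] transposed_op_translate[OF \<eta>', of P c] by (simp add: h_def)
      qed
    qed (rule d)
    then have "(\<integral>x. h x * cis (- (x \<bullet> \<xi>)) \<partial>lborel) = 0" by simp
    then have "U \<xi> * (cpoly_eval P \<xi> * test_transform \<eta> \<xi>) = 0"
      using fourier[OF Q] by (simp add: h_def test_transform_transposed_op[OF \<eta>'])
    then show ?thesis using \<eta>(2) by simp
  qed
  define h where "h x = u (translate x \<phi>)" for x
  have ih: "integrable lborel h" unfolding h_def by (rule int[OF \<phi>])
  have "(\<integral>x. h x * cis (- (x \<bullet> \<xi>)) \<partial>lborel) = 0" for \<xi>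
  proof -
    have "\<forall>k. \<exists>\<xi>'. \<xi>' \<in> ball \<xi> (inverse (real (Suc k))) \<and> cpoly_eval P \<xi>' \<noteq> 0"
      using cpoly_nonzero_dense[OF P] by (metis inverse_positive_iff_positive of_nat_0_less_iff zero_less_Suc)
    then obtain X where X: "\<And>k. X k \<in> ball \<xi> (inverse (real (Suc k)))" "\<And>k. cpoly_eval P (X k) \<noteq> 0" by metis
    have "X \<longlonglongrightarrow> \<xi>"
    proof (rule metric_LIMSEQ_I)
      fix e :: real assume "e > 0"
      then obtain N where N: "inverse (real (Suc N)) < e" using reals_Archimedean by blast
      have "dist (X k) \<xi> < e" if "k \<ge> N" for k
      proof -
        have "inverse (real (Suc k)) \<le> inverse (real (Suc N))" using that by (intro le_imp_inverse_le) auto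
        moreover have "dist (X k) \<xi> < inverse (real (Suc k))" using X(1)[of k] by (simp add: dist_commute)
        ultimately show ?thesis using N by linarith
      qed
      then show "\<exists>N. \<forall>k\<ge>N. dist (X k) \<xi> < e" by blast
    qed
    have "(\<lambda>k. \<integral>x. h x * cis (- (x \<bullet> X k)) \<partial>lborel) \<longlonglongrightarrow> (\<integral>x. h x * cis (- (x \<bullet> \<xi>)) \<partial>lborel)"
    proof (rule integral_dominated_convergence)
      have c: "(\<lambda>x. cis (- (x \<bullet> \<zeta>))) \<in> borel_measurable lborel" for \<zeta> :: "real ^ 'n"
        using borel_measurable_continuous_onI[of "\<lambda>x. cis (- (x \<bullet> \<zeta>))"] by (simp add: continuous_intros)
      show "(\<lambda>x. h x * cis (- (x \<bullet> \<xi>))) \<in> borel_measurable lborel"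
        "(\<lambda>x. h x * cis (- (x \<bullet> X k))) \<in> borel_measurable lborel" for k
        using ih c by (auto intro!: borel_measurable_times)
      show "integrable lborel (\<lambda>x. norm (h x))" using ih by simp
      show "AE x in lborel. (\<lambda>k. h x * cis (- (x \<bullet> X k))) \<longlonglongrightarrow> h x * cis (- (x \<bullet> \<xi>))"
      proof (intro AE_I2 tendsto_mult tendsto_const)
        fix x :: "real ^ 'n"
        have "isCont (\<lambda>\<zeta>. cis (- (x \<bullet> \<zeta>))) \<xi>"
          by (rule continuous_on_interior[of UNIV]) (auto intro!: continuous_intros)
        then show "(\<lambda>k. cis (- (x \<bullet> X k))) \<longlonglongrightarrow> cis (- (x \<bullet> \<xi>))"
          using \<open>X \<longlonglongrightarrow> \<xi>\<close> by (rule isCont_tendsto_compose)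
      qed
    qed (auto simp: norm_mult)
    moreover have "(\<integral>x. h x * cis (- (x \<bullet> X k)) \<partial>lborel) = 0" for k
      using fourier[OF \<phi>, of "X k"] UP[of "X k"] X(2)[of k] by (simp add: h_def)
    ultimately show ?thesis by (simp add: LIMSEQ_const_iff)
  qed
  then have "h 0 = 0"
    by (rule zero_if_Fourier_transform_zero[rotated 2]) (unfold h_def, rule cont[OF \<phi>], rule int[OF \<phi>])
  then show ?thesis by (simp add: h_def)
qed

section \<open>Integration along rays\<close>

lemma nn_integral_lborel_affine:
  fixes f :: "'a::euclidean_space \<Rightarrow> ennreal"
  assumes [measurable]: "f \<in> borel_measurable borel" and c: "c \<noteq> 0"
  shows "(\<integral>\<^sup>+x. f x \<partial>lborel) = (\<integral>\<^sup>+x. ennreal (\<bar>c\<bar> ^ DIM('a)) * f (t + c *\<^sub>R x) \<partial>lborel)"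
proof -
  have [measurable]: "(\<lambda>x::'a. t + c *\<^sub>R x) \<in> borel_measurable lborel" by measurable
  show ?thesis
    by (subst lborel_affine[OF c, of t]) (simp add: nn_integral_density nn_integral_distr)
qed

lemma nn_integral_tail_power:
  assumes a: "0 < a" and n: "0 < n"
  shows "(\<integral>\<^sup>+s. ennreal (inverse \<bar>s\<bar> ^ (n + 1) * indicator {a<..} \<bar>s\<bar>) \<partial>lborel) = ennreal (2 * inverse a ^ n / real n)"
proof -
  define g where "g s = ennreal (inverse s ^ (n + 1)) * indicator {a..} s" for s :: real
  have [measurable]: "g \<in> borel_measurable borel" unfolding g_def by measurable
  have "(\<integral>\<^sup>+s. g s \<partial>lborel) = ennreal (0 - (- (inverse a ^ n) / real n))"
    unfolding g_def
  proof (rule nn_integral_FTC_atLeast)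
    show "DERIV (\<lambda>s. - (inverse s ^ n) / real n) x :> inverse x ^ (n + 1)" if "a \<le> x" for x
    proof -
      have "x > 0" using a that by simp
      obtain p where p: "n = Suc p" using n by (cases n) auto
      have "((\<lambda>s. - (inverse s ^ n) / real n) has_real_derivative
          - (real n * (- (inverse x ^ Suc (Suc 0)) * inverse x ^ (n - Suc 0))) / real n) (at x)"
        using \<open>x > 0\<close> by (intro DERIV_cdivide DERIV_minus DERIV_power DERIV_inverse) auto
      then show ?thesis by (rule DERIV_cong) (use n in \<open>simp add: p del: of_nat_Suc\<close>)
    qed
    have "((\<lambda>s. - (inverse s ^ n) / real n) \<longlongrightarrow> - (0 ^ n) / real n) at_top"
      by (intro tendsto_intros tendsto_inverse_0_at_top filterlim_ident) (use n in auto)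
    then show "((\<lambda>s. - (inverse s ^ n) / real n) \<longlongrightarrow> 0) at_top" using n by (simp add: zero_power)
  qed (use a in auto)
  then have gi: "(\<integral>\<^sup>+s. g s \<partial>lborel) = ennreal (inverse a ^ n / real n)" by simp
  have gm: "(\<integral>\<^sup>+s. g (- s) \<partial>lborel) = (\<integral>\<^sup>+s. g s \<partial>lborel)"
    using nn_integral_lborel_affine[of g "-1" 0] by simp
  have "(\<integral>\<^sup>+s. ennreal (inverse \<bar>s\<bar> ^ (n + 1) * indicator {a<..} \<bar>s\<bar>) \<partial>lborel) = (\<integral>\<^sup>+s. g s + g (- s) \<partial>lborel)"
  proof (rule nn_integral_cong_AE)
    have "AE s in lborel. s \<noteq> a \<and> s \<noteq> - a"
      using AE_lborel_singleton[of a] AE_lborel_singleton[of "- a"] by eventually_elim auto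
    then show "AE s in lborel. ennreal (inverse \<bar>s\<bar> ^ (n + 1) * indicator {a<..} \<bar>s\<bar>) = g s + g (- s)"
    proof eventually_elim
      case (elim s)
      then show ?case using a by (cases "s > 0") (auto simp: g_def indicator_def)
    qed
  qed
  also have "\<dots> = (\<integral>\<^sup>+s. g s \<partial>lborel) + (\<integral>\<^sup>+s. g (- s) \<partial>lborel)"
    by (rule nn_integral_add) auto
  also have "\<dots> = ennreal (2 * inverse a ^ n / real n)"
    unfolding gm gi using a by (simp add: ennreal_plus[symmetric] del: ennreal_plus)
  finally show ?thesis .
qed

lemma borel_measurable_lborel_pair:
  "borel_measurable (lborel \<Otimes>\<^sub>M lborel) = borel_measurable (borel \<Otimes>\<^sub>M borel)"
  by (intro measurable_cong_sets sets_pair_measure_cong) auto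

text \<open>
  The weight that appears when an integral over the sphere of line integrals in unit directions is rewritten,
  by the cone formula for the surface measure and rescaling of the line, as an integral over the unit ball.
\<close>
definition cone_weight :: "'a::euclidean_space \<Rightarrow> real" where
  "cone_weight y = (if norm y < 1 then norm y else 0)"

lemma cone_weight_measurable [measurable]: "cone_weight \<in> borel_measurable borel"
  unfolding cone_weight_def by measurable

lemma cone_weight_nonneg: "cone_weight y \<ge> 0"
  by (simp add: cone_weight_def)

text \<open>
  For fixed \<open>s\<close> substitute \<open>w = s *\<^sub>R y\<close> and exchange the integrals. What remains for fixed \<open>w\<close> is the integral of
  \<open>inverse \<bar>s\<bar> ^ (n + 1)\<close> over \<open>\<bar>s\<bar> > norm w\<close>, times \<open>norm w\<close>.
\<close>
lemma nn_integral_rays: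
  fixes \<phi> :: "'a::euclidean_space \<Rightarrow> ennreal"
  assumes dim: "2 \<le> DIM('a)" and [measurable]: "\<phi> \<in> borel_measurable borel"
  shows "(\<integral>\<^sup>+y. \<integral>\<^sup>+s. ennreal (cone_weight y) * \<phi> (s *\<^sub>R y) \<partial>lborel \<partial>lborel)
    = (\<integral>\<^sup>+w. ennreal (2 / real DIM('a) * riesz_kernel w) * \<phi> w \<partial>lborel)"
proof -
  let ?n = "DIM('a)"
  define K where "K s w = ennreal (\<bar>1 / s\<bar> ^ ?n * cone_weight ((1 / s) *\<^sub>R w)) * \<phi> w" for s w
  have [measurable]: "(\<lambda>(s, w). K s w) \<in> borel_measurable (lborel \<Otimes>\<^sub>M lborel)"
    unfolding K_def borel_measurable_lborel_pair by measurable
  have "(\<integral>\<^sup>+y. \<integral>\<^sup>+s. ennreal (cone_weight y) * \<phi> (s *\<^sub>R y) \<partial>lborel \<partial>lborel)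
    = (\<integral>\<^sup>+s. \<integral>\<^sup>+y. ennreal (cone_weight y) * \<phi> (s *\<^sub>R y) \<partial>lborel \<partial>lborel)"
    by (rule lborel_pair.Fubini') measurable
  also have "\<dots> = (\<integral>\<^sup>+s. \<integral>\<^sup>+w. K s w \<partial>lborel \<partial>lborel)"
  proof (rule nn_integral_cong_AE)
    have "AE s in lborel. s \<noteq> (0::real)" by (rule AE_lborel_singleton)
    then show "AE s in lborel. (\<integral>\<^sup>+y. ennreal (cone_weight y) * \<phi> (s *\<^sub>R y) \<partial>lborel) = (\<integral>\<^sup>+w. K s w \<partial>lborel)"
    proof eventually_elim
      case (elim s)
      have "(\<integral>\<^sup>+y. ennreal (cone_weight y) * \<phi> (s *\<^sub>R y) \<partial>lborel) =
        (\<integral>\<^sup>+w. ennreal (\<bar>1/s\<bar> ^ ?n) * (ennreal (cone_weight (0 + (1/s) *\<^sub>R w)) * \<phi> (s *\<^sub>R (0 + (1/s) *\<^sub>R w))) \<partial>lborel)"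
        by (rule nn_integral_lborel_affine[where f="\<lambda>y. ennreal (cone_weight y) * \<phi> (s *\<^sub>R y)"])
           (use elim in auto)
      also have "\<dots> = (\<integral>\<^sup>+w. K s w \<partial>lborel)"
        using elim by (intro nn_integral_cong) (simp add: K_def ennreal_mult' mult.assoc)
      finally show ?case .
    qed
  qed
  also have "\<dots> = (\<integral>\<^sup>+w. \<integral>\<^sup>+s. K s w \<partial>lborel \<partial>lborel)"
    by (rule lborel_pair.Fubini'[symmetric]) measurable
  also have "\<dots> = (\<integral>\<^sup>+w. ennreal (2 / real ?n * riesz_kernel w) * \<phi> w \<partial>lborel)"
  proof (rule nn_integral_cong)
    fix w :: 'a
    show "(\<integral>\<^sup>+s. K s w \<partial>lborel) = ennreal (2 / real ?n * riesz_kernel w) * \<phi> w"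
    proof (cases "w = 0")
      case True
      then show ?thesis using dim by (simp add: K_def cone_weight_def riesz_kernel_def power_0_left)
    next
      case False
      define a where "a = norm w"
      have a: "a > 0" using False by (simp add: a_def)
      have "(\<integral>\<^sup>+s. K s w \<partial>lborel) = (\<integral>\<^sup>+s. (ennreal a * \<phi> w) * ennreal (inverse \<bar>s\<bar> ^ (?n + 1) * indicator {a<..} \<bar>s\<bar>) \<partial>lborel)"
      proof (rule nn_integral_cong_AE)
        have "AE s in lborel. s \<noteq> (0::real)" by (rule AE_lborel_singleton)
        then show "AE s in lborel. K s w = (ennreal a * \<phi> w) * ennreal (inverse \<bar>s\<bar> ^ (?n + 1) * indicator {a<..} \<bar>s\<bar>)"
        proof eventually_elim
          case (elim s)
          have "cone_weight ((1 / s) *\<^sub>R w) = a * inverse \<bar>s\<bar> * indicator {a<..} \<bar>s\<bar>"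
            using elim by (auto simp: cone_weight_def indicator_def a_def divide_simps)
          then have "\<bar>1 / s\<bar> ^ ?n * cone_weight ((1 / s) *\<^sub>R w)
             = a * (inverse \<bar>s\<bar> ^ (?n + 1) * indicator {a<..} \<bar>s\<bar>)"
            using elim by (simp add: divide_inverse mult_ac)
          then show ?case using a unfolding K_def by (simp add: ennreal_mult mult_ac)
        qed
      qed
      also have "\<dots> = (ennreal a * \<phi> w) * ennreal (2 * inverse a ^ ?n / real ?n)"
        using nn_integral_tail_power[OF a, of ?n] by (subst nn_integral_cmult) auto
      also have "\<dots> = ennreal (a * (2 * inverse a ^ ?n / real ?n)) * \<phi> w"
      proof -
        have "ennreal (a * (2 * inverse a ^ ?n / real ?n)) = ennreal a * ennreal (2 * inverse a ^ ?n / real ?n)"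
          by (rule ennreal_mult) (use a in auto)
        then show ?thesis by (simp only: mult_ac)
      qed
      also have "a * (2 * inverse a ^ ?n / real ?n) = 2 / real ?n * inverse a ^ (?n - 1)"
      proof -
        obtain p where p: "?n = Suc p" using dim by (cases ?n) auto
        show ?thesis using a by (simp add: p)
      qed
      finally show ?thesis by (simp add: a_def riesz_kernel_def)
    qed
  qed
  finally show ?thesis .
qed

text \<open>
  The ball of radius \<open>R\<close> meets the line spanned by \<open>y\<close> in a segment of parameter length \<open>2 * R / norm y\<close>, and the
  factor \<open>1 / norm y\<close> is cancelled by the weight.
\<close>
lemma riesz_kernel_locally_integrable:
  assumes dim: "2 \<le> DIM('a::euclidean_space)"
  shows "locally_integrable (\<lambda>w::'a. complex_of_real (riesz_kernel w))"
  unfolding locally_integrable_def set_integrable_def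
proof (intro conjI allI)
  fix R :: real
  let ?n = "DIM('a)"
  define c where "c = 2 / real ?n"
  have c: "c > 0" using dim by (simp add: c_def)
  have [measurable]: "cball (0::'a) R \<in> sets borel" by simp
  have "(\<integral>\<^sup>+w. ennreal (c * riesz_kernel w) * indicator (cball 0 R) w \<partial>(lborel :: 'a measure))
     = (\<integral>\<^sup>+y. \<integral>\<^sup>+s. ennreal (cone_weight y) * indicator (cball 0 R) (s *\<^sub>R y) \<partial>lborel \<partial>(lborel :: 'a measure))"
    unfolding c_def by (rule nn_integral_rays[OF dim, symmetric]) measurable
  also have "\<dots> \<le> (\<integral>\<^sup>+y. ennreal (2 * \<bar>R\<bar>) * indicator (ball 0 1) y \<partial>(lborel :: 'a measure))"
  proof (rule nn_integral_mono)
    fix y :: 'a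
    show "(\<integral>\<^sup>+s. ennreal (cone_weight y) * indicator (cball 0 R) (s *\<^sub>R y) \<partial>lborel) \<le> ennreal (2 * \<bar>R\<bar>) * indicator (ball 0 1) y"
    proof (cases "y = 0 \<or> y \<notin> ball 0 1")
      case True
      then show ?thesis by (auto simp: cone_weight_def)
    next
      case False
      then have y: "norm y > 0" and cw: "cone_weight y = norm y" by (simp_all add: cone_weight_def)
      have "(\<integral>\<^sup>+s. ennreal (cone_weight y) * indicator (cball 0 R) (s *\<^sub>R y) \<partial>lborel)
        \<le> (\<integral>\<^sup>+s. ennreal (norm y) * indicator {- (\<bar>R\<bar> / norm y)..\<bar>R\<bar> / norm y} s \<partial>lborel)"
      proof (rule nn_integral_mono)
        fix s :: real
        show "ennreal (cone_weight y) * indicator (cball 0 R) (s *\<^sub>R y) \<le> ennreal (norm y) * indicator {- (\<bar>R\<bar> / norm y)..\<bar>R\<bar> / norm y} s"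
        proof (cases "s *\<^sub>R y \<in> cball 0 R")
          case True
          then have "\<bar>s\<bar> * norm y \<le> \<bar>R\<bar>" by simp
          then have "\<bar>s\<bar> \<le> \<bar>R\<bar> / norm y" using y by (simp add: pos_le_divide_eq)
          then have "s \<in> {- (\<bar>R\<bar> / norm y)..\<bar>R\<bar> / norm y}" by auto
          then show ?thesis using cw True by simp
        qed simp
      qed
      also have "\<dots> = ennreal (norm y) * ennreal (2 * (\<bar>R\<bar> / norm y))"
        using y by (subst nn_integral_cmult_indicator) auto
      also have "\<dots> = ennreal (2 * \<bar>R\<bar>) * indicator (ball 0 1) y"
        using y False by (simp add: ennreal_mult[symmetric])
      finally show ?thesis .
    qed
  qed
  also have "\<dots> = ennreal (2 * \<bar>R\<bar>) * emeasure lborel (ball (0::'a) 1)"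
    by (rule nn_integral_cmult_indicator) simp
  also have "\<dots> < \<infinity>"
    using emeasure_lborel_ball_finite[of "0::'a" 1] by (simp add: ennreal_mult_less_top)
  finally have fin: "(\<integral>\<^sup>+w. ennreal (c * riesz_kernel w) * indicator (cball 0 R) w \<partial>(lborel :: 'a measure)) < \<infinity>" .
  have "integrable lborel (\<lambda>w::'a. indicator (cball 0 R) w *\<^sub>R complex_of_real (c * riesz_kernel w))"
  proof (rule integrableI_bounded)
    have "ennreal (norm (indicator (cball 0 R) w *\<^sub>R complex_of_real (c * riesz_kernel w))) = ennreal (c * riesz_kernel w) * indicator (cball 0 R) w" for w :: 'a
      using c riesz_kernel_nonneg[of w] by (simp add: indicator_def abs_mult norm_mult)
    then show "(\<integral>\<^sup>+w. ennreal (norm (indicator (cball 0 R) w *\<^sub>R complex_of_real (c * riesz_kernel w))) \<partial>(lborel :: 'a measure)) < \<infinity>"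
      using fin by simp
  qed measurable
  then have "integrable lborel (\<lambda>w::'a. of_real (1 / c) * (indicator (cball 0 R) w *\<^sub>R complex_of_real (c * riesz_kernel w)))"
    by (rule integrable_mult_right)
  then show "integrable lborel (\<lambda>w::'a. indicator (cball 0 R) w *\<^sub>R complex_of_real (riesz_kernel w))"
    using c by (simp add: scaleR_conv_of_real mult_ac)
qed measurable

text \<open>
  For indicator functions the formula for nonnegative integrands identifies the image of the measure with density
  \<open>wt\<close> under \<open>(y, s) \<mapsto> s *\<^sub>R y\<close>; complex integrands are then handled by the change of variables theorem.
\<close>
lemma integral_rays:
  fixes \<psi> :: "'a::euclidean_space \<Rightarrow> complex"
  assumes dim: "2 \<le> DIM('a)" and [measurable]: "\<psi> \<in> borel_measurable borel"
    and int: "integrable lborel (\<lambda>w. \<psi> w * of_real (riesz_kernel w))"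
  shows "(\<integral>y. (\<integral>s. cone_weight y *\<^sub>R \<psi> (s *\<^sub>R y) \<partial>lborel) \<partial>lborel)
    = of_real (2 / real DIM('a)) * (\<integral>w. \<psi> w * of_real (riesz_kernel w) \<partial>lborel)"
proof -
  define c where "c = 2 / real DIM('a)"
  define wt where "wt p = cone_weight (fst p)" for p :: "'a \<times> real"
  define \<nu> where "\<nu> = density (lborel \<Otimes>\<^sub>M lborel) (\<lambda>p. ennreal (wt p))"
  define \<tau> where "\<tau> p = snd p *\<^sub>R fst p" for p :: "'a \<times> real"
  have c: "c > 0" using dim by (simp add: c_def)
  have [measurable]: "wt \<in> borel_measurable (lborel \<Otimes>\<^sub>M lborel)"
    unfolding wt_def borel_measurable_lborel_pair by measurable
  have [measurable]: "\<tau> \<in> borel_measurable (lborel \<Otimes>\<^sub>M lborel)"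
    unfolding \<tau>_def borel_measurable_lborel_pair by measurable
  have [measurable]: "\<tau> \<in> borel_measurable \<nu>" unfolding \<nu>_def by measurable
  have wt0: "wt p \<ge> 0" for p by (simp add: wt_def cone_weight_nonneg)
  have M: "distr \<nu> borel \<tau> = density lborel (\<lambda>w. ennreal (c * riesz_kernel w))"
  proof (rule measure_eqI)
    fix A assume "A \<in> sets (distr \<nu> borel \<tau>)"
    then have [measurable]: "A \<in> sets borel" by simp
    have "emeasure (distr \<nu> borel \<tau>) A = (\<integral>\<^sup>+x. indicator A x \<partial>distr \<nu> borel \<tau>)" by simp
    also have "\<dots> = (\<integral>\<^sup>+p. indicator A (\<tau> p) \<partial>\<nu>)" by (rule nn_integral_distr) auto
    also have "\<dots> = (\<integral>\<^sup>+p. ennreal (wt p) * indicator A (\<tau> p) \<partial>(lborel \<Otimes>\<^sub>M lborel))"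
      unfolding \<nu>_def by (rule nn_integral_density) measurable
    also have "\<dots> = (\<integral>\<^sup>+y. \<integral>\<^sup>+s. ennreal (wt (y, s)) * indicator A (\<tau> (y, s)) \<partial>lborel \<partial>lborel)"
      by (rule lborel.nn_integral_fst[symmetric]) measurable
    also have "\<dots> = (\<integral>\<^sup>+w. ennreal (c * riesz_kernel w) * indicator A w \<partial>lborel)"
      using nn_integral_rays[OF dim, of "indicator A"] by (simp add: wt_def \<tau>_def c_def)
    also have "\<dots> = emeasure (density lborel (\<lambda>w. ennreal (c * riesz_kernel w))) A"
      by (rule emeasure_density[symmetric]) auto
    finally show "emeasure (distr \<nu> borel \<tau>) A = emeasure (density lborel (\<lambda>w. ennreal (c * riesz_kernel w))) A" .
  qed simp
  have int': "integrable lborel (\<lambda>w. (c * riesz_kernel w) *\<^sub>R \<psi> w)"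
    using integrable_mult_right[OF int, of "of_real c"] by (simp add: scaleR_conv_of_real mult_ac)
  have "integrable (density lborel (\<lambda>w. ennreal (c * riesz_kernel w))) \<psi>"
    using int' c by (subst integrable_density) (auto simp: riesz_kernel_nonneg)
  then have "integrable \<nu> (\<lambda>p. \<psi> (\<tau> p))"
    unfolding M[symmetric] by (subst (asm) integrable_distr_eq) auto
  then have I: "integrable (lborel \<Otimes>\<^sub>M lborel) (\<lambda>p. wt p *\<^sub>R \<psi> (\<tau> p))"
    unfolding \<nu>_def by (subst (asm) integrable_density) (auto simp: wt0)
  have "(\<integral>y. (\<integral>s. wt (y, s) *\<^sub>R \<psi> (\<tau> (y, s)) \<partial>lborel) \<partial>lborel) = (\<integral>p. wt p *\<^sub>R \<psi> (\<tau> p) \<partial>(lborel \<Otimes>\<^sub>M lborel))"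
    by (rule lborel_pair.integral_fst'[OF I])
  also have "\<dots> = (\<integral>p. \<psi> (\<tau> p) \<partial>\<nu>)"
    unfolding \<nu>_def by (rule integral_density[symmetric]) (auto simp: wt0)
  also have "\<dots> = (\<integral>w. \<psi> w \<partial>distr \<nu> borel \<tau>)"
    by (rule integral_distr[symmetric]) auto
  also have "\<dots> = (\<integral>w. (c * riesz_kernel w) *\<^sub>R \<psi> w \<partial>lborel)"
    unfolding M by (rule integral_density) (use c in \<open>auto simp: riesz_kernel_nonneg\<close>)
  also have "\<dots> = (\<integral>w. of_real c * (\<psi> w * of_real (riesz_kernel w)) \<partial>lborel)"
    by (simp add: scaleR_conv_of_real mult_ac)
  also have "\<dots> = of_real c * (\<integral>w. \<psi> w * of_real (riesz_kernel w) \<partial>lborel)" by simp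
  finally show ?thesis by (simp add: wt_def \<tau>_def c_def)
qed

section \<open>The X-ray transform of a test function\<close>

lemma integral_sphere_measure:
  fixes F :: "'a::euclidean_space \<Rightarrow> complex"
  assumes F: "F \<in> borel_measurable borel"
  shows "(\<integral>\<theta>. F \<theta> \<partial>sphere_measure) = of_real (real DIM('a)) * (\<integral>y. indicator (ball 0 1 - {0}) y *\<^sub>R F (sgn y) \<partial>lborel)"
proof -
  define M0 where "M0 = restrict_space lborel (ball 0 1 - {0::'a})"
  define N where "N = restrict_space borel (sphere 0 (1::real) :: 'a set)"
  have sgn: "sgn \<in> measurable M0 N"
    unfolding M0_def N_def
    by (intro measurable_restrict_space2 measurable_restrict_space1) (auto simp: space_restrict_space norm_sgn)
  have FN: "F \<in> borel_measurable N" unfolding N_def using F by (rule measurable_restrict_space1)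
  have "(sphere_measure :: 'a measure) = density (distr M0 N sgn) (\<lambda>_. ennreal (real DIM('a)))"
  proof (rule measure_eqI)
    show "emeasure sphere_measure A = emeasure (density (distr M0 N sgn) (\<lambda>_. ennreal (real DIM('a)))) A"
      if "A \<in> sets (sphere_measure :: 'a measure)" for A
      using that unfolding sphere_measure_def M0_def[symmetric] N_def[symmetric]
      by (simp add: emeasure_density nn_integral_cmult_indicator ennreal_of_nat_eq_real_of_nat)
  qed (simp add: sphere_measure_def M0_def N_def)
  then have "(\<integral>\<theta>. F \<theta> \<partial>sphere_measure) = (\<integral>\<theta>. F \<theta> \<partial>density (distr M0 N sgn) (\<lambda>_. ennreal (real DIM('a))))"
    by (simp only:)
  also have "\<dots> = (\<integral>\<theta>. real DIM('a) *\<^sub>R F \<theta> \<partial>distr M0 N sgn)"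
    by (rule integral_density) (use FN in auto)
  also have "\<dots> = (\<integral>y. real DIM('a) *\<^sub>R F (sgn y) \<partial>M0)"
    by (rule integral_distr[OF sgn]) (use FN in auto)
  also have "\<dots> = (\<integral>y. indicator (ball 0 1 - {0}) y *\<^sub>R (real DIM('a) *\<^sub>R F (sgn y)) \<partial>lborel)"
    unfolding M0_def by (rule integral_restrict_space) auto
  also have "\<dots> = (\<integral>y. of_real (real DIM('a)) * (indicator (ball 0 1 - {0}) y *\<^sub>R F (sgn y)) \<partial>lborel)"
    by (simp add: scaleR_conv_of_real mult_ac)
  finally show ?thesis by (simp only: integral_mult_right_zero)
qed

lemma xray_orthogonal_projection:
  "xray \<phi> (x - (x \<bullet> \<theta>) *\<^sub>R \<theta>, \<theta>) = (\<integral>s. \<phi> (x + s *\<^sub>R \<theta>) \<partial>lborel)"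
  using lborel_integral_real_affine[of 1 "\<lambda>s. \<phi> (x + s *\<^sub>R \<theta>)" "- (x \<bullet> \<theta>)"]
  by (simp add: xray_def algebra_simps)

lemma integral_line_sgn:
  assumes "y \<noteq> 0"
  shows "(\<integral>s. \<phi> (x + s *\<^sub>R sgn y) \<partial>lborel) = of_real (norm y) * (\<integral>s. (\<phi> (x + s *\<^sub>R y) :: complex) \<partial>lborel)"
proof -
  have "(norm y * s) *\<^sub>R sgn y = s *\<^sub>R y" for s
    using assms by (simp add: sgn_div_norm)
  then show ?thesis
    using lborel_integral_real_affine[of "norm y" "\<lambda>s. \<phi> (x + s *\<^sub>R sgn y)" 0] assms
    by (simp add: scaleR_conv_of_real)
qed

text \<open>
  The normal operator of the X-ray transform is twice the convolution with the Riesz kernel, each line through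
  \<open>x\<close> being counted in both orientations.
\<close>
lemma xray_adjoint_xray:
  fixes \<phi> :: "'a::euclidean_space \<Rightarrow> complex"
  assumes dim: "2 \<le> DIM('a)" and [measurable]: "\<phi> \<in> borel_measurable borel"
    and int: "integrable lborel (\<lambda>w. \<phi> (x + w) * of_real (riesz_kernel w))"
  shows "xray_adjoint (xray \<phi>) x = 2 * (\<integral>w. \<phi> (x + w) * of_real (riesz_kernel w) \<partial>lborel)"
proof -
  let ?F = "\<lambda>\<theta>. \<integral>s. \<phi> (x + s *\<^sub>R \<theta>) \<partial>lborel"
  have [measurable]: "?F \<in> borel_measurable borel" by measurable
  have "xray_adjoint (xray \<phi>) x = (\<integral>\<theta>. ?F \<theta> \<partial>sphere_measure)"
    by (simp add: xray_adjoint_def xray_orthogonal_projection)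
  also have "\<dots> = of_real (real DIM('a)) * (\<integral>y. indicator (ball 0 1 - {0}) y *\<^sub>R ?F (sgn y) \<partial>lborel)"
    by (rule integral_sphere_measure) measurable
  also have "(\<integral>y. indicator (ball 0 1 - {0}) y *\<^sub>R ?F (sgn y) \<partial>lborel) = (\<integral>y. (\<integral>s. cone_weight y *\<^sub>R \<phi> (x + s *\<^sub>R y) \<partial>lborel) \<partial>lborel)"
  proof (rule Bochner_Integration.integral_cong)
    fix y :: 'a
    show "indicator (ball 0 1 - {0}) y *\<^sub>R ?F (sgn y) = (\<integral>s. cone_weight y *\<^sub>R \<phi> (x + s *\<^sub>R y) \<partial>lborel)"
      using integral_line_sgn[of y \<phi> x] by (cases "y = 0") (auto simp: cone_weight_def indicator_def scaleR_conv_of_real)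
  qed simp
  also have "\<dots> = of_real (2 / real DIM('a)) * (\<integral>w. \<phi> (x + w) * of_real (riesz_kernel w) \<partial>lborel)"
    by (rule integral_rays[OF dim _ int]) measurable
  finally show ?thesis using dim by simp
qed

lemma conv_riesz_kernel:
  fixes \<phi> :: "'a::euclidean_space \<Rightarrow> complex"
  assumes "\<phi> \<in> test_functions V"
  shows "conv \<phi> (\<lambda>w. of_real (riesz_kernel w)) x = (\<integral>w. \<phi> (x + w) * of_real (riesz_kernel w) \<partial>lborel)"
    and "2 \<le> DIM('a) \<Longrightarrow> integrable lborel (\<lambda>w. \<phi> (x + w) * of_real (riesz_kernel w))"
proof -
  have [measurable]: "\<phi> \<in> borel_measurable borel" using test_borel_measurable[OF assms] .
  have e: "(\<lambda>w. \<phi> (x - w) * of_real (riesz_kernel w)) = (\<lambda>w. (\<lambda>w. \<phi> (x + w) * of_real (riesz_kernel w)) (0 - w))"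
    by (simp add: riesz_kernel_def)
  show "conv \<phi> (\<lambda>w. of_real (riesz_kernel w)) x = (\<integral>w. \<phi> (x + w) * of_real (riesz_kernel w) \<partial>lborel)"
    unfolding conv_def e by (rule lborel_reflect_translate) measurable
  show "integrable lborel (\<lambda>w. \<phi> (x + w) * of_real (riesz_kernel w))" if "2 \<le> DIM('a)"
    using conv_integrable[OF assms riesz_kernel_locally_integrable[OF that], of x]
    unfolding e by (subst (asm) lborel_reflect_translate(2)) auto
qed

lemma xray_adjoint_xray_test:
  assumes "2 \<le> DIM('a::euclidean_space)" "\<phi> \<in> test_functions (V :: 'a set)"
  shows "xray_adjoint (xray \<phi>) = (\<lambda>x. 2 * conv \<phi> (\<lambda>w. of_real (riesz_kernel w)) x)"
proof
  fix x
  show "xray_adjoint (xray \<phi>) x = 2 * conv \<phi> (\<lambda>w. of_real (riesz_kernel w)) x"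
    unfolding conv_riesz_kernel(1)[OF assms(2)]
    by (rule xray_adjoint_xray[OF assms(1) test_borel_measurable[OF assms(2)] conv_riesz_kernel(2)[OF assms(2,1)]])
qed

text \<open>
  Near a given line only a bounded parameter range contributes to the X-ray transform of a test function. The
  powers of \<open>s\<close> make the family closed under derivatives in the direction variable.
\<close>
definition truncated_xray :: "real \<Rightarrow> nat \<Rightarrow> ('a::euclidean_space \<Rightarrow> complex) \<Rightarrow> 'a \<times> 'a \<Rightarrow> complex" where
  "truncated_xray S k \<phi> p = (\<integral>s. (indicator {-S..S} s * s ^ k) *\<^sub>R \<phi> (fst p + s *\<^sub>R snd p) \<partial>lborel)"

lemma truncated_xray_has_derivative:
  fixes \<phi> :: "'a::euclidean_space \<Rightarrow> complex"
  assumes \<phi>: "\<phi> \<in> test_functions V"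
  shows "(truncated_xray S k \<phi> has_derivative (\<lambda>v. \<integral>s. (indicator {-S..S} s * s ^ k) *\<^sub>R dir_deriv (fst v + s *\<^sub>R snd v) \<phi> (fst p + s *\<^sub>R snd p) \<partial>lborel)) (at p)"
proof -
  obtain L where L: "0 \<le> L" "\<And>x y. norm (\<phi> x - \<phi> y) \<le> L * norm (x - y)"
    by (rule test_bounds[OF \<phi>]) blast
  have sm: "\<phi> \<in> smooth_functions" using test_functionsD[OF \<phi>] by simp
  have "((\<lambda>p. \<integral>s. (indicator {-S..S} s * s ^ k) *\<^sub>R \<phi> (fst p + s *\<^sub>R snd p) \<partial>lborel) has_derivative
     (\<lambda>v. \<integral>s. (indicator {-S..S} s * s ^ k) *\<^sub>R dir_deriv (fst v + s *\<^sub>R snd v) \<phi> (fst p + s *\<^sub>R snd p) \<partial>lborel)) (at p)"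
  proof (rule has_derivative_integral(1)[where r=1 and w="\<lambda>s. indicator {-S..S} s *\<^sub>R (\<bar>s\<bar> ^ k * (L * (1 + \<bar>s\<bar>)))"])
    show "integrable lborel (\<lambda>s. (indicator {-S..S} s * s ^ k) *\<^sub>R \<phi> (fst q + s *\<^sub>R snd q))" for q
    proof -
      have "integrable lborel (\<lambda>s. indicator {-S..S} s *\<^sub>R ((s ^ k) *\<^sub>R \<phi> (fst q + s *\<^sub>R snd q)))"
        by (rule borel_integrable_compact)
           (auto intro!: continuous_intros continuous_on_compose2[OF smooth_continuous[OF sm, of UNIV]])
      then show ?thesis by simp
    qed
    show "integrable lborel (\<lambda>s. indicator {-S..S} s *\<^sub>R (\<bar>s\<bar> ^ k * (L * (1 + \<bar>s\<bar>))))"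
      by (rule borel_integrable_compact) (auto intro!: continuous_intros)
    show "((\<lambda>p. (indicator {-S..S} s * s ^ k) *\<^sub>R \<phi> (fst p + s *\<^sub>R snd p)) has_derivative
       (\<lambda>v. (indicator {-S..S} s * s ^ k) *\<^sub>R dir_deriv (fst v + s *\<^sub>R snd v) \<phi> (fst p + s *\<^sub>R snd p))) (at p)" for s
    proof (rule has_derivative_scaleR_right)
      have "((\<lambda>p. fst p + s *\<^sub>R snd p) has_derivative (\<lambda>v. fst v + s *\<^sub>R snd v)) (at p)"
        by (auto intro!: derivative_eq_intros)
      from has_derivative_compose[OF this smooth_has_derivative[OF sm]]
      show "((\<lambda>p. \<phi> (fst p + s *\<^sub>R snd p)) has_derivative (\<lambda>v. dir_deriv (fst v + s *\<^sub>R snd v) \<phi> (fst p + s *\<^sub>R snd p))) (at p)" .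
    qed
    show "norm ((indicator {-S..S} s * s ^ k) *\<^sub>R \<phi> (fst q + s *\<^sub>R snd q) - (indicator {-S..S} s * s ^ k) *\<^sub>R \<phi> (fst p + s *\<^sub>R snd p))
       \<le> indicator {-S..S} s *\<^sub>R (\<bar>s\<bar> ^ k * (L * (1 + \<bar>s\<bar>))) * norm (q - p)" for s q
    proof -
      have "norm (\<phi> (fst q + s *\<^sub>R snd q) - \<phi> (fst p + s *\<^sub>R snd p)) \<le> L * norm ((fst q + s *\<^sub>R snd q) - (fst p + s *\<^sub>R snd p))"
        by (rule L)
      also have "(fst q + s *\<^sub>R snd q) - (fst p + s *\<^sub>R snd p) = fst (q - p) + s *\<^sub>R snd (q - p)"
        by (simp add: algebra_simps)
      also have "norm (fst (q - p) + s *\<^sub>R snd (q - p)) \<le> norm (q - p) + \<bar>s\<bar> * norm (q - p)"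
      proof (intro norm_triangle_le add_mono)
          show "norm (fst (q - p)) \<le> norm (q - p)" by (metis norm_fst_le prod.collapse)
          have "norm (snd (q - p)) \<le> norm (q - p)" by (metis norm_snd_le prod.collapse)
          then show "norm (s *\<^sub>R snd (q - p)) \<le> \<bar>s\<bar> * norm (q - p)" by (simp add: mult_left_mono)
        qed
      finally have "norm (\<phi> (fst q + s *\<^sub>R snd q) - \<phi> (fst p + s *\<^sub>R snd p)) \<le> L * (norm (q - p) + \<bar>s\<bar> * norm (q - p))"
        using L(1) by (simp add: mult_left_mono)
      then have "(indicator {-S..S} s * \<bar>s\<bar> ^ k) * norm (\<phi> (fst q + s *\<^sub>R snd q) - \<phi> (fst p + s *\<^sub>R snd p))
         \<le> (indicator {-S..S} s * \<bar>s\<bar> ^ k) * (L * (norm (q - p) + \<bar>s\<bar> * norm (q - p)))"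
        by (rule mult_left_mono) simp
      then show ?thesis
        by (simp add: scaleR_diff_right[symmetric] abs_mult power_abs algebra_simps del: scaleR_diff_right)
    qed
  qed simp
  then show ?thesis by (simp add: truncated_xray_def[abs_def])
qed

lemma smooth_truncated_xray:
  fixes \<phi> :: "'a::euclidean_space \<Rightarrow> complex"
  assumes "\<phi> \<in> test_functions V"
  shows "truncated_xray S k \<phi> \<in> smooth_functions"
proof (rule smooth_functions_coinduct[where S="{truncated_xray S k \<phi> |k \<phi>. \<phi> \<in> test_functions V}"])
  fix h :: "'a \<times> 'a \<Rightarrow> complex" assume "h \<in> {truncated_xray S k \<phi> |k \<phi>. \<phi> \<in> test_functions V}"
  then obtain k \<phi> where h: "h = truncated_xray S k \<phi>" and \<phi>: "\<phi> \<in> test_functions V" by auto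
  let ?D = "\<lambda>p v. \<integral>s. (indicator {-S..S} s * s ^ k) *\<^sub>R dir_deriv (fst v + s *\<^sub>R snd v) \<phi> (fst p + s *\<^sub>R snd p) \<partial>lborel"
  show "\<exists>f'. (\<forall>x. (h has_derivative f' x) (at x)) \<and> (\<forall>b\<in>Basis. (\<lambda>x. f' x b) \<in> {truncated_xray S k \<phi> |k \<phi>. \<phi> \<in> test_functions V})"
  proof (intro exI conjI allI ballI)
    show "(h has_derivative ?D p) (at p)" for p
      unfolding h by (rule truncated_xray_has_derivative[OF \<phi>])
    fix c :: "'a \<times> 'a" assume "c \<in> Basis"
    then consider b where "b \<in> Basis" "c = (b, 0)" | b where "b \<in> Basis" "c = (0, b)"
      by (auto simp: Basis_prod_def)
    then show "(\<lambda>p. ?D p c) \<in> {truncated_xray S k \<phi> |k \<phi>. \<phi> \<in> test_functions V}"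
    proof cases
      case 1
      then have "(\<lambda>p. ?D p c) = truncated_xray S k (dir_deriv b \<phi>)" by (simp add: truncated_xray_def[abs_def])
      then show ?thesis using test_dir_deriv[OF \<phi> 1(1)] by blast
    next
      case 2
      have "dir_deriv (s *\<^sub>R b) \<phi> x = s *\<^sub>R dir_deriv b \<phi> x" for s x
        using has_derivative_linear[OF smooth_has_derivative[OF test_functionsD(1)[OF \<phi>]]] by (rule linear_scale)
      then have "(\<lambda>p. ?D p c) = truncated_xray S (Suc k) (dir_deriv b \<phi>)"
        using 2 by (simp add: truncated_xray_def[abs_def] mult_ac)
      then show ?thesis using test_dir_deriv[OF \<phi> 2(1)] by blast
    qed
  qed
qed (use assms in blast)

text \<open>
  The lines that meet the support of \<open>\<phi>\<close> form the image \<open>C\<close> of the compact product of that support with the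
  sphere, because every point of the support lies on exactly one line of each direction.
\<close>
lemma xray_test_function:
  fixes \<phi> :: "'a::euclidean_space \<Rightarrow> complex"
  assumes \<phi>: "\<phi> \<in> test_functions V"
  shows "xray \<phi> \<in> line_test_functions (lines_meeting V)"
proof -
  obtain R where R: "0 < R" "\<And>x. R \<le> norm x \<Longrightarrow> \<phi> x = 0" by (rule test_bounds[OF \<phi>]) blast
  let ?K = "closure {x. \<phi> x \<noteq> 0}"
  have K: "compact ?K" "?K \<subseteq> V" using test_functionsD[OF \<phi>] by auto
  have "xray \<phi> \<in> smooth_line_functions"
    unfolding smooth_line_functions_def
  proof (intro CollectI ballI)
    fix p :: "'a \<times> 'a" assume p: "p \<in> line_space"
    define U where "U = {q :: 'a \<times> 'a. norm (fst q) < norm (fst p) + 1} \<inter> {q. 1 / 2 < norm (snd q)}"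
    \<comment> \<open>As \<open>norm (z + s *\<^sub>R \<theta>) \<ge> \<bar>s\<bar> - norm z\<close> on the line space, parameters beyond \<open>S\<close> lie outside the support.\<close>
    define S where "S = 2 * (R + norm (fst p) + 1)"
    have "open U" unfolding U_def by (intro open_Int open_Collect_less continuous_intros)
    moreover have "p \<in> U" using p by (auto simp: U_def line_space_def)
    moreover have "smooth_on U (truncated_xray S 0 \<phi>)"
      using smooth_truncated_xray[OF \<phi>, of S 0] by (auto simp: smooth_functions_def smooth_on_def)
    moreover have "truncated_xray S 0 \<phi> q = xray \<phi> q" if q: "q \<in> U \<inter> line_space" for q
    proof -
      have "(indicator {-S..S} s * s ^ 0) *\<^sub>R \<phi> (fst q + s *\<^sub>R snd q) = \<phi> (fst q + s *\<^sub>R snd q)" for s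
      proof (cases "s \<in> {-S..S}")
        case False
        then have "S < \<bar>s\<bar>" by auto
        have "norm (snd q) = 1" using q by (auto simp: line_space_def)
        then have "\<bar>s\<bar> - norm (fst q) \<le> norm (fst q + s *\<^sub>R snd q)"
          using norm_triangle_ineq2[of "s *\<^sub>R snd q" "- fst q"] by (simp add: add.commute)
        moreover have "norm (fst q) < norm (fst p) + 1" using q by (auto simp: U_def)
        moreover have "R \<le> X" if "A - Q \<le> X" "Q < P + 1" "2 * (R + P + 1) < A" "0 \<le> P" for A Q X P
          using that R(1) by (simp add: algebra_simps)
        ultimately have "R \<le> norm (fst q + s *\<^sub>R snd q)"
          using \<open>S < \<bar>s\<bar>\<close> norm_ge_zero[of "fst p"] unfolding S_def by blast
        then show ?thesis by (simp add: R)
      qed simp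
      then show ?thesis by (simp add: truncated_xray_def xray_def case_prod_unfold)
    qed
    ultimately show "\<exists>U g. open U \<and> p \<in> U \<and> smooth_on U g \<and> (\<forall>q\<in>U \<inter> line_space. g q = xray \<phi> q)" by blast
  qed
  moreover define C where "C = (\<lambda>(x, \<theta>). (x - (x \<bullet> \<theta>) *\<^sub>R \<theta>, \<theta>)) ` (?K \<times> sphere 0 1)"
  have "compact C" unfolding C_def case_prod_unfold
    by (intro compact_continuous_image compact_Times K compact_sphere continuous_intros)
  have "{p \<in> line_space. xray \<phi> p \<noteq> 0} \<subseteq> C"
  proof (clarsimp)
    fix z \<theta> :: 'a assume l: "(z, \<theta>) \<in> line_space" and nz: "xray \<phi> (z, \<theta>) \<noteq> 0"
    have "\<exists>s. \<phi> (z + s *\<^sub>R \<theta>) \<noteq> 0"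
    proof (rule ccontr)
      assume "\<not> ?thesis"
      then have "xray \<phi> (z, \<theta>) = 0" by (simp add: xray_def)
      then show False using nz by simp
    qed
    then obtain s where s: "\<phi> (z + s *\<^sub>R \<theta>) \<noteq> 0" by blast
    have th: "norm \<theta> = 1" "z \<bullet> \<theta> = 0" "\<theta> \<bullet> \<theta> = 1" using l by (auto simp: line_space_def norm_eq_1)
    show "(z, \<theta>) \<in> C" unfolding C_def
    proof (rule image_eqI[of _ _ "(z + s *\<^sub>R \<theta>, \<theta>)"])
      show "(z, \<theta>) = (case (z + s *\<^sub>R \<theta>, \<theta>) of (x, \<theta>) \<Rightarrow> (x - (x \<bullet> \<theta>) *\<^sub>R \<theta>, \<theta>))"
        using th by (simp add: inner_add_left)
      show "(z + s *\<^sub>R \<theta>, \<theta>) \<in> ?K \<times> sphere 0 1"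
        using s th closure_subset[of "{x. \<phi> x \<noteq> 0}"] by auto
    qed
  qed
  then have bd: "bounded {p \<in> line_space. xray \<phi> p \<noteq> 0}"
    and cl: "closure {p \<in> line_space. xray \<phi> p \<noteq> 0} \<subseteq> C"
    using bounded_subset[OF compact_imp_bounded[OF \<open>compact C\<close>]]
      closure_minimal[OF _ compact_imp_closed[OF \<open>compact C\<close>]] by auto
  have "compact (closure {p \<in> line_space. xray \<phi> p \<noteq> 0})" using bd by (simp only: compact_closure)
  moreover have "C \<subseteq> lines_meeting V"
  proof (clarsimp simp: C_def)
    fix x \<theta> :: 'a assume x: "x \<in> ?K" and th: "norm \<theta> = 1"
    have "\<theta> \<bullet> \<theta> = 1" using th by (simp add: norm_eq_1)
    then have "(x - (x \<bullet> \<theta>) *\<^sub>R \<theta>) \<bullet> \<theta> = 0" by (simp add: inner_diff_left)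
    moreover have "x - (x \<bullet> \<theta>) *\<^sub>R \<theta> + (x \<bullet> \<theta>) *\<^sub>R \<theta> \<in> V" using x K by auto
    ultimately show "(x - (x \<bullet> \<theta>) *\<^sub>R \<theta>, \<theta>) \<in> lines_meeting V"
      using th unfolding lines_meeting_def line_space_def by blast
  qed
  ultimately show ?thesis using cl unfolding line_test_functions_def by blast
qed

section \<open>Compactly supported distributions\<close>

lemma iter_deriv_sum:
  assumes "finite A" "\<And>i. i \<in> A \<Longrightarrow> f i \<in> smooth_functions" "bs \<in> lists Basis"
  shows "iter_deriv bs (\<lambda>x. \<Sum>i\<in>A. c i * f i x) = (\<lambda>x. \<Sum>i\<in>A. c i * iter_deriv bs (f i) x)"
  using assms(1,2)
proof (induction A rule: finite_induct)
  case (insert a A)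
  have "(\<lambda>x. \<Sum>i\<in>A. c i * f i x) \<in> smooth_functions"
    using insert by (intro smooth_sum smooth_cmult) auto
  then have "iter_deriv bs (\<lambda>x. c a * f a x + 1 * (\<Sum>i\<in>A. c i * f i x))
     = (\<lambda>x. c a * iter_deriv bs (f a) x + 1 * iter_deriv bs (\<lambda>x. \<Sum>i\<in>A. c i * f i x) x)"
    using insert by (intro iter_deriv_linear_combination assms(3)) auto
  then show ?case using insert by simp
qed (simp add: iter_deriv_zero)

locale compactly_supported =
  fixes u :: "'a::euclidean_space distribution" and K :: "'a set" and C :: real and N :: nat
  assumes lin: "linear_functional_on smooth_functions u"
    and K: "compact K" "K \<noteq> {}"
    and est: "\<And>\<phi>. \<phi> \<in> smooth_functions \<Longrightarrow> norm (u \<phi>) \<le> C * compact_seminorm K N \<phi>"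
begin

lemma linear_combination:
  "f \<in> smooth_functions \<Longrightarrow> g \<in> smooth_functions \<Longrightarrow> u (\<lambda>x. c * f x + d * g x) = c * u f + d * u g"
proof -
  assume f: "f \<in> smooth_functions" and g: "g \<in> smooth_functions"
  have add: "u (\<lambda>x. f x + g x) = u f + u g" if "f \<in> smooth_functions" "g \<in> smooth_functions" for f g
    using lin that by (simp add: linear_functional_on_def)
  have mul: "u (\<lambda>x. c * f x) = c * u f" if "f \<in> smooth_functions" for f c
    using lin that by (simp add: linear_functional_on_def)
  show ?thesis using add[OF smooth_cmult[OF f] smooth_cmult[OF g], of c d] mul[OF f] mul[OF g] by simp
qed

lemma difference: "f \<in> smooth_functions \<Longrightarrow> g \<in> smooth_functions \<Longrightarrow> u (\<lambda>x. f x - g x) = u f - u g"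
  using linear_combination[of f g 1 "-1"] by simp

lemma scale: "f \<in> smooth_functions \<Longrightarrow> u (\<lambda>x. c * f x) = c * u f"
  using linear_combination[of f f c 0] by simp

lemma finite_sum:
  assumes "finite A" "\<And>i. i \<in> A \<Longrightarrow> f i \<in> smooth_functions"
  shows "u (\<lambda>x. \<Sum>i\<in>A. c i * f i x) = (\<Sum>i\<in>A. c i * u (f i))"
  using assms
proof (induction A rule: finite_induct)
  case empty
  show ?case using scale[OF smooth_zero, of 0] by simp
next
  case (insert a A)
  have "u (\<lambda>x. c a * f a x + 1 * (\<Sum>i\<in>A. c i * f i x)) = c a * u (f a) + 1 * u (\<lambda>x. \<Sum>i\<in>A. c i * f i x)"
    using insert by (intro linear_combination smooth_sum smooth_cmult) auto
  then show ?case using insert by simp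
qed

definition orders :: "'a list set" where
  "orders = {bs. bs \<in> lists Basis \<and> length bs \<le> N}"

lemma finite_orders: "finite orders"
  unfolding orders_def using finite_lists_length_le[OF finite_Basis, of N] by (simp add: lists_eq_set conj_commute)

definition bound :: real where "bound = \<bar>C\<bar> * real (card orders)"

lemma bound_nonneg: "bound \<ge> 0" by (simp add: bound_def)

lemma estimate:
  assumes \<phi>: "\<phi> \<in> smooth_functions" and e: "\<And>bs y. bs \<in> orders \<Longrightarrow> y \<in> K \<Longrightarrow> norm (iter_deriv bs \<phi> y) \<le> e"
  shows "norm (u \<phi>) \<le> bound * e"
proof -
  have "compact_seminorm K N \<phi> \<le> (\<Sum>bs\<in>orders. e)"
    unfolding compact_seminorm_def orders_def[symmetric]
    by (intro sum_mono cSUP_least K e)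
  moreover have "0 \<le> compact_seminorm K N \<phi>"
    unfolding compact_seminorm_def
  proof (rule sum_nonneg)
    fix bs :: "'a list" assume "bs \<in> {bs. bs \<in> lists Basis \<and> length bs \<le> N}"
    then have "continuous_on K (\<lambda>x. norm (iter_deriv bs \<phi> x))"
      by (intro continuous_intros smooth_continuous smooth_iter_deriv \<phi>) auto
    then have "bdd_above ((\<lambda>x. norm (iter_deriv bs \<phi> x)) ` K)"
      by (intro bounded_imp_bdd_above compact_imp_bounded compact_continuous_image K)
    moreover obtain x where "x \<in> K" using K by auto
    ultimately show "0 \<le> (SUP x\<in>K. norm (iter_deriv bs \<phi> x))"
      by (meson cSUP_upper norm_ge_zero order_trans)
  qed
  ultimately have "\<bar>C\<bar> * compact_seminorm K N \<phi> \<le> \<bar>C\<bar> * (real (card orders) * e)"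
    by (intro mult_left_mono) auto
  moreover have "C * compact_seminorm K N \<phi> \<le> \<bar>C\<bar> * compact_seminorm K N \<phi>"
    using \<open>0 \<le> compact_seminorm K N \<phi>\<close> by (intro mult_right_mono) auto
  ultimately show ?thesis using est[OF \<phi>] by (simp add: bound_def mult.assoc)
qed

context
  fixes \<Phi> :: "'a \<Rightarrow> complex" assumes \<Phi>: "\<Phi> \<in> test_functions UNIV"
begin

lemma \<Phi>_smooth: "\<Phi> \<in> smooth_functions" using test_functionsD[OF \<Phi>] by simp

lemma uniform_bounds:
  obtains L R where "0 \<le> L" "0 < R"
    "\<And>bs x y. bs \<in> orders \<Longrightarrow> norm (iter_deriv bs \<Phi> x - iter_deriv bs \<Phi> y) \<le> L * norm (x - y)"
    "\<And>bs x y. y \<in> K \<Longrightarrow> R < norm x \<Longrightarrow> iter_deriv bs \<Phi> (y - x) = 0"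
proof -
  have "\<forall>bs\<in>orders. \<exists>L\<ge>0. \<forall>x y. norm (iter_deriv bs \<Phi> x - iter_deriv bs \<Phi> y) \<le> L * norm (x - y)"
  proof
    fix bs assume "bs \<in> orders"
    then have "iter_deriv bs \<Phi> \<in> test_functions UNIV" by (intro test_iter_deriv \<Phi>) (auto simp: orders_def)
    then show "\<exists>L\<ge>0. \<forall>x y. norm (iter_deriv bs \<Phi> x - iter_deriv bs \<Phi> y) \<le> L * norm (x - y)"
      by (rule test_bounds) blast
  qed
  then obtain l where l: "\<And>bs. bs \<in> orders \<Longrightarrow> 0 \<le> l bs"
    "\<And>bs x y. bs \<in> orders \<Longrightarrow> norm (iter_deriv bs \<Phi> x - iter_deriv bs \<Phi> y) \<le> l bs * norm (x - y)" by metis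
  define L where "L = (\<Sum>bs\<in>orders. l bs)"
  have L: "l bs \<le> L" if "bs \<in> orders" for bs
    unfolding L_def using that l finite_orders by (intro member_le_sum) auto
  obtain Q where Q: "compact Q" "\<And>x bs. x \<notin> Q \<Longrightarrow> iter_deriv bs \<Phi> x = 0"
    by (rule test_functionsE[OF \<Phi>]) blast
  obtain q where q: "q > 0" "\<And>x. x \<in> Q \<Longrightarrow> norm x < q"
    using compact_imp_bounded[OF Q(1)] by (meson bounded_pos_less)
  obtain k where k: "k > 0" "\<And>x. x \<in> K \<Longrightarrow> norm x < k"
    using compact_imp_bounded[OF K(1)] by (meson bounded_pos_less)
  show ?thesis
  proof (rule that[of L "q + k"])
    show "0 \<le> L" unfolding L_def by (intro sum_nonneg l)
    show "norm (iter_deriv bs \<Phi> x - iter_deriv bs \<Phi> y) \<le> L * norm (x - y)" if "bs \<in> orders" for bs x y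
      using l(2)[OF that, of x y] mult_right_mono[OF L[OF that], of "norm (x - y)"] by simp
    show "iter_deriv bs \<Phi> (y - x) = 0" if "y \<in> K" "q + k < norm x" for bs x y
    proof (rule Q(2))
      have "norm (y - x) > q" using norm_triangle_ineq2[of x y] k(2)[OF that(1)] that(2)
        by (simp add: norm_minus_commute)
      then show "y - x \<notin> Q" using q(2) by force
    qed
  qed (use q k in auto)
qed

lemma translate_smooth: "translate x \<Phi> \<in> smooth_functions"
  by (rule smooth_translate[OF \<Phi>_smooth])

lemma iter_deriv_translate_orders: "bs \<in> orders \<Longrightarrow> iter_deriv bs (translate x \<Phi>) = (translate x (iter_deriv bs \<Phi>))"
  by (rule iter_deriv_translate[OF \<Phi>_smooth]) (simp add: orders_def)

lemma translates_Lipschitz: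
  assumes L: "\<And>bs x y. bs \<in> orders \<Longrightarrow> norm (iter_deriv bs \<Phi> x - iter_deriv bs \<Phi> y) \<le> L * norm (x - y)"
  shows "norm (u (translate x \<Phi>) - u (translate x' \<Phi>)) \<le> bound * L * norm (x - x')"
proof -
  have "u (translate x \<Phi>) - u (translate x' \<Phi>) = u (\<lambda>y. 1 * \<Phi> (y - x) + (-1) * \<Phi> (y - x'))"
    unfolding linear_combination[OF translate_smooth translate_smooth] by simp
  also have "norm \<dots> \<le> bound * (L * norm (x - x'))"
  proof (rule estimate)
    show "(\<lambda>y. 1 * \<Phi> (y - x) + (-1) * \<Phi> (y - x')) \<in> smooth_functions"
      by (intro smooth_linear_combination translate_smooth)
    fix bs y assume bs: "bs \<in> orders"
    then have bsB: "bs \<in> lists Basis" by (simp add: orders_def)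
    have "iter_deriv bs (\<lambda>y. 1 * \<Phi> (y - x) + (-1) * \<Phi> (y - x')) y = iter_deriv bs \<Phi> (y - x) - iter_deriv bs \<Phi> (y - x')"
      unfolding iter_deriv_linear_combination[OF translate_smooth translate_smooth bsB] iter_deriv_translate_orders[OF bs] by simp
    then show "norm (iter_deriv bs (\<lambda>y. 1 * \<Phi> (y - x) + (-1) * \<Phi> (y - x')) y) \<le> L * norm (x - x')"
      using L[OF bs, of "y - x" "y - x'"] by (simp add: norm_minus_commute)
  qed
  finally show ?thesis by (simp add: mult.assoc)
qed

lemma translates_continuous: "continuous_on UNIV (\<lambda>x. u (translate x \<Phi>))"
proof -
  obtain L R where L: "0 \<le> L" "\<And>bs x y. bs \<in> orders \<Longrightarrow> norm (iter_deriv bs \<Phi> x - iter_deriv bs \<Phi> y) \<le> L * norm (x - y)"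
    by (rule uniform_bounds) blast
  have "(bound * L)-lipschitz_on UNIV (\<lambda>x. u (translate x \<Phi>))"
    using translates_Lipschitz[OF L(2)] L(1) bound_nonneg by (intro lipschitz_onI) (auto simp: dist_norm)
  then show ?thesis by (rule lipschitz_on_continuous_on)
qed

lemma translates_zero:
  assumes "\<And>bs y. y \<in> K \<Longrightarrow> iter_deriv bs \<Phi> (y - x) = 0"
  shows "u (translate x \<Phi>) = 0"
proof -
  have "norm (u (translate x \<Phi>)) \<le> bound * 0"
    by (rule estimate[OF translate_smooth]) (simp add: iter_deriv_translate_orders assms)
  then show ?thesis by simp
qed

lemma translates_integrable: "integrable lborel (\<lambda>x. u (translate x \<Phi>))"
proof -
  obtain L R where R: "0 < R" "\<And>bs x y. y \<in> K \<Longrightarrow> R < norm x \<Longrightarrow> iter_deriv bs \<Phi> (y - x) = 0"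
    by (rule uniform_bounds) blast
  have "integrable lborel (\<lambda>x. indicator (cball 0 R) x *\<^sub>R u (translate x \<Phi>))"
    by (intro borel_integrable_compact continuous_on_subset[OF translates_continuous]) auto
  also have "(\<lambda>x. indicator (cball 0 R) x *\<^sub>R u (translate x \<Phi>)) = (\<lambda>x. u (translate x \<Phi>))"
    using translates_zero R(2) by (auto simp: fun_eq_iff indicator_def)
  finally show ?thesis .
qed

text \<open>
  A Fubini theorem for the pairing with \<open>u\<close>. Replacing the integration variable \<open>x\<close> by a simple function \<open>s i x\<close>
  turns both sides into the same finite sum, by linearity. The error is controlled by the common Lipschitz
  constant of the derivatives of \<open>\<Phi>\<close> up to the order of \<open>u\<close>, hence by \<open>\<delta> i\<close>.
\<close>
lemma integral_translates:
  assumes m: "locally_integrable m"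
  shows "(\<integral>x. u (translate x \<Phi>) * m x \<partial>lborel) = u (conv \<Phi> m)"
proof -
  obtain L R where L: "0 \<le> L" "\<And>bs x y. bs \<in> orders \<Longrightarrow> norm (iter_deriv bs \<Phi> x - iter_deriv bs \<Phi> y) \<le> L * norm (x - y)"
    and R: "0 < R" "\<And>bs x y. y \<in> K \<Longrightarrow> R < norm x \<Longrightarrow> iter_deriv bs \<Phi> (y - x) = 0"
    by (rule uniform_bounds) blast
  define h where "h x = u (translate x \<Phi>)" for x
  \<comment> \<open>Translates of \<open>\<Phi>\<close> by more than \<open>R\<close> vanish near \<open>K\<close>, so \<open>m\<close> may be truncated to an integrable weight.\<close>
  define mW where "mW x = indicator (cball 0 R) x *\<^sub>R m x" for x
  have imW: "integrable lborel mW" using m unfolding mW_def locally_integrable_def set_integrable_def by auto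
  have [measurable]: "m \<in> borel_measurable borel" using m by (simp add: locally_integrable_def)
  have [measurable]: "mW \<in> borel_measurable borel" using imW by auto
  have [measurable]: "h \<in> borel_measurable borel" unfolding h_def
    by (rule borel_measurable_continuous_onI[OF translates_continuous])
  obtain s :: "nat \<Rightarrow> 'a \<Rightarrow> 'a" where s: "\<And>i. simple_function lborel (s i)" "\<And>x. (\<lambda>i. s i x) \<longlonglongrightarrow> x"
      "\<And>i x. dist (s i x) 0 \<le> 2 * dist x 0"
    using borel_measurable_implies_sequence_metric[of "\<lambda>x. x" lborel "0::'a"] by auto
  have [measurable]: "s i \<in> borel_measurable borel" for i
    using borel_measurable_simple_function[OF s(1)] by simp
  have sn: "norm (s i x) \<le> 2 * norm x" for i x using s(3)[of i x] by simp
  have fin: "finite (range (s i))" for i using s(1)[of i] by (auto simp: simple_function_def)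
  define cc where "cc i v = (\<integral>x. indicator (s i -` {v}) x *\<^sub>R mW x \<partial>lborel)" for i v
  have icc: "integrable lborel (\<lambda>x. indicator (s i -` {v}) x *\<^sub>R mW x)" for i v
  proof -
    have "s i -` {v} \<inter> space borel \<in> sets borel" by (rule measurable_sets[of _ borel borel]) auto
    then show ?thesis by (intro integrable_mult_indicator imW) simp
  qed
  have step: "(\<integral>x. G (s i x) * mW x \<partial>lborel) = (\<Sum>v\<in>range (s i). cc i v * G v) \<and> integrable lborel (\<lambda>x. G (s i x) * mW x)"
    for G :: "'a \<Rightarrow> complex" and i
  proof -
    have e: "(\<lambda>x. G (s i x) * mW x) = (\<lambda>x. \<Sum>v\<in>range (s i). G v * (indicator (s i -` {v}) x *\<^sub>R mW x))"
    proof
      fix x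
      have "(\<Sum>v\<in>range (s i). G v * (indicator (s i -` {v}) x *\<^sub>R mW x)) = (\<Sum>v\<in>range (s i). if v = s i x then G (s i x) * mW x else 0)"
        by (intro sum.cong) (auto simp: indicator_def)
      then show "G (s i x) * mW x = (\<Sum>v\<in>range (s i). G v * (indicator (s i -` {v}) x *\<^sub>R mW x))"
        using fin[of i] by simp
    qed
    have i: "integrable lborel (\<lambda>x. G v * (indicator (s i -` {v}) x *\<^sub>R mW x))" for v
      by (rule integrable_mult_right[OF icc])
    have "(\<integral>x. (\<Sum>v\<in>range (s i). G v * (indicator (s i -` {v}) x *\<^sub>R mW x)) \<partial>lborel) = (\<Sum>v\<in>range (s i). cc i v * G v)"
      unfolding Bochner_Integration.integral_sum[OF i] cc_def integral_mult_right_zero by (simp only: mult.commute)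
    moreover have "integrable lborel (\<lambda>x. \<Sum>v\<in>range (s i). G v * (indicator (s i -` {v}) x *\<^sub>R mW x))"
      by (rule Bochner_Integration.integrable_sum) (rule i)
    ultimately show ?thesis unfolding e by (rule conjI)
  qed
  define \<delta> where "\<delta> i = (\<integral>x. norm (s i x - x) * norm (mW x) \<partial>lborel)" for i
  have i\<delta>: "integrable lborel (\<lambda>x. norm (s i x - x) * norm (mW x))" for i
  proof (rule Bochner_Integration.integrable_bound[of _ "\<lambda>x. (3 * R) * norm (mW x)"])
    show "AE x in lborel. norm (norm (s i x - x) * norm (mW x)) \<le> norm ((3 * R) * norm (mW x))"
    proof (rule AE_I2)
      fix x
      show "norm (norm (s i x - x) * norm (mW x)) \<le> norm ((3 * R) * norm (mW x))"
      proof (cases "norm x \<le> R")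
        case True
        have "norm (s i x - x) \<le> 3 * R"
          using norm_triangle_ineq4[of "s i x" x] sn[of i x] True by linarith
        then show ?thesis using R(1) by (simp add: abs_mult mult_right_mono)
      qed (simp add: mW_def)
    qed
  qed (use imW in auto)
  have \<delta>_lim: "\<delta> \<longlonglongrightarrow> 0"
  proof -
    have "(\<lambda>i. \<integral>x. norm (s i x - x) * norm (mW x) \<partial>lborel) \<longlonglongrightarrow> (\<integral>x. 0 \<partial>(lborel :: 'a measure))"
    proof (rule integral_dominated_convergence)
      show "integrable lborel (\<lambda>x. (3 * R) * norm (mW x))" using imW by auto
      show "AE x in lborel. norm (norm (s i x - x) * norm (mW x)) \<le> (3 * R) * norm (mW x)" for i
      proof (rule AE_I2)
        fix x
        show "norm (norm (s i x - x) * norm (mW x)) \<le> (3 * R) * norm (mW x)"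
        proof (cases "norm x \<le> R")
          case True
          have "norm (s i x - x) \<le> 3 * R"
            using norm_triangle_ineq4[of "s i x" x] sn[of i x] True by linarith
          then show ?thesis by (simp add: abs_mult mult_right_mono)
        qed (simp add: mW_def)
      qed
      show "AE x in lborel. (\<lambda>i. norm (s i x - x) * norm (mW x)) \<longlonglongrightarrow> 0"
      proof (rule AE_I2)
        fix x
        have "(\<lambda>i. norm (s i x - x) * norm (mW x)) \<longlonglongrightarrow> norm (x - x) * norm (mW x)"
          by (intro tendsto_intros s)
        then show "(\<lambda>i. norm (s i x - x) * norm (mW x)) \<longlonglongrightarrow> 0" by simp
      qed
    qed auto
    then show ?thesis by (simp add: \<delta>_def[abs_def])
  qed
  have close: "norm ((\<integral>x. G (s i x) * mW x \<partial>lborel) - (\<integral>x. G x * mW x \<partial>lborel)) \<le> M * \<delta> i"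
    if lip: "\<And>x y. norm (G x - G y) \<le> M * norm (x - y)" and iG: "integrable lborel (\<lambda>x. G x * mW x)"
    for G :: "'a \<Rightarrow> complex" and M i
  proof -
    have "(\<integral>x. G (s i x) * mW x \<partial>lborel) - (\<integral>x. G x * mW x \<partial>lborel) = (\<integral>x. G (s i x) * mW x - G x * mW x \<partial>lborel)"
      using step[of G i] iG by (intro Bochner_Integration.integral_diff[symmetric]) auto
    also have "norm \<dots> \<le> (\<integral>x. M * (norm (s i x - x) * norm (mW x)) \<partial>lborel)"
    proof (rule norm_integral_le)
      show "integrable lborel (\<lambda>x. G (s i x) * mW x - G x * mW x)" using step[of G i] iG by auto
      show "integrable lborel (\<lambda>x. M * (norm (s i x - x) * norm (mW x)))" using i\<delta> by auto
      show "norm (G (s i x) * mW x - G x * mW x) \<le> M * (norm (s i x - x) * norm (mW x))" for x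
        using mult_right_mono[OF lip[of "s i x" x], of "norm (mW x)"]
        by (simp add: left_diff_distrib[symmetric] norm_mult mult.assoc)
    qed
    finally show ?thesis by (simp add: \<delta>_def)
  qed
  have hW: "h x * m x = h x * mW x" for x
    using translates_zero R(2) by (auto simp: mW_def h_def indicator_def)
  have h_bounded: "integrable lborel (\<lambda>x. h x * mW x)"
  proof -
    have "compact (h ` cball 0 R)" unfolding h_def
      by (intro compact_continuous_image continuous_on_subset[OF translates_continuous]) auto
    then obtain B where B: "\<And>x. x \<in> cball 0 R \<Longrightarrow> norm (h x) \<le> B"
      using compact_imp_bounded bounded_iff by (metis imageI)
    show ?thesis
    proof (rule Bochner_Integration.integrable_bound[of _ "\<lambda>x. B * norm (mW x)"])
      show "AE x in lborel. norm (h x * mW x) \<le> norm (B * norm (mW x))"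
      proof (rule AE_I2)
        fix x
        show "norm (h x * mW x) \<le> norm (B * norm (mW x))"
        proof (cases "norm x \<le> R")
          case True
          then have "norm (h x) \<le> \<bar>B\<bar>" using B[of x] by simp
          then show ?thesis by (simp add: norm_mult abs_mult mult_right_mono)
        qed (simp add: mW_def)
      qed
    qed (use imW in auto)
  qed
  have psi: "norm ((\<Sum>v\<in>range (s i). cc i v * iter_deriv bs \<Phi> (y - v)) - conv (iter_deriv bs \<Phi>) m y) \<le> L * \<delta> i"
    if bs: "bs \<in> orders" and y: "y \<in> K" for bs y i
  proof -
    have t: "iter_deriv bs \<Phi> \<in> test_functions UNIV" using bs by (intro test_iter_deriv \<Phi>) (simp add: orders_def)
    have e: "iter_deriv bs \<Phi> (y - x) * m x = iter_deriv bs \<Phi> (y - x) * mW x" for x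
      using R(2)[OF y, of x bs] by (auto simp: mW_def indicator_def)
    have "norm ((\<integral>x. iter_deriv bs \<Phi> (y - s i x) * mW x \<partial>lborel) - (\<integral>x. iter_deriv bs \<Phi> (y - x) * mW x \<partial>lborel)) \<le> L * \<delta> i"
    proof (rule close[of "\<lambda>x. iter_deriv bs \<Phi> (y - x)"])
      show "norm (iter_deriv bs \<Phi> (y - x) - iter_deriv bs \<Phi> (y - x')) \<le> L * norm (x - x')" for x x'
        using L(2)[OF bs, of "y - x" "y - x'"] by (simp add: norm_minus_commute)
      show "integrable lborel (\<lambda>x. iter_deriv bs \<Phi> (y - x) * mW x)"
        unfolding e[symmetric] by (rule conv_integrable[OF t m])
    qed
    then show ?thesis
      using step[of "\<lambda>x. iter_deriv bs \<Phi> (y - x)" i] by (simp add: conv_def e)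
  qed
  have "norm ((\<integral>x. h x * m x \<partial>lborel) - u (conv \<Phi> m)) \<le> 2 * (bound * L) * \<delta> i" for i
  proof -
    define g where "g y = (\<Sum>v\<in>range (s i). cc i v * \<Phi> (y - v))" for y
    have gs: "g \<in> smooth_functions" unfolding g_def using fin by (intro smooth_sum smooth_cmult translate_smooth)
    have ug: "u g = (\<integral>x. h (s i x) * mW x \<partial>lborel)"
    proof -
      have "u g = (\<Sum>v\<in>range (s i). cc i v * h v)"
        unfolding g_def[abs_def] h_def by (rule finite_sum[OF fin translate_smooth])
      then show ?thesis using step[of h i] by simp
    qed
    have "norm (u g - u (conv \<Phi> m)) = norm (u (\<lambda>y. 1 * g y + (-1) * conv \<Phi> m y))"
      using linear_combination[OF gs smooth_conv[OF \<Phi> m], of 1 "-1"] by simp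
    also have "\<dots> \<le> bound * (L * \<delta> i)"
    proof (rule estimate)
      show "(\<lambda>y. 1 * g y + (-1) * conv \<Phi> m y) \<in> smooth_functions"
        by (intro smooth_linear_combination gs smooth_conv[OF \<Phi> m])
      fix bs y assume bs: "bs \<in> orders" and y: "y \<in> K"
      then have bsB: "bs \<in> lists Basis" by (simp add: orders_def)
      have "iter_deriv bs (\<lambda>y. 1 * g y + (-1) * conv \<Phi> m y) y = 1 * iter_deriv bs g y + (-1) * iter_deriv bs (conv \<Phi> m) y"
        by (subst iter_deriv_linear_combination[OF gs smooth_conv[OF \<Phi> m] bsB]) (rule refl)
      also have "iter_deriv bs g = (\<lambda>y. \<Sum>v\<in>range (s i). cc i v * iter_deriv bs \<Phi> (y - v))"
        unfolding g_def[abs_def]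
        by (subst iter_deriv_sum[OF fin translate_smooth bsB]) (simp add: iter_deriv_translate_orders[OF bs])
      also have "iter_deriv bs (conv \<Phi> m) = conv (iter_deriv bs \<Phi>) m"
        by (rule iter_deriv_conv[OF \<Phi> m bsB])
      finally show "norm (iter_deriv bs (\<lambda>y. 1 * g y + (-1) * conv \<Phi> m y) y) \<le> L * \<delta> i"
        using psi[OF bs y, of i] by simp
    qed
    finally have 1: "norm (u g - u (conv \<Phi> m)) \<le> bound * L * \<delta> i" by (simp add: mult.assoc)
    have 2: "norm (u g - (\<integral>x. h x * m x \<partial>lborel)) \<le> bound * L * \<delta> i"
      unfolding ug hW
      by (rule close[OF _ h_bounded]) (use translates_Lipschitz[OF L(2)] in \<open>simp add: h_def\<close>)
    have "norm ((\<integral>x. h x * m x \<partial>lborel) - u (conv \<Phi> m)) \<le> norm ((\<integral>x. h x * m x \<partial>lborel) - u g) + norm (u g - u (conv \<Phi> m))"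
      using norm_triangle_ineq[of "(\<integral>x. h x * m x \<partial>lborel) - u g" "u g - u (conv \<Phi> m)"] by simp
    then show ?thesis using 1 2 by (simp add: norm_minus_commute)
  qed
  moreover have "(\<lambda>i. 2 * (bound * L) * \<delta> i) \<longlonglongrightarrow> 2 * (bound * L) * 0" by (intro tendsto_intros \<delta>_lim)
  ultimately have "norm ((\<integral>x. h x * m x \<partial>lborel) - u (conv \<Phi> m)) \<le> 2 * (bound * L) * 0"
    by (intro LIMSEQ_le_const) auto
  then show ?thesis by (simp add: h_def)
qed

end

text \<open>
  The functional sees only the derivatives on \<open>K\<close>, and a cutoff function that is \<open>1\<close> near \<open>K\<close> does not change these.
\<close>
lemma determined_by_test_functions:
  assumes z: "\<And>\<phi>. \<phi> \<in> test_functions UNIV \<Longrightarrow> u \<phi> = 0" and \<phi>: "\<phi> \<in> smooth_functions"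
  shows "u \<phi> = 0"
proof -
  obtain R where R: "R > 0" "\<And>x. x \<in> K \<Longrightarrow> norm x < R"
    using compact_imp_bounded[OF K(1)] by (meson bounded_pos_less)
  obtain g :: "'a \<Rightarrow> complex" where g: "g \<in> test_functions UNIV" "\<And>y. y \<in> ball 0 R \<Longrightarrow> g y = 1"
    using cutoff_exists[OF R(1)] by metis
  obtain Q where Q: "g \<in> smooth_functions" "compact Q" "\<And>x bs. x \<notin> Q \<Longrightarrow> iter_deriv bs g x = 0"
    by (rule test_functionsE[OF g(1)]) blast
  have gs: "(\<lambda>y. g y * \<phi> y) \<in> smooth_functions" by (rule smooth_mult[OF Q(1) \<phi>])
  have t: "(\<lambda>y. g y * \<phi> y) \<in> test_functions UNIV"
    by (rule test_functionsI[OF gs Q(2)]) (use Q(3)[of _ "[]"] in auto)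
  have "norm (u (\<lambda>y. \<phi> y - g y * \<phi> y)) \<le> bound * 0"
  proof (rule estimate[OF smooth_diff[OF \<phi> gs]])
    fix bs y assume y: "y \<in> K"
    have "iter_deriv bs (\<lambda>y. \<phi> y - g y * \<phi> y) y = iter_deriv bs (\<lambda>y. 0) y"
      by (rule iter_deriv_local_cong[of "ball 0 R"]) (use g(2) R(2)[OF y] in auto)
    then show "norm (iter_deriv bs (\<lambda>y. \<phi> y - g y * \<phi> y) y) \<le> 0" by (simp add: iter_deriv_zero)
  qed
  then show ?thesis using difference[OF \<phi> gs] z[OF t] by simp
qed

end

section \<open>Rapidly decaying functions\<close>

text \<open>
  Layer cake: the integrand is the integral of \<open>g t\<close> over \<open>t \<ge> norm x\<close>. After exchanging the integrals the
  inner one is the volume of a ball of radius \<open>t\<close>, which grows like \<open>t ^ DIM('a)\<close> and leaves an integrand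
  of order \<open>inverse (1 + t) ^ 2\<close>.
\<close>
lemma integrable_inverse_power_norm:
  "integrable lborel (\<lambda>x::'a::euclidean_space. inverse (1 + norm x) ^ (DIM('a) + 1))"
proof (rule integrableI_bounded)
  let ?n = "DIM('a)"
  define m where "m = ?n + 1"
  define v where "v = unit_ball_vol (real ?n)"
  have v: "v \<ge> 0" by (simp add: v_def)
  define g where "g t = real m * inverse (1 + t) ^ (m + 1)" for t :: real
  have lim: "((\<lambda>t::real. - (inverse (1 + t) ^ Suc k)) \<longlongrightarrow> 0) at_top" for k
  proof -
    have "((\<lambda>t::real. - (inverse (1 + t) ^ Suc k)) \<longlongrightarrow> - (0 ^ Suc k)) at_top"
      by (intro tendsto_intros tendsto_inverse_0_at_top filterlim_tendsto_add_at_top[OF tendsto_const] filterlim_ident)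
    then show ?thesis by simp
  qed
  have der: "DERIV (\<lambda>t. - (inverse (1 + t) ^ Suc k)) t :> real (Suc k) * inverse (1 + t) ^ (Suc k + 1)" if "0 \<le> t" for t k
  proof -
    have "((\<lambda>t. 1 + t) has_real_derivative 1) (at t)" by (auto intro!: derivative_eq_intros)
    then have "((\<lambda>t. - (inverse (1 + t) ^ Suc k)) has_real_derivative
        - (real (Suc k) * (- (inverse (1 + t) * 1 * inverse (1 + t)) * inverse (1 + t) ^ (Suc k - Suc 0)))) (at t)"
      using that by (intro DERIV_minus DERIV_power DERIV_inverse') auto
    then show ?thesis by (rule DERIV_cong) (simp add: mult_ac)
  qed
  have layer: "ennreal (inverse (1 + norm x) ^ m) = (\<integral>\<^sup>+t. ennreal (g t) * indicator {norm x..} t \<partial>lborel)" for x :: 'a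
  proof -
    have "(\<integral>\<^sup>+t. ennreal (g t) * indicator {norm x..} t \<partial>lborel) = ennreal (0 - (- (inverse (1 + norm x) ^ Suc ?n)))"
    proof (rule nn_integral_FTC_atLeast[OF _ _ _ lim])
      show "g \<in> borel_measurable borel" unfolding g_def by measurable
      show "DERIV (\<lambda>t. - (inverse (1 + t) ^ Suc ?n)) t :> g t" if "norm x \<le> t" for t
        using der[of t ?n] that norm_ge_zero[of x] by (simp add: g_def m_def)
      show "0 \<le> g t" if "norm x \<le> t" for t
      proof -
        have "0 \<le> 1 + t" using that norm_ge_zero[of x] by linarith
        then show ?thesis by (auto simp: g_def intro!: mult_nonneg_nonneg)
      qed
    qed
    then show ?thesis by (simp add: m_def)
  qed
  have [measurable]: "g \<in> borel_measurable borel" unfolding g_def by measurable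
  have "(\<integral>\<^sup>+x. ennreal (inverse (1 + norm x) ^ m) \<partial>(lborel :: 'a measure))
     = (\<integral>\<^sup>+x. \<integral>\<^sup>+t. ennreal (g t) * (if norm x \<le> t then 1 else 0) \<partial>lborel \<partial>(lborel :: 'a measure))"
    unfolding layer by (intro nn_integral_cong) (auto simp: indicator_def)
  also have "\<dots> = (\<integral>\<^sup>+t. \<integral>\<^sup>+x. ennreal (g t) * (if norm x \<le> t then 1 else 0) \<partial>(lborel :: 'a measure) \<partial>lborel)"
    by (rule lborel_pair.Fubini') (unfold borel_measurable_lborel_pair, measurable)
  also have "\<dots> \<le> (\<integral>\<^sup>+t. ennreal (real m * v) * (ennreal (inverse (1 + t) ^ 2) * indicator {0..} t) \<partial>lborel)"
  proof (rule nn_integral_mono)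
    fix t :: real
    show "(\<integral>\<^sup>+x. ennreal (g t) * (if norm x \<le> t then 1 else 0) \<partial>(lborel :: 'a measure)) \<le> ennreal (real m * v) * (ennreal (inverse (1 + t) ^ 2) * indicator {0..} t)"
    proof (cases "0 \<le> t")
      case False
      then have "\<not> norm x \<le> t" for x :: 'a using norm_ge_zero[of x] by linarith
      then show ?thesis by simp
    next
      case True
      have "(\<integral>\<^sup>+x. ennreal (g t) * (if norm x \<le> t then 1 else 0) \<partial>(lborel :: 'a measure)) = (\<integral>\<^sup>+x. ennreal (g t) * indicator (cball 0 t) x \<partial>(lborel :: 'a measure))"
        by (intro nn_integral_cong) (auto simp: indicator_def)
      also have "\<dots> = ennreal (g t) * ennreal (v * t ^ ?n)"
        using True by (subst nn_integral_cmult_indicator) (auto simp: emeasure_cball v_def)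
      also have "\<dots> = ennreal (g t * (v * t ^ ?n))"
        by (rule ennreal_mult[symmetric]) (use True v in \<open>auto simp: g_def\<close>)
      also have "\<dots> \<le> ennreal ((real m * v) * inverse (1 + t) ^ 2)"
      proof (rule ennreal_leI)
        have "inverse (1 + t) ^ ?n * t ^ ?n = (t / (1 + t)) ^ ?n" by (simp add: power_mult_distrib divide_inverse mult.commute)
        also have "\<dots> \<le> 1" using True by (intro power_le_one) auto
        finally have "(real m * v * inverse (1 + t) ^ 2) * (inverse (1 + t) ^ ?n * t ^ ?n) \<le> (real m * v * inverse (1 + t) ^ 2) * 1"
          using True v by (intro mult_left_mono) auto
        moreover have "g t * (v * t ^ ?n) = (real m * v * inverse (1 + t) ^ 2) * (inverse (1 + t) ^ ?n * t ^ ?n)"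
          by (simp add: g_def m_def power2_eq_square mult_ac)
        ultimately show "g t * (v * t ^ ?n) \<le> (real m * v) * inverse (1 + t) ^ 2"
          by (simp only: mult_1_right)
      qed
      also have "\<dots> = ennreal (real m * v) * ennreal (inverse (1 + t) ^ 2)"
        by (rule ennreal_mult) (use v in auto)
      finally show ?thesis using True by simp
    qed
  qed
  also have "\<dots> = ennreal (real m * v) * (\<integral>\<^sup>+t. ennreal (inverse (1 + t) ^ 2) * indicator {0..} t \<partial>lborel)"
    by (rule nn_integral_cmult) measurable
  also have "(\<integral>\<^sup>+t. ennreal (inverse (1 + t) ^ 2) * indicator {0..} t \<partial>lborel) = ennreal (0 - (- (inverse (1 + 0) ^ Suc 0)))"
    by (rule nn_integral_FTC_atLeast[OF _ _ _ lim]) (use der[of _ 0] in \<open>auto simp: power2_eq_square\<close>)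
  also have "ennreal (real m * v) * \<dots> < \<infinity>" by (simp add: ennreal_mult_less_top)
  finally show "(\<integral>\<^sup>+x. ennreal (norm (inverse (1 + norm x) ^ (?n + 1))) \<partial>(lborel :: 'a measure)) < \<infinity>"
    by (simp add: m_def abs_mult power_abs)
qed measurable

lemma rapidly_decaying_integrable:
  fixes f :: "'a::euclidean_space \<Rightarrow> complex"
  assumes "f \<in> rapidly_decaying_functions"
  shows "integrable lborel f" "\<exists>B\<ge>0. \<forall>x. norm (f x) \<le> B" "continuous_on UNIV f"
proof -
  show c: "continuous_on UNIV f" using assms by (simp add: rapidly_decaying_functions_def)
  have b: "\<exists>B. \<forall>x. (1 + norm x) ^ k * norm (f x) \<le> B" for k
    using assms unfolding rapidly_decaying_functions_def bounded_iff by (auto dest!: spec[of _ k])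
  obtain B0 where "\<And>x. norm (f x) \<le> B0" using b[of 0] by auto
  moreover from this have "B0 \<ge> 0" using norm_ge_zero order_trans by blast
  ultimately show "\<exists>B\<ge>0. \<forall>x. norm (f x) \<le> B" by blast
  obtain B where B: "\<And>x. (1 + norm x) ^ (DIM('a) + 1) * norm (f x) \<le> B" using b by blast
  show "integrable lborel f"
  proof (rule Bochner_Integration.integrable_bound[of _ "\<lambda>x. B * inverse (1 + norm x) ^ (DIM('a) + 1)"])
    show "integrable lborel (\<lambda>x::'a. B * inverse (1 + norm x) ^ (DIM('a) + 1))"
      using integrable_inverse_power_norm by (rule integrable_mult_right)
    show "f \<in> borel_measurable lborel" using borel_measurable_continuous_onI[OF c] by simp
    show "AE x in lborel. norm (f x) \<le> norm (B * inverse (1 + norm x) ^ (DIM('a) + 1))"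
    proof (rule AE_I2)
      fix x :: 'a
      have p: "0 < (1 + norm x) ^ (DIM('a) + 1)" by (intro zero_less_power add_pos_nonneg) auto
      have "norm (f x) \<le> B / (1 + norm x) ^ (DIM('a) + 1)"
        using B[of x] p by (simp add: pos_le_divide_eq mult.commute)
      also have "\<dots> = B * inverse (1 + norm x) ^ (DIM('a) + 1)" by (simp add: divide_inverse power_inverse)
      finally show "norm (f x) \<le> norm (B * inverse (1 + norm x) ^ (DIM('a) + 1))" by (rule order_trans) simp
    qed
  qed
qed

locale bounded_integrable =
  fixes f :: "'a::euclidean_space \<Rightarrow> complex" and B :: real
  assumes cont: "continuous_on UNIV f" and int: "integrable lborel f" and B: "0 \<le> B" "\<And>x. norm (f x) \<le> B"
begin

lemma f_measurable [measurable]: "f \<in> borel_measurable borel"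
  by (rule borel_measurable_continuous_onI[OF cont])

lemma times_test_integrable:
  assumes "\<phi> \<in> test_functions V" shows "integrable lborel (\<lambda>y. f y * \<phi> y)"
proof -
  obtain M where M: "\<And>x. norm (\<phi> x) \<le> M" by (rule test_bounds[OF assms]) blast
  have [measurable]: "\<phi> \<in> borel_measurable borel" by (rule test_borel_measurable[OF assms])
  show ?thesis
    by (rule Bochner_Integration.integrable_bound[of _ "\<lambda>y. M * norm (f y)"])
       (use int M in \<open>auto intro!: AE_I2 mult_left_mono order_trans[OF _ abs_ge_self] simp: norm_mult mult.commute[of M]\<close>)
qed

lemma linear_combination:
  assumes "\<phi> \<in> test_functions V" "\<psi> \<in> test_functions V"
  shows "distribution_of f (\<lambda>x. c * \<phi> x + d * \<psi> x) = c * distribution_of f \<phi> + d * distribution_of f \<psi>"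
proof -
  have "distribution_of f (\<lambda>x. c * \<phi> x + d * \<psi> x) = (\<integral>x. c * (f x * \<phi> x) + d * (f x * \<psi> x) \<partial>lborel)"
    unfolding distribution_of_def by (simp add: algebra_simps)
  also have "\<dots> = c * (\<integral>x. f x * \<phi> x \<partial>lborel) + d * (\<integral>x. f x * \<psi> x \<partial>lborel)"
    using times_test_integrable[OF assms(1)] times_test_integrable[OF assms(2)] by simp
  finally show ?thesis by (simp add: distribution_of_def)
qed

text \<open>
  Split the kernel at \<open>norm w = 1\<close>: inside it is integrable and \<open>f\<close> is bounded, outside it is at most \<open>1\<close> and
  \<open>f\<close> is integrable.
\<close>
lemma Riesz_potential_bound:
  assumes dim: "2 \<le> DIM('a)"
  obtains D where "\<And>v. integrable lborel (\<lambda>w. norm (f (v + w)) * riesz_kernel w)"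
    "\<And>v. (\<integral>w. norm (f (v + w)) * riesz_kernel w \<partial>lborel) \<le> D"
proof -
  define k1 where "k1 w = indicator (cball 0 1) w * riesz_kernel w" for w :: 'a
  have ik1: "integrable lborel k1"
  proof -
    have "integrable lborel (\<lambda>w::'a. Re (indicator (cball 0 1) w *\<^sub>R complex_of_real (riesz_kernel w)))"
      using riesz_kernel_locally_integrable[OF dim] unfolding locally_integrable_def set_integrable_def by (intro integrable_Re) auto
    then show ?thesis by (simp add: k1_def[abs_def])
  qed
  have bd: "norm (f (v + w)) * riesz_kernel w \<le> B * k1 w + norm (f (v + w))" for v w
  proof (cases "norm w \<le> 1")
    case True
    then show ?thesis using mult_right_mono[OF B(2) riesz_kernel_nonneg, of "v + w" w]
      by (simp add: k1_def add_increasing2)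
  next
    case False
    have "riesz_kernel w \<le> 1" unfolding riesz_kernel_def
      using False by (intro power_le_one) (auto simp: inverse_le_1_iff)
    then show ?thesis using False by (simp add: k1_def mult_left_le)
  qed
  have if1: "integrable lborel (\<lambda>w. norm (f (v + w)))" for v
    using lborel_reflect_translate(4)[of "\<lambda>w. norm (f w)" v] int by simp
  have If1: "(\<integral>w. norm (f (v + w)) \<partial>lborel) = (\<integral>w. norm (f w) \<partial>lborel)" for v
    using lborel_reflect_translate(3)[of "\<lambda>w. norm (f w)" v] by simp
  define D where "D = B * (\<integral>w. k1 w \<partial>lborel) + (\<integral>w. norm (f w) \<partial>lborel)"
  have ifk: "integrable lborel (\<lambda>w. norm (f (v + w)) * riesz_kernel w)" for v
    by (rule Bochner_Integration.integrable_bound[of _ "\<lambda>w. B * k1 w + norm (f (v + w))"])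
       (use ik1 if1 bd in \<open>auto intro!: AE_I2 order_trans[OF _ abs_ge_self] simp: riesz_kernel_nonneg abs_mult\<close>)
  have IfkD: "(\<integral>w. norm (f (v + w)) * riesz_kernel w \<partial>lborel) \<le> D" for v
  proof -
    have "(\<integral>w. norm (f (v + w)) * riesz_kernel w \<partial>lborel) \<le> (\<integral>w. B * k1 w + norm (f (v + w)) \<partial>lborel)"
      by (rule integral_mono[OF ifk _ bd]) (use ik1 if1 in auto)
    also have "\<dots> = D" using ik1 if1 If1 by (simp add: D_def)
    finally show ?thesis .
  qed
  show ?thesis by (rule that[OF ifk IfkD])
qed

context
  fixes \<Phi> :: "'a \<Rightarrow> complex" assumes \<Phi>: "\<Phi> \<in> test_functions UNIV"
begin

lemma translate_test: "translate x \<Phi> \<in> test_functions UNIV"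
  by (rule test_translate[OF \<Phi>]) auto

lemma \<Phi>_measurable [measurable]: "\<Phi> \<in> borel_measurable borel"
  by (rule test_borel_measurable[OF \<Phi>])

lemma \<Phi>_integrable: "integrable lborel \<Phi>"
  using conv_integrable[OF \<Phi> continuous_imp_locally_integrable[of "\<lambda>_. 1"], of 0]
    lborel_reflect_translate(2)[of \<Phi> 0] by simp

lemma translates_continuous: "continuous_on UNIV (\<lambda>x. distribution_of f (translate x \<Phi>))"
proof -
  obtain L where L: "0 \<le> L" "\<And>x y. norm (\<Phi> x - \<Phi> y) \<le> L * norm (x - y)" by (rule test_bounds[OF \<Phi>]) blast
  have "norm (distribution_of f (translate x \<Phi>) - distribution_of f (translate x' \<Phi>)) \<le> (L * (\<integral>y. norm (f y) \<partial>lborel)) * norm (x - x')" for x x'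
  proof -
    have i: "integrable lborel (\<lambda>y. f y * \<Phi> (y - x))" for x by (rule times_test_integrable[OF translate_test])
    have "distribution_of f (translate x \<Phi>) - distribution_of f (translate x' \<Phi>) = (\<integral>y. f y * \<Phi> (y - x) - f y * \<Phi> (y - x') \<partial>lborel)"
      unfolding distribution_of_def by (rule Bochner_Integration.integral_diff[symmetric]) (rule i)+
    also have "norm \<dots> \<le> (\<integral>y. (L * norm (x - x')) * norm (f y) \<partial>lborel)"
    proof (rule norm_integral_le)
      show "norm (f y * \<Phi> (y - x) - f y * \<Phi> (y - x')) \<le> (L * norm (x - x')) * norm (f y)" for y
        using mult_right_mono[OF L(2)[of "y - x" "y - x'"], of "norm (f y)"]
        by (simp add: right_diff_distrib[symmetric] norm_mult norm_minus_commute mult_ac)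
    qed (use i int in auto)
    finally show ?thesis by (simp add: mult_ac)
  qed
  then have "(L * (\<integral>y. norm (f y) \<partial>lborel))-lipschitz_on UNIV (\<lambda>x. distribution_of f (translate x \<Phi>))"
    using L(1) by (intro lipschitz_onI) (auto simp: dist_norm intro!: mult_nonneg_nonneg)
  then show ?thesis by (rule lipschitz_on_continuous_on)
qed

lemma product_integrable:
  assumes e[measurable]: "e \<in> borel_measurable borel" and ne: "\<And>x. norm (e x :: complex) = 1"
  shows "integrable (lborel \<Otimes>\<^sub>M lborel) (\<lambda>(y, x). f y * (\<Phi> (y - x) * e x))"
proof (rule lborel_pair.Fubini_integrable)
  show "(\<lambda>(y, x). f y * (\<Phi> (y - x) * e x)) \<in> borel_measurable (lborel \<Otimes>\<^sub>M lborel)"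
    unfolding borel_measurable_lborel_pair by measurable
  have i: "integrable lborel (\<lambda>x. norm (\<Phi> (y - x)))" for y
    using lborel_reflect_translate(2)[of "\<lambda>x. norm (\<Phi> x)" y] \<Phi>_integrable by simp
  have I: "(\<integral>x. norm (\<Phi> (y - x)) \<partial>lborel) = (\<integral>x. norm (\<Phi> x) \<partial>lborel)" for y
    using lborel_reflect_translate(1)[of "\<lambda>x. norm (\<Phi> x)" y] by simp
  show "integrable lborel (\<lambda>y. \<integral>x. norm (case (y, x) of (y, x) \<Rightarrow> f y * (\<Phi> (y - x) * e x)) \<partial>lborel)"
    using int by (simp add: norm_mult ne I)
  have "integrable lborel (\<lambda>x. f y * (\<Phi> (y - x) * e x))" for y
    by (rule Bochner_Integration.integrable_bound[of _ "\<lambda>x. norm (f y) * norm (\<Phi> (y - x))"])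
       (use i in \<open>auto simp: norm_mult ne intro!: AE_I2\<close>)
  then show "AE y in lborel. integrable lborel (\<lambda>x. case (y, x) of (y, x) \<Rightarrow> f y * (\<Phi> (y - x) * e x))" by simp
qed

lemma translates_integrable: "integrable lborel (\<lambda>x. distribution_of f (translate x \<Phi>))"
  using lborel_pair.integrable_snd[OF product_integrable[of "\<lambda>_. 1"]] by (simp add: distribution_of_def)

lemma translates_Fourier:
  "(\<integral>x. distribution_of f (translate x \<Phi>) * cis (- (x \<bullet> \<xi>)) \<partial>lborel) = (\<integral>y. f y * cis (- (y \<bullet> \<xi>)) \<partial>lborel) * test_transform \<Phi> \<xi>"
proof -
  have m: "(\<lambda>x. cis (- (x \<bullet> \<xi>))) \<in> borel_measurable borel"
    by (intro borel_measurable_continuous_onI continuous_intros)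
  have "(\<integral>x. distribution_of f (translate x \<Phi>) * cis (- (x \<bullet> \<xi>)) \<partial>lborel) = (\<integral>x. (\<integral>y. f y * (\<Phi> (y - x) * cis (- (x \<bullet> \<xi>))) \<partial>lborel) \<partial>lborel)"
    by (simp add: distribution_of_def mult.assoc flip: integral_mult_left_zero)
  also have "\<dots> = (\<integral>y. (\<integral>x. f y * (\<Phi> (y - x) * cis (- (x \<bullet> \<xi>))) \<partial>lborel) \<partial>lborel)"
    by (rule lborel_pair.Fubini_integral[OF product_integrable[OF m]]) simp
  also have "\<dots> = (\<integral>y. (f y * cis (- (y \<bullet> \<xi>))) * test_transform \<Phi> \<xi> \<partial>lborel)"
    using conv_cis[OF \<Phi>, of \<xi>] by (simp add: conv_def mult.assoc)
  finally show ?thesis by simp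
qed

text \<open>
  Moving the translation from \<open>\<Phi>\<close> to \<open>f\<close> turns the integral into the pairing of the Riesz potential of \<open>f\<close> with a
  test function supported in \<open>V\<close>.
\<close>
lemma translates_Riesz:
  assumes dim: "2 \<le> DIM('a)" and V: "(translate c \<Phi>) \<in> test_functions V"
    and N: "\<And>x. x \<in> V \<Longrightarrow> (\<integral>w. f (x + w) * of_real (riesz_kernel w) \<partial>lborel) = 0"
  shows "(\<integral>x. distribution_of f (translate x \<Phi>) * of_real (riesz_kernel (x - c)) \<partial>lborel) = 0"
proof -
  define \<Phi>c where "\<Phi>c v = \<Phi> (v - c)" for v
  have [measurable]: "\<Phi>c \<in> borel_measurable borel" unfolding \<Phi>c_def by measurable
  have i\<Phi>c: "integrable lborel \<Phi>c"
    using lborel_reflect_translate(4)[of \<Phi> "- c"] \<Phi>_integrable by (simp add: \<Phi>c_def[abs_def])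
  obtain D where ifk: "\<And>v. integrable lborel (\<lambda>w. norm (f (v + w)) * riesz_kernel w)"
    and IfkD: "\<And>v. (\<integral>w. norm (f (v + w)) * riesz_kernel w \<partial>lborel) \<le> D"
    by (rule Riesz_potential_bound[OF dim]) blast
  let ?G = "\<lambda>v w. \<Phi>c v * (f (v + w) * of_real (riesz_kernel w))"
  have G: "integrable (lborel \<Otimes>\<^sub>M lborel) (\<lambda>(v, w). ?G v w)"
  proof (rule lborel_pair.Fubini_integrable)
    show "(\<lambda>(v, w). ?G v w) \<in> borel_measurable (lborel \<Otimes>\<^sub>M lborel)"
      unfolding borel_measurable_lborel_pair by measurable
    have e: "(\<integral>w. norm (case (v, w) of (v, w) \<Rightarrow> ?G v w) \<partial>lborel) = norm (\<Phi>c v) * (\<integral>w. norm (f (v + w)) * riesz_kernel w \<partial>lborel)" for v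
      by (simp add: norm_mult riesz_kernel_nonneg)
    show "integrable lborel (\<lambda>v. \<integral>w. norm (case (v, w) of (v, w) \<Rightarrow> ?G v w) \<partial>lborel)"
      unfolding e
    proof (rule Bochner_Integration.integrable_bound[of _ "\<lambda>v. norm (\<Phi>c v) * D"])
      show "AE v in lborel. norm (norm (\<Phi>c v) * (\<integral>w. norm (f (v + w)) * riesz_kernel w \<partial>lborel)) \<le> norm (norm (\<Phi>c v) * D)"
      proof (rule AE_I2)
        fix v
        have n0: "0 \<le> (\<integral>w. norm (f (v + w)) * riesz_kernel w \<partial>lborel)"
          by (intro Bochner_Integration.integral_nonneg) (simp add: riesz_kernel_nonneg)
        then have "\<bar>\<integral>w. norm (f (v + w)) * riesz_kernel w \<partial>lborel\<bar> \<le> \<bar>D\<bar>" using IfkD[of v] by linarith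
        then show "norm (norm (\<Phi>c v) * (\<integral>w. norm (f (v + w)) * riesz_kernel w \<partial>lborel)) \<le> norm (norm (\<Phi>c v) * D)"
          by (simp add: abs_mult mult_left_mono)
      qed
      show "(\<lambda>v. norm (\<Phi>c v) * (\<integral>w. norm (f (v + w)) * riesz_kernel w \<partial>lborel)) \<in> borel_measurable lborel"
        by measurable
    qed (use i\<Phi>c in auto)
    show "AE v in lborel. integrable lborel (\<lambda>w. case (v, w) of (v, w) \<Rightarrow> ?G v w)"
    proof (rule AE_I2)
      fix v
      have "integrable lborel (\<lambda>w. f (v + w) * complex_of_real (riesz_kernel w))"
        by (rule Bochner_Integration.integrable_bound[OF ifk[of v]])
           (auto simp: norm_mult riesz_kernel_nonneg)
      then show "integrable lborel (\<lambda>w. case (v, w) of (v, w) \<Rightarrow> ?G v w)" by simp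
    qed
  qed
  have shift: "distribution_of f (translate (c + w) \<Phi>) = (\<integral>v. f (v + w) * \<Phi>c v \<partial>lborel)" for w
    using lborel_reflect_translate(3)[of "\<lambda>y. f y * \<Phi> (y - (c + w))" w]
    by (simp add: distribution_of_def \<Phi>c_def algebra_simps)
  have [measurable]: "(\<lambda>x. distribution_of f (translate x \<Phi>)) \<in> borel_measurable borel"
    by (rule borel_measurable_continuous_onI[OF translates_continuous])
  have "(\<integral>x. distribution_of f (translate x \<Phi>) * of_real (riesz_kernel (x - c)) \<partial>lborel)
      = (\<integral>w. distribution_of f (translate (c + w) \<Phi>) * of_real (riesz_kernel (c + w - c)) \<partial>lborel)"
    by (rule lborel_reflect_translate(3)[symmetric]) measurable
  also have "\<dots> = (\<integral>w. (\<integral>v. ?G v w \<partial>lborel) \<partial>lborel)"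
  proof (rule Bochner_Integration.integral_cong[OF refl])
    fix w
    show "distribution_of f (translate (c + w) \<Phi>) * of_real (riesz_kernel (c + w - c)) = (\<integral>v. ?G v w \<partial>lborel)"
      unfolding shift integral_mult_left_zero[symmetric]
      by (intro Bochner_Integration.integral_cong) (auto simp: mult_ac)
  qed
  also have "\<dots> = (\<integral>v. (\<integral>w. ?G v w \<partial>lborel) \<partial>lborel)"
    by (rule lborel_pair.Fubini_integral[OF G])
  also have "\<dots> = (\<integral>v. \<Phi>c v * (\<integral>w. f (v + w) * of_real (riesz_kernel w) \<partial>lborel) \<partial>lborel)" by simp
  also have "\<dots> = (\<integral>v. 0 \<partial>(lborel :: 'a measure))"
  proof (rule Bochner_Integration.integral_cong[OF refl])
    fix v
    show "\<Phi>c v * (\<integral>w. f (v + w) * of_real (riesz_kernel w) \<partial>lborel) = 0"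
    proof (cases "v \<in> V")
      case False
      have "\<Phi>c v = 0"
        using test_functionsD(3)[OF V] closure_subset[of "{x. \<Phi> (x - c) \<noteq> 0}"] False by (auto simp: \<Phi>c_def)
      then show ?thesis by simp
    qed (simp add: N)
  qed
  finally show ?thesis by simp
qed

end

text \<open>
  Every line through a point of \<open>V\<close> meets \<open>V\<close>, so all inner integrals in the ray formula vanish.
\<close>
lemma normal_operator_zero:
  assumes dim: "2 \<le> DIM('a)" and z: "\<And>z \<theta>. (z, \<theta>) \<in> lines_meeting V \<Longrightarrow> xray f (z, \<theta>) = 0" and x: "x \<in> V"
  shows "(\<integral>w. f (x + w) * of_real (riesz_kernel w) \<partial>lborel) = 0"
proof -
  obtain D where D: "\<And>v. integrable lborel (\<lambda>w. norm (f (v + w)) * riesz_kernel w)"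
    by (rule Riesz_potential_bound[OF dim]) blast
  have ik: "integrable lborel (\<lambda>w. f (x + w) * of_real (riesz_kernel w))"
    by (rule Bochner_Integration.integrable_bound[OF D[of x]]) (auto simp: norm_mult riesz_kernel_nonneg)
  have line: "(\<integral>s. f (x + s *\<^sub>R y) \<partial>lborel) = 0" if "y \<noteq> 0" for y
  proof -
    define \<theta> where "\<theta> = sgn y"
    have th: "norm \<theta> = 1" "\<theta> \<bullet> \<theta> = 1" using that by (auto simp: \<theta>_def norm_sgn norm_eq_1[symmetric])
    have "(x - (x \<bullet> \<theta>) *\<^sub>R \<theta>) \<bullet> \<theta> = 0" using th by (simp add: inner_diff_left)
    moreover have "x - (x \<bullet> \<theta>) *\<^sub>R \<theta> + (x \<bullet> \<theta>) *\<^sub>R \<theta> \<in> V" using x by simp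
    ultimately have "(x - (x \<bullet> \<theta>) *\<^sub>R \<theta>, \<theta>) \<in> lines_meeting V"
      using th unfolding lines_meeting_def line_space_def by blast
    then have "(\<integral>s. f (x + s *\<^sub>R \<theta>) \<partial>lborel) = 0" using z xray_orthogonal_projection[of f x \<theta>] by simp
    then show ?thesis using integral_line_sgn[OF that, of f x] that by (simp add: \<theta>_def)
  qed
  have "of_real (2 / real DIM('a)) * (\<integral>w. f (x + w) * of_real (riesz_kernel w) \<partial>lborel) = (\<integral>y. (\<integral>s. cone_weight y *\<^sub>R f (x + s *\<^sub>R y) \<partial>lborel) \<partial>lborel)"
    by (rule integral_rays[OF dim _ ik, symmetric]) measurable
  also have "\<dots> = (\<integral>y. 0 \<partial>(lborel :: 'a measure))"
  proof (rule Bochner_Integration.integral_cong[OF refl])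
    fix y :: 'a
    show "(\<integral>s. cone_weight y *\<^sub>R f (x + s *\<^sub>R y) \<partial>lborel) = 0"
      using line[of y] by (cases "y = 0") (simp_all add: cone_weight_def)
  qed
  finally show ?thesis using dim by simp
qed

end

section \<open>Partial data uniqueness for the X-ray transform\<close>

text \<open>
  Both parts are instances of \<open>vanishing_if_normal_operator_vanishes\<close>; the function \<open>U\<close> is the Fourier
  transform of \<open>u\<close> or \<open>f\<close>. For a distribution, the vanishing of the Riesz potential on \<open>V\<close> is obtained by
  testing \<open>xray_dist u\<close> with the X-ray transforms of test functions on \<open>V\<close>.
\<close>
theorem theorem1p4:
  fixes V :: "(real ^ 'n) set"
  assumes "CARD('n) \<ge> 2" and "open V" and "V \<noteq> {}"
  shows "(\<forall>u \<in> compactly_supported_distributions \<inter> admissible V.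
            (\<forall>\<psi> \<in> line_test_functions (lines_meeting V). xray_dist u \<psi> = 0)
              \<longrightarrow> (\<forall>\<phi> \<in> smooth_functions. u \<phi> = 0))
       \<and> (\<forall>f \<in> rapidly_decaying_functions.
            distribution_of f \<in> admissible V \<longrightarrow>
            (\<forall>(z, \<theta>) \<in> lines_meeting V. xray f (z, \<theta>) = 0)
              \<longrightarrow> (\<forall>x. f x = 0))"
proof (intro conjI ballI impI allI)
  have dim: "2 \<le> DIM(real ^ 'n)" using assms(1) by simp
  {
    fix u :: "(real ^ 'n) distribution" and \<phi> :: "real ^ 'n \<Rightarrow> complex"
    assume u: "u \<in> compactly_supported_distributions \<inter> admissible V"
      and x: "\<forall>\<psi> \<in> line_test_functions (lines_meeting V). xray_dist u \<psi> = 0"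
      and \<phi>: "\<phi> \<in> smooth_functions"
    obtain K C N where "linear_functional_on smooth_functions u" "compact K" "K \<noteq> {}"
      "\<And>\<phi>. \<phi> \<in> smooth_functions \<Longrightarrow> norm (u \<phi>) \<le> C * compact_seminorm K N \<phi>"
      using u unfolding compactly_supported_distributions_def by blast
    then interpret compactly_supported u K C N by unfold_locales auto
    obtain P where P: "P \<noteq> 0" "vanishes_on V (const_coeff_op P u)"
      using u unfolding admissible_def by blast
    have normal: "u (conv \<psi> (\<lambda>w. of_real (riesz_kernel w))) = 0" if \<psi>: "\<psi> \<in> test_functions V" for \<psi>
    proof -
      have "xray_dist u (xray \<psi>) = 0" using x xray_test_function[OF \<psi>] by blast
      then show ?thesis
        using scale[OF smooth_conv[OF \<psi> riesz_kernel_locally_integrable[OF dim]], of 2]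
        by (simp add: xray_dist_def xray_adjoint_xray_test[OF dim \<psi>])
    qed
    have zero: "u \<Phi> = 0" if \<Phi>: "\<Phi> \<in> test_functions UNIV" for \<Phi>
    proof (rule vanishing_if_normal_operator_vanishes[OF assms P(1) _ _ _ _ _ P(2) \<Phi>,
          where U="\<lambda>\<xi>. u (\<lambda>y. cis (- (y \<bullet> \<xi>)))"])
      fix f :: "real ^ 'n \<Rightarrow> complex" assume f: "f \<in> test_functions UNIV"
      have fs: "f \<in> smooth_functions" using test_functionsD[OF f] by simp
      show "continuous_on UNIV (\<lambda>x. u (translate x f))" by (rule translates_continuous[OF f])
      show "integrable lborel (\<lambda>x. u (translate x f))" by (rule translates_integrable[OF f])
      show "u (\<lambda>x. c * f x + d * g x) = c * u f + d * u g" if "g \<in> test_functions UNIV" for g c d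
        using linear_combination[OF fs] test_functionsD(1)[OF that] by blast
      show "(\<integral>x. u (translate x f) * of_real (riesz_kernel (x - c)) \<partial>lborel) = 0"
        if V: "(translate c f) \<in> test_functions V" for c
      proof -
        let ?t = "\<lambda>x. u (translate x f)"
        have fc: "(translate c f) \<in> test_functions UNIV" using V test_mono[of V UNIV] by auto
        have [measurable]: "?t \<in> borel_measurable borel"
          by (rule borel_measurable_continuous_onI[OF translates_continuous[OF f]])
        have "(\<integral>x. ?t x * of_real (riesz_kernel (x - c)) \<partial>lborel) = (\<integral>x. ?t (c + x) * of_real (riesz_kernel (c + x - c)) \<partial>lborel)"
          by (rule lborel_reflect_translate(3)[symmetric]) measurable
        also have "\<dots> = (\<integral>x. u (\<lambda>y. (translate c f) (y - x)) * of_real (riesz_kernel x) \<partial>lborel)"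
          by (simp add: algebra_simps)
        also have "\<dots> = u (conv (translate c f) (\<lambda>w. of_real (riesz_kernel w)))"
          by (rule integral_translates[OF fc riesz_kernel_locally_integrable[OF dim]])
        also have "\<dots> = 0" by (rule normal[OF V])
        finally show ?thesis .
      qed
      show "(\<integral>x. u (translate x f) * cis (- (x \<bullet> \<xi>)) \<partial>lborel) = u (\<lambda>y. cis (- (y \<bullet> \<xi>))) * test_transform f \<xi>" for \<xi>
      proof -
        have c: "conv f (\<lambda>x. cis (- (x \<bullet> \<xi>))) = (\<lambda>y. test_transform f \<xi> * cis (y \<bullet> - \<xi>))"
          using conv_cis[OF f, of \<xi>] by (simp add: fun_eq_iff mult.commute)
        show ?thesis
          using integral_translates[OF f locally_integrable_cis, of \<xi>] scale[OF smooth_cis, of "test_transform f \<xi>" "- \<xi>"]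
          unfolding c by (simp add: mult.commute)
      qed
    qed
    show "u \<phi> = 0" by (rule determined_by_test_functions[OF zero \<phi>])
  next
    fix f :: "real ^ 'n \<Rightarrow> complex" and c :: "real ^ 'n"
    assume f: "f \<in> rapidly_decaying_functions" and a: "distribution_of f \<in> admissible V"
      and x: "\<forall>(z, \<theta>) \<in> lines_meeting V. xray f (z, \<theta>) = 0"
    obtain B where "B \<ge> 0" "\<And>x. norm (f x) \<le> B" using rapidly_decaying_integrable(2)[OF f] by blast
    then interpret bounded_integrable f B
      using rapidly_decaying_integrable(1,3)[OF f] by unfold_locales auto
    obtain P where P: "P \<noteq> 0" "vanishes_on V (const_coeff_op P (distribution_of f))"
      using a unfolding admissible_def by blast
    have N: "(\<integral>w. f (x + w) * of_real (riesz_kernel w) \<partial>lborel) = 0" if "x \<in> V" for x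
      by (rule normal_operator_zero[OF dim _ that]) (use x in auto)
    have zero: "distribution_of f \<Phi> = 0" if \<Phi>: "\<Phi> \<in> test_functions UNIV" for \<Phi>
    proof (rule vanishing_if_normal_operator_vanishes[OF assms P(1) _ _ _ _ _ P(2) \<Phi>])
      fix g :: "real ^ 'n \<Rightarrow> complex" assume g: "g \<in> test_functions UNIV"
      show "continuous_on UNIV (\<lambda>x. distribution_of f (translate x g))" by (rule translates_continuous[OF g])
      show "integrable lborel (\<lambda>x. distribution_of f (translate x g))" by (rule translates_integrable[OF g])
      show "distribution_of f (\<lambda>x. c * g x + d * g' x) = c * distribution_of f g + d * distribution_of f g'"
        if "g' \<in> test_functions UNIV" for g' c d
        by (rule linear_combination[OF g that])
      show "(\<integral>x. distribution_of f (translate x g) * of_real (riesz_kernel (x - c)) \<partial>lborel) = 0"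
        if "(translate c g) \<in> test_functions V" for c
        by (rule translates_Riesz[OF g dim that N])
      show "(\<integral>x. distribution_of f (translate x g) * cis (- (x \<bullet> \<xi>)) \<partial>lborel) = (\<integral>y. f y * cis (- (y \<bullet> \<xi>)) \<partial>lborel) * test_transform g \<xi>" for \<xi>
        by (rule translates_Fourier[OF g])
    qed
    show "f c = 0"
    proof (rule continuous_zero_by_localization[OF cont])
      fix r :: real assume "r > 0"
      then obtain e :: "real ^ 'n \<Rightarrow> real" where e: "(\<lambda>y. complex_of_real (e y)) \<in> test_functions (ball c r)"
        "continuous_on UNIV e" "\<And>y. e y \<ge> 0" "e c > 0" "\<And>y. y \<notin> ball c r \<Longrightarrow> e y = 0"
        using bump_exists by metis
      have "(\<integral>y. f y * of_real (e y) \<partial>lborel) = 0"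
        using zero[OF subsetD[OF test_mono[OF subset_UNIV] e(1)]] by (simp add: distribution_of_def)
      then show "\<exists>g. continuous_on UNIV g \<and> (\<forall>y. 0 \<le> (g y :: real)) \<and> 0 < g c \<and> (\<forall>y. y \<notin> ball c r \<longrightarrow> g y = 0) \<and>
          (\<integral>y. f y * of_real (g y) \<partial>lborel) = 0" using e by blast
    qed
  }
qed

end
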